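(* Suppose that the algebra $A$ is regular. Then the left $A$-module $\mathrm{Der}_K(A)$ is generated by the derivations $\partial_{\mathbf i,\mathbf j}$, $\mathbf i=(i_1,\dots,i_r)\in \mathbf I_r$, $\mathbf j=(j_1,\dots,j_{r+1})\in\mathbf J_{r+1}$, where $$\partial_{\mathbf i,\mathbf j}=\partial_{i_1,\dots,i_r;j_1,\dots,j_{r+1}}:=\det\begin{pmatrix}\overline{\frac{\partial f_{i_1}}{\partial x_{j_1}}}&\cdots&\overline{\frac{\partial f_{i_1}}{\partial x_{j_{r+1}}}}\\ \vdots&\vdots&\vdots\\ \overline{\frac{\partial f_{i_r}}{\partial x_{j_1}}}&\cdots&\overline{\frac{\partial f_{i_r}}{\partial x_{j_{r+1}}}}\\ \partial_{j_1}&\cdots&\partial_{j_{r+1}}\end{pmatrix},$$ and these generators satisfy the following defining relations (as a left $A$-module): $$\Delta(\mathbf i,\mathbf j)\,\partial_{\mathbf i',\mathbf j'}=\sum_{l=1}^s(-1)^{r+1+\nu_l}\,\Delta(\mathbf i';j_1',\dots,\widehat{j_{\nu_l}'},\dots,j_{r+1}')\,\partial_{\mathbf i;\mathbf j,j_{\nu_l}'}$$ for all $\mathbf i,\mathbf i'\in\mathbf I_r$, $\mathbf j=(j_1,\dots,j_r)\in\mathbf J_r$ and $\mathbf j'=(j_1',\dots,j_{r+1}')\in\mathbf J_{r+1}$, where $\{j_{\nu_1}',\dots,j_{\nu_s}'\}=\{j_1',\dots,j_{r+1}'\}\setminus\{j_1,\dots,j_r\}$.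
   Context: Setting: $K$ is a perfect field of characteristic $p>0$; $P_n=K[x_1,\dots,x_n]$ is a polynomial algebra; $I=\sum_{i=1}^m P_nf_i$ is a prime but not maximal ideal of $P_n$ with generators $f_1,\dots,f_m$; $A=S^{-1}(P_n/I)$ is the localization of $P_n/I$ at a multiplicatively closed subset $S$, assumed to be a domain, with field of fractions $Q$. The image of $f\in P_n$ in $A$ is written $\overline f$ (and $x_i$ is also written for $\overline{x}_i$). $\mathrm{Der}_K(A)$ is the left $A$-module of $K$-derivations of $A$. Minors: $\overline J=(\overline{\partial f_i/\partial x_j})\in M_{m,n}(A)$ is the Jacobi matrix and $r$ is its rank over $Q$. For $\mathbf i=(i_1,\dots,i_r)$ with $1\le i_1<\dots<i_r\le m$ and an $r$-tuple $\mathbf j=(j_1,\dots,j_r)$ of indices in $\{1,\dots,n\}$, $\Delta(\mathbf i,\mathbf j)=\Delta(\mathbf i;j_1,\dots,j_r)=\det(\overline J_{i_\nu,j_\mu})_{\nu,\mu=1,\dots,r}$ (equal to $1$ if $r=0$). A tuple $\mathbf i=(i_1,\dots,i_r)$ with $1\le i_1<\dots<i_r\le m$ (resp. a tuple $\mathbf j=(j_1,\dots,j_r)$ with $1\le j_1<\dots<j_r\le n$) is non-singular if $\Delta(\mathbf i,\mathbf j')\ne0$ for some increasing $\mathbf j'$ (resp. $\Delta(\mathbf i',\mathbf j)\neq0$ for some increasing $\mathbf i'$). $\mathbf I_r$ (resp. $\mathbf J_r$) is the set of all non-singular $r$-tuples $\mathbf i$ (resp. $\mathbf j$). $\mathbf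 J_{r+1}$ is the set of all $(r+1)$-tuples $(j_1,\dots,j_{r+1})$ with $1\le j_1<\dots<j_{r+1}\le n$ such that deleting some element $j_\nu$ gives a tuple in $\mathbf J_r$. A hat over a symbol means that it is omitted. Derivations: for $\mathbf i\in\mathbf I_r$ and distinct indices $c_1,\dots,c_{r+1}$ (in any order), the determinant is expanded along its last row: $\partial_{\mathbf i;c_1,\dots,c_{r+1}}=\sum_{\nu=1}^{r+1}(-1)^{r+1+\nu}\Delta(\mathbf i;c_1,\dots,\widehat{c_\nu},\dots,c_{r+1})\,\partial_{c_\nu}$ with $\partial_c=\partial/\partial x_c$; it is the $K$-derivation of $A$ sending $\overline{x}_{c_\nu}$ to $(-1)^{r+1+\nu}\Delta(\mathbf i;c_1,\dots,\widehat{c_\nu},\dots,c_{r+1})$ and the other $\overline{x}_k$ to $0$. $\partial_{\mathbf i;\mathbf j,c}$ means $\partial_{\mathbf i;j_1,\dots,j_r,c}$ with columns in this order; thus it is $\pm$ the generator attached to the increasing rearrangement of $(j_1,\dots,j_r,c)$, which belongs to $\mathbf J_{r+1}$ when $\mathbf j\in\mathbf J_r$ and $c\notin\{j_1,\dots,j_r\}$. *)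

theory Defs
  imports
    "HOL-Algebra.Algebraic_Closure_Type"
    "HOL-Algebra.QuotRing"
    "HOL-Algebra.Ring_Divisibility"
    "HOL-Library.Poly_Mapping"
    "HOL-Library.Extended_Nat"
    "HOL-Library.Function_Algebras"
    "HOL-Computational_Algebra.Fraction_Field"
    "Jordan_Normal_Form.DL_Rank"
begin

section \<open>Perfect fields and polynomial algebras\<close>

definition perfect_field :: "'k::field itself \<Rightarrow> bool" where
  "perfect_field _ \<longleftrightarrow> (\<forall>g :: 'k poly. irreducible g \<longrightarrow> coprime g (pderiv g))"

text \<open>Polynomials are finitely supported families of coefficients, indexed by finitely supported
  exponent vectors. The variables are numbered from 0, so \<open>P\<^sub>n\<close> consists of the polynomials in
  \<open>x\<^sub>0, \<dots>, x\<^bsub>n-1\<^esub>\<close>. All other indices (of the generators of the ideal, and of the positions in a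
  tuple) also start at 0.\<close>

type_synonym 'k mpol = "(nat \<Rightarrow>\<^sub>0 nat) \<Rightarrow>\<^sub>0 'k"

definition pol_ring :: "nat \<Rightarrow> 'k::field mpol ring" where
  "pol_ring n = \<lparr>carrier = {g. \<forall>e\<in>Poly_Mapping.keys g. Poly_Mapping.keys e \<subseteq> {..<n}},
     monoid.mult = (*), one = 1, ring.zero = 0, add = (+)\<rparr>"

definition pol_const :: "'k::field \<Rightarrow> 'k mpol" where
  "pol_const c = Poly_Mapping.single 0 c"

definition pol_pderiv :: "nat \<Rightarrow> 'k::field mpol \<Rightarrow> 'k mpol" where
  "pol_pderiv j g = (\<Sum>e\<in>Poly_Mapping.keys g.
     Poly_Mapping.single (e - Poly_Mapping.single j 1)
       (of_nat (Poly_Mapping.lookup e j) * Poly_Mapping.lookup g e))"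

section \<open>Localization and regular rings\<close>

definition loc_rel :: "('a, 'b) ring_scheme \<Rightarrow> 'a set \<Rightarrow> (('a \<times> 'a) \<times> ('a \<times> 'a)) set" where
  "loc_rel R S = {((a, s), (b, t)). a \<in> carrier R \<and> b \<in> carrier R \<and> s \<in> S \<and> t \<in> S \<and>
     (\<exists>u\<in>S. u \<otimes>\<^bsub>R\<^esub> (a \<otimes>\<^bsub>R\<^esub> t \<ominus>\<^bsub>R\<^esub> b \<otimes>\<^bsub>R\<^esub> s) = \<zero>\<^bsub>R\<^esub>)}"

text \<open>The fraction \<open>a / s\<close>.\<close>

definition loc_frac :: "('a, 'b) ring_scheme \<Rightarrow> 'a set \<Rightarrow> 'a \<Rightarrow> 'a \<Rightarrow> ('a \<times> 'a) set" where
  "loc_frac R S a s = loc_rel R S `` {(a, s)}"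

text \<open>Sums and products of classes are formed by taking the union over all representatives;
  for a commutative ring and a multiplicative set every representative contributes the same class.\<close>

definition localization :: "('a, 'b) ring_scheme \<Rightarrow> 'a set \<Rightarrow> ('a \<times> 'a) set ring" where
  "localization R S = \<lparr>carrier = (carrier R \<times> S) // loc_rel R S,
     monoid.mult = (\<lambda>U V. \<Union>(a, s)\<in>U. \<Union>(b, t)\<in>V. loc_frac R S (a \<otimes>\<^bsub>R\<^esub> b) (s \<otimes>\<^bsub>R\<^esub> t)),
     one = loc_frac R S \<one>\<^bsub>R\<^esub> \<one>\<^bsub>R\<^esub>,
     ring.zero = loc_frac R S \<zero>\<^bsub>R\<^esub> \<one>\<^bsub>R\<^esub>,
     add = (\<lambda>U V. \<Union>(a, s)\<in>U. \<Union>(b, t)\<in>V.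
       loc_frac R S (a \<otimes>\<^bsub>R\<^esub> t \<oplus>\<^bsub>R\<^esub> b \<otimes>\<^bsub>R\<^esub> s) (s \<otimes>\<^bsub>R\<^esub> t))\<rparr>"

definition krull_dim :: "('a, 'b) ring_scheme \<Rightarrow> enat" where
  "krull_dim R = Sup {enat k |k. \<exists>C :: nat \<Rightarrow> 'a set.
     (\<forall>i\<le>k. primeideal (C i) R) \<and> (\<forall>i<k. C i \<subset> C (Suc i))}"

definition regular_local_ring :: "('a, 'b) ring_scheme \<Rightarrow> bool" where
  "regular_local_ring R \<longleftrightarrow> cring R \<and> noetherian_ring R \<and>
     (\<exists>M. {M'. maximalideal M' R} = {M} \<and>
       krull_dim R = enat (LEAST d. \<exists>B\<subseteq>carrier R. finite B \<and> card B = d \<and> M = genideal R B))"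

definition regular_ring :: "('a, 'b) ring_scheme \<Rightarrow> bool" where
  "regular_ring R \<longleftrightarrow> cring R \<and> noetherian_ring R \<and>
     (\<forall>P. primeideal P R \<longrightarrow> regular_local_ring (localization R (carrier R - P)))"

section \<open>Modules of functions and derivations\<close>

text \<open>Functions into a ring with pointwise operations: used both for the module of derivations
  (functions from the ring to itself) and for the free module on a set of symbols.\<close>

definition fscale :: "'a::comm_ring_1 \<Rightarrow> ('b \<Rightarrow> 'a) \<Rightarrow> ('b \<Rightarrow> 'a)" where
  "fscale a F = (\<lambda>x. a * F x)"

interpretation fmod: Modules.module "fscale :: 'a::comm_ring_1 \<Rightarrow> ('b \<Rightarrow> 'a) \<Rightarrow> ('b \<Rightarrow> 'a)"
  by unfold_locales (auto simp: fscale_def plus_fun_def algebra_simps)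

text \<open>\<open>\<kappa>\<close> is the structure map of the algebra.\<close>

definition derivations :: "('k \<Rightarrow> 'a::comm_ring_1) \<Rightarrow> ('a \<Rightarrow> 'a) set" where
  "derivations \<kappa> = {D. (\<forall>a b. D (a + b) = D a + D b) \<and> (\<forall>a b. D (a * b) = a * D b + b * D a) \<and>
     (\<forall>c a. D (\<kappa> c * a) = \<kappa> c * D a)}"

section \<open>Minors of the Jacobi matrix and the attached derivations\<close>

definition mat_rank :: "'a::idom mat \<Rightarrow> nat" where
  "mat_rank J = vec_space.rank (dim_row J) (map_mat (\<lambda>a. Fraction_Field.Fract a 1) J)"

definition minor :: "'a::comm_ring_1 mat \<Rightarrow> nat list \<Rightarrow> nat list \<Rightarrow> 'a" where
  "minor J ii jj = det (mat (length ii) (length jj) (\<lambda>(a, b). J $$ (ii ! a, jj ! b)))"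

definition incr_tuples :: "nat \<Rightarrow> nat \<Rightarrow> nat list set" where
  "incr_tuples k N = {xs. length xs = k \<and> sorted_wrt (<) xs \<and> set xs \<subseteq> {..<N}}"

definition omit :: "nat \<Rightarrow> 'b list \<Rightarrow> 'b list" where
  "omit \<nu> xs = take \<nu> xs @ drop (Suc \<nu>) xs"

text \<open>In order: \<open>\<^bold>I\<^sub>r\<close>, \<open>\<^bold>J\<^sub>r\<close> and \<open>\<^bold>J\<^bsub>r+1\<^esub>\<close>, where \<open>r\<close> is the rank of \<open>J\<close>.\<close>

definition nonsing_rows :: "'a::idom mat \<Rightarrow> nat list set" where
  "nonsing_rows J = {ii \<in> incr_tuples (mat_rank J) (dim_row J).
     \<exists>jj \<in> incr_tuples (mat_rank J) (dim_col J). minor J ii jj \<noteq> 0}"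

definition nonsing_cols :: "'a::idom mat \<Rightarrow> nat list set" where
  "nonsing_cols J = {jj \<in> incr_tuples (mat_rank J) (dim_col J).
     \<exists>ii \<in> incr_tuples (mat_rank J) (dim_row J). minor J ii jj \<noteq> 0}"

definition ext_cols :: "'a::idom mat \<Rightarrow> nat list set" where
  "ext_cols J = {jj \<in> incr_tuples (mat_rank J + 1) (dim_col J).
     \<exists>\<nu> < mat_rank J + 1. omit \<nu> jj \<in> nonsing_cols J}"

text \<open>\<open>D\<close> is the derivation given by the expansion along the last row: here \<open>bar\<close> maps a polynomial
  to its image in the algebra, and the case in which \<open>g\<close> is a variable gives the values of \<open>D\<close> on
  the generators. The sign is \<open>(-1)\<^bsup>r+1+\<nu>\<^esup>\<close> when positions are counted from 1.\<close>

definition is_jacobi_derivation ::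
    "nat \<Rightarrow> ('k::field mpol \<Rightarrow> 'a::idom) \<Rightarrow> 'a mat \<Rightarrow> nat list \<Rightarrow> nat list \<Rightarrow> ('a \<Rightarrow> 'a) \<Rightarrow> bool" where
  "is_jacobi_derivation n bar J ii cc D \<longleftrightarrow>
     D \<in> derivations (\<lambda>c. bar (pol_const c)) \<and>
     (\<forall>g \<in> carrier (pol_ring n). D (bar g) =
        (\<Sum>\<nu> < length cc. (-1) ^ (length ii + \<nu>) * minor J ii (omit \<nu> cc) * bar (pol_pderiv (cc ! \<nu>) g)))"

definition jacobi_derivation ::
    "nat \<Rightarrow> ('k::field mpol \<Rightarrow> 'a::idom) \<Rightarrow> 'a mat \<Rightarrow> nat list \<Rightarrow> nat list \<Rightarrow> ('a \<Rightarrow> 'a)" where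
  "jacobi_derivation n bar J ii cc = (THE D. is_jacobi_derivation n bar J ii cc D)"

section \<open>The free module on the generating symbols and its relators\<close>

definition free_gen :: "nat list \<Rightarrow> nat list \<Rightarrow> (nat list \<times> nat list \<Rightarrow> 'a::comm_ring_1)" where
  "free_gen ii jj = (\<lambda>x. if x = (ii, jj) then 1 else 0)"

text \<open>The symbol of a derivation whose columns \<open>cc\<close> are distinct but not necessarily increasing:
  the generator attached to the increasing rearrangement, times the sign of that rearrangement.\<close>

definition signed_gen :: "nat list \<Rightarrow> nat list \<Rightarrow> (nat list \<times> nat list \<Rightarrow> 'a::comm_ring_1)" where
  "signed_gen ii cc =
     fscale ((-1) ^ card {(a, b). a < b \<and> b < length cc \<and> cc ! b < cc ! a}) (free_gen ii (sort cc))"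

definition relator ::
    "'a::idom mat \<Rightarrow> nat list \<Rightarrow> nat list \<Rightarrow> nat list \<Rightarrow> nat list \<Rightarrow> (nat list \<times> nat list \<Rightarrow> 'a)" where
  "relator J ii jj ii' jj' =
     fscale (minor J ii jj) (free_gen ii' jj') -
     (\<Sum>\<nu> \<in> {\<nu>. \<nu> < length jj' \<and> jj' ! \<nu> \<notin> set jj}.
        fscale ((-1) ^ (length ii' + \<nu>) * minor J ii' (omit \<nu> jj')) (signed_gen ii (jj @ [jj' ! \<nu>])))"

end

theory Submission
  imports Defs
begin

text \<open>Write \<open>\<rho>(P)\<close> for the rank, over the residue field of a prime \<open>P\<close> of \<open>A\<close>, of the gradients of the
  polynomials that vanish modulo \<open>P\<close>. If \<open>C\<close> is a set of \<open>\<rho>(Q)\<close> coordinates that determines these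
  gradients for \<open>Q\<close>, then the variables outside \<open>C\<close> are algebraically independent modulo \<open>Q\<close>: a
  relation of minimal size would have vanishing gradient, hence be a \<open>p\<close>-th power because \<open>K\<close> is
  perfect. Let \<open>P \<subset> Q\<close> be primes and adjoin the variables in \<open>C\<close> one at a time to those outside. The
  rank of the gradients for \<open>P\<close> grows by at most one at each step, and not at all when the new variable
  is transcendental modulo \<open>P\<close> over the previous ones. This happens at least once: \<open>P\<close> and \<open>Q\<close> contain
  the same polynomials in the variables outside \<open>C\<close>, and an algebraic variable preserves such an
  equality. Hence \<open>\<rho>(P) < \<rho>(Q)\<close>.

  If \<open>A\<^sub>P\<close> is regular of dimension \<open>d\<close>, a chain of primes gives \<open>\<rho>(0) + d \<le> \<rho>(P)\<close>, while the \<open>d\<close>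
  generators of the maximal ideal give \<open>\<rho>(P) \<le> s + d\<close> for the rank \<open>s\<close> of the Jacobi matrix modulo
  \<open>P\<close>. Hence \<open>r \<le> \<rho>(0) \<le> s\<close>, some minor of size \<open>r\<close> lies outside \<open>P\<close>, and the minors of size \<open>r\<close>
  generate the unit ideal.

  A derivation is determined by its values on the \<open>x\<^sub>k\<close> with \<open>k\<close> outside \<open>j\<close> as soon as \<open>\<Delta>(i, j) \<noteq> 0\<close>.
  This gives \<open>\<Delta>(i, j) D = \<Sum>\<^sub>k D(x\<^sub>k) \<partial>\<^bsub>i;j,k\<^esub>\<close> for every derivation \<open>D\<close>, hence the relations, and
  also \<open>\<Delta>(i, j) c = \<Sum>\<^sub>g c\<^sub>g R\<^sub>g\<close> for every syzygy \<open>c\<close>, where \<open>R\<^sub>g\<close> is the relator attached to \<open>i, j\<close>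
  and the generator \<open>g\<close>. Combining these two identities with a representation of \<open>1\<close> by the minors
  proves generation and that the relations are defining.\<close>

section \<open>Polynomials and partial derivatives\<close>

text \<open>The Jacobian criterion is usually drawn from dimension theory, through transcendence
  degrees of residue fields. Here the rank rho only has to grow strictly along an inclusion of
  primes: one chain of length d below P is all that is taken from the Krull dimension, and the
  opposite bound uses only a number of generators of the maximal ideal. That both numbers can be the
  same d is what regularity of A_P means, so d cancels. The residue field changes with the prime.
  All linear algebra over it is therefore done in A itself, with factors outside P in place of
  denominators and congruences modulo P in place of equations. The inequality r <= rho(0) holds
  because the rows of the Jacobi matrix are gradients of polynomials that vanish in A. The bound
  rho(P) <= s + d is the product rule: a polynomial vanishing modulo P is, up to a factor outside P,
  a combination of d generators and of the f_i, and every term in which a coefficient is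
  differentiated carries a factor in P. The rows i and the columns j are chosen independently of
  each other in the relations, so Delta(i, j) must be nonzero for all pairs from I_r and J_r; this
  is a fact about matrices of rank r.\<close>

definition pols_in :: "nat set \<Rightarrow> 'k::field mpol set" where
  "pols_in V = {g. \<forall>e\<in>Poly_Mapping.keys g. Poly_Mapping.keys e \<subseteq> V}"

definition pol_var :: "nat \<Rightarrow> 'k::field mpol" where
  "pol_var j = Poly_Mapping.single (Poly_Mapping.single j 1) 1"

lemma carrier_pol_ring: "carrier (pol_ring n) = pols_in {..<n}"
  by (simp add: pol_ring_def pols_in_def)

lemma pols_in_mono: "V \<subseteq> W \<Longrightarrow> g \<in> pols_in V \<Longrightarrow> g \<in> pols_in W"
  unfolding pols_in_def by blast

lemma pols_in_0 [simp]: "0 \<in> pols_in V"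
  and pols_in_1 [simp]: "1 \<in> pols_in V"
  by (simp_all add: pols_in_def)

lemma pols_in_uminus [simp]: "- f \<in> pols_in V \<longleftrightarrow> f \<in> pols_in V"
  by (simp add: pols_in_def in_keys_iff)

lemma pols_in_add: "f \<in> pols_in V \<Longrightarrow> g \<in> pols_in V \<Longrightarrow> f + g \<in> pols_in V"
  unfolding pols_in_def using Poly_Mapping.keys_add[of f g] by blast

lemma pols_in_diff: "f \<in> pols_in V \<Longrightarrow> g \<in> pols_in V \<Longrightarrow> f - g \<in> pols_in V"
  using pols_in_add[of f V "- g"] by simp

lemma pols_in_mult:
  assumes "f \<in> pols_in V" "g \<in> pols_in V"
  shows "f * g \<in> pols_in V"
  unfolding pols_in_def
proof (clarify)
  fix e x assume e: "e \<in> Poly_Mapping.keys (f * g)" and x: "x \<in> Poly_Mapping.keys e"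
  obtain a b where ab: "e = a + b" "a \<in> Poly_Mapping.keys f" "b \<in> Poly_Mapping.keys g"
    using e keys_mult[of f g] by blast
  have "x \<in> Poly_Mapping.keys a \<union> Poly_Mapping.keys b"
    using x Poly_Mapping.keys_add[of a b] unfolding ab(1) by blast
  then show "x \<in> V" using ab assms unfolding pols_in_def by blast
qed

lemma pols_in_power: "f \<in> pols_in V \<Longrightarrow> f ^ k \<in> pols_in V"
  by (induction k) (auto intro: pols_in_mult)

lemma pols_in_sum: "(\<And>i. i \<in> A \<Longrightarrow> f i \<in> pols_in V) \<Longrightarrow> sum f A \<in> pols_in V"
  by (induction A rule: infinite_finite_induct) (auto intro: pols_in_add)

lemma pols_in_const [simp]: "pol_const c \<in> pols_in V"
  by (simp add: pols_in_def pol_const_def)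

lemma pols_in_single: "Poly_Mapping.keys e \<subseteq> V \<Longrightarrow> Poly_Mapping.single e c \<in> pols_in V"
  by (simp add: pols_in_def)

lemma pol_var_in: "j \<in> V \<Longrightarrow> pol_var j \<in> pols_in V"
  unfolding pol_var_def by (rule pols_in_single) simp

lemma sum_single: "g = (\<Sum>e\<in>Poly_Mapping.keys g. Poly_Mapping.single e (Poly_Mapping.lookup g e))"
proof (rule poly_mapping_eqI)
  fix k
  show "Poly_Mapping.lookup g k = Poly_Mapping.lookup
     (\<Sum>e\<in>Poly_Mapping.keys g. Poly_Mapping.single e (Poly_Mapping.lookup g e)) k"
    by (simp add: lookup_sum lookup_single when_def in_keys_iff)
qed

lemma lookup_pol_pderiv:
  "Poly_Mapping.lookup (pol_pderiv j g) e =
    of_nat (Poly_Mapping.lookup e j + 1) * Poly_Mapping.lookup g (e + Poly_Mapping.single j 1)"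
proof -
  let ?u = "Poly_Mapping.single j (1::nat)"
  \<comment> \<open>Subtraction of exponents is truncated, so several exponents may be sent to
    \<open>e\<close>; those in which x_j does not occur carry the coefficient 0, and on the others
    the shift is injective.\<close>
  have eq: "(if e' - ?u = e then of_nat (Poly_Mapping.lookup e' j) * Poly_Mapping.lookup g e' else 0)
     = (if e' = e + ?u then of_nat (Poly_Mapping.lookup e j + 1) * Poly_Mapping.lookup g e' else 0)" for e'
  proof (cases "Poly_Mapping.lookup e' j = 0")
    case True
    then have "e' \<noteq> e + ?u" by (auto simp: lookup_add)
    then show ?thesis using True by simp
  next
    case False
    have "e' - ?u = e \<longleftrightarrow> e' = e + ?u"
    proof
      assume "e' - ?u = e"
      then have "Poly_Mapping.lookup e' k = Poly_Mapping.lookup (e + ?u) k" for k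
        using False by (auto simp: lookup_add lookup_minus lookup_single when_def)
      then show "e' = e + ?u" by (rule poly_mapping_eqI)
    qed simp
    then show ?thesis by (auto simp: lookup_add)
  qed
  have "Poly_Mapping.lookup (pol_pderiv j g) e = (\<Sum>e'\<in>Poly_Mapping.keys g.
      (if e' - ?u = e then of_nat (Poly_Mapping.lookup e' j) * Poly_Mapping.lookup g e' else 0))"
    unfolding pol_pderiv_def lookup_sum by (simp add: lookup_single when_def)
  also have "\<dots> = (\<Sum>e'\<in>Poly_Mapping.keys g.
      (if e' = e + ?u then of_nat (Poly_Mapping.lookup e j + 1) * Poly_Mapping.lookup g e' else 0))"
    by (simp only: eq)
  also have "\<dots> = of_nat (Poly_Mapping.lookup e j + 1) * Poly_Mapping.lookup g (e + ?u)"
    by (simp add: in_keys_iff)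
  finally show ?thesis .
qed

lemma pol_pderiv_0 [simp]: "pol_pderiv j 0 = 0"
  by (rule poly_mapping_eqI) (simp add: lookup_pol_pderiv)

lemma pol_pderiv_add: "pol_pderiv j (f + g) = pol_pderiv j f + pol_pderiv j g"
  by (rule poly_mapping_eqI) (simp add: lookup_pol_pderiv lookup_add algebra_simps)

lemma pol_pderiv_uminus: "pol_pderiv j (- f) = - pol_pderiv j f"
  by (rule poly_mapping_eqI) (simp add: lookup_pol_pderiv)

lemma pol_pderiv_diff: "pol_pderiv j (f - g) = pol_pderiv j f - pol_pderiv j g"
  using pol_pderiv_add[of j f "- g"] by (simp add: pol_pderiv_uminus)

lemma pol_pderiv_sum: "pol_pderiv j (sum f A) = (\<Sum>i\<in>A. pol_pderiv j (f i))"
  by (induction A rule: infinite_finite_induct) (auto simp: pol_pderiv_add)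

lemma pol_pderiv_single: "pol_pderiv j (Poly_Mapping.single e c) =
    Poly_Mapping.single (e - Poly_Mapping.single j 1) (of_nat (Poly_Mapping.lookup e j) * c)"
  unfolding pol_pderiv_def by (cases "c = 0") auto

lemma pol_pderiv_const [simp]: "pol_pderiv j (pol_const c) = 0"
  by (simp add: pol_const_def pol_pderiv_single)

lemma pol_pderiv_1 [simp]: "pol_pderiv j 1 = 0"
  by (subst single_one[symmetric], subst pol_pderiv_single) simp

lemma pol_pderiv_var: "pol_pderiv j (pol_var k) = (if j = k then 1 else 0)"
  by (auto simp: pol_var_def pol_pderiv_single lookup_single when_def)

lemma pol_pderiv_mult: "pol_pderiv j (f * g) = f * pol_pderiv j g + g * pol_pderiv j f"
proof -
  let ?s = "Poly_Mapping.single" and ?u = "Poly_Mapping.single j (1::nat)"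
  have mono: "pol_pderiv j (?s a x * ?s b y) = ?s a x * pol_pderiv j (?s b y) + ?s b y * pol_pderiv j (?s a x)"
    for a b and x y :: 'a
  proof -
    \<comment> \<open>This fails for truncated subtraction if x_j does not occur in
      \<open>b\<close>, but then the derivative of that factor is 0.\<close>
    have *: "a + (b - ?u) = a + b - ?u" if "Poly_Mapping.lookup b j \<noteq> 0" for a b
      using that
      by (intro poly_mapping_eqI) (auto simp: lookup_add lookup_minus lookup_single when_def)
    have A: "?s a x * pol_pderiv j (?s b y)
        = ?s (a + b - ?u) (of_nat (Poly_Mapping.lookup b j) * (x * y))" for a b and x y :: 'a
      by (cases "Poly_Mapping.lookup b j = 0")
        (simp_all add: pol_pderiv_single mult_single *[simplified] mult.left_commute)
    have "pol_pderiv j (?s a x * ?s b y) = ?s (a + b - ?u)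
        (of_nat (Poly_Mapping.lookup b j) * (x * y) + of_nat (Poly_Mapping.lookup a j) * (y * x))"
      by (simp add: mult_single pol_pderiv_single lookup_add algebra_simps)
    also have "\<dots> = ?s a x * pol_pderiv j (?s b y) + ?s b y * pol_pderiv j (?s a x)"
      by (simp only: A single_add add.commute[of b a])
    finally show ?thesis .
  qed
  have "f * g = (\<Sum>a\<in>Poly_Mapping.keys f. \<Sum>b\<in>Poly_Mapping.keys g.
     ?s a (Poly_Mapping.lookup f a) * ?s b (Poly_Mapping.lookup g b))"
    by (subst sum_product[symmetric]) (simp flip: sum_single)
  then have "pol_pderiv j (f * g) = (\<Sum>a\<in>Poly_Mapping.keys f. \<Sum>b\<in>Poly_Mapping.keys g.
     ?s a (Poly_Mapping.lookup f a) * pol_pderiv j (?s b (Poly_Mapping.lookup g b)))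
     + (\<Sum>a\<in>Poly_Mapping.keys f. \<Sum>b\<in>Poly_Mapping.keys g.
     pol_pderiv j (?s a (Poly_Mapping.lookup f a)) * ?s b (Poly_Mapping.lookup g b))"
    by (simp add: pol_pderiv_sum mono sum.distrib mult.commute)
  also have "\<dots> = f * pol_pderiv j g + pol_pderiv j f * g"
    by (simp flip: sum_product sum_single pol_pderiv_sum)
  finally show ?thesis by (simp add: mult.commute)
qed

lemma pol_pderiv_in:
  assumes "g \<in> pols_in V"
  shows "pol_pderiv j g \<in> pols_in V"
  unfolding pol_pderiv_def
proof (rule pols_in_sum, rule pols_in_single)
  fix e assume "e \<in> Poly_Mapping.keys g"
  then have "Poly_Mapping.keys e \<subseteq> V" using assms by (auto simp: pols_in_def)
  moreover have "Poly_Mapping.keys (e - Poly_Mapping.single j 1) \<subseteq> Poly_Mapping.keys e"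
    by (auto simp: in_keys_iff lookup_minus)
  ultimately show "Poly_Mapping.keys (e - Poly_Mapping.single j 1) \<subseteq> V" by blast
qed

lemma pol_pderiv_notin:
  assumes "g \<in> pols_in V" "j \<notin> V"
  shows "pol_pderiv j g = 0"
  unfolding pol_pderiv_def
proof (rule sum.neutral, safe)
  fix e assume "e \<in> Poly_Mapping.keys g"
  then have "j \<notin> Poly_Mapping.keys e" using assms by (auto simp: pols_in_def)
  then show "Poly_Mapping.single (e - Poly_Mapping.single j 1)
     (of_nat (Poly_Mapping.lookup e j) * Poly_Mapping.lookup g e) = 0"
    by (simp add: in_keys_iff)
qed

section \<open>Vanishing gradients in characteristic \<open>p\<close>\<close>

text \<open>Perfectness is given as separability of irreducible polynomials, so the root is
  extracted from X^p - c. Let \<open>g\<close> be an irreducible factor of multiplicity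
  \<open>k\<close>. The derivative of X^p - c is 0, which makes \<open>g\<close> divide k g' h with
  \<open>g\<close> dividing neither g' nor h; hence p divides \<open>k\<close>. As k * deg g <= p,
  the factor \<open>g\<close> is linear and its root is a p-th root of c.\<close>

lemma perfect_field_root:
  fixes c :: "'k::field"
  assumes p: "CHAR('k) = p" "p > 0" and perf: "perfect_field TYPE('k)"
  shows "\<exists>b. b ^ p = c"
proof -
  let ?f = "monom 1 p + [:- c:] :: 'k poly"
  have deg: "degree ?f = p"
    by (subst degree_add_eq_left) (use p in \<open>auto simp: degree_monom_eq\<close>)
  then have f0: "?f \<noteq> 0" using p by auto
  have df: "pderiv ?f = 0"
    using p of_nat_CHAR[where 'a='k] by (simp add: pderiv_add pderiv_monom pderiv_pCons)
  have "?f dvd ?f \<and> degree ?f > 0" using deg p by simp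
  then obtain g where g: "g dvd ?f" "degree g > 0"
    and min: "\<And>g'. g' dvd ?f \<Longrightarrow> degree g' > 0 \<Longrightarrow> degree g \<le> degree g'"
    using ex_has_least_nat[of "\<lambda>g. g dvd ?f \<and> degree g > 0" ?f degree] by blast
  have g0: "g \<noteq> 0" using g(2) by auto
  have gi: "irreducible g"
  proof (rule irreducibleI)
    fix a b assume ab: "g = a * b"
    then have ab0: "a \<noteq> 0" "b \<noteq> 0" using g0 by auto
    then have d: "degree g = degree a + degree b" using ab by (simp add: degree_mult_eq)
    show "is_unit a \<or> is_unit b"
    proof (rule ccontr)
      assume "\<not> ?thesis"
      then have "degree a > 0" "degree b > 0" using ab0 by (auto simp: is_unit_iff_degree)
      moreover have "a dvd ?f" using g(1) ab by (metis dvd_mult_left)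
      ultimately show False using min[of a] d by simp
    qed
  qed (use g g0 in \<open>auto simp: is_unit_iff_degree\<close>)
  have gp: "prime_elem g" using gi by (rule field_poly_irreducible_imp_prime)
  have bound: "k \<le> p" if "g ^ k dvd ?f" for k
  proof -
    have "k * degree g \<le> p"
      using dvd_imp_degree_le[OF that f0] deg by (simp add: degree_power_eq g0)
    then show ?thesis using g(2) by (metis le_trans mult.right_neutral mult_le_mono2 Suc_leI One_nat_def)
  qed
  obtain k where k: "g ^ k dvd ?f" and kmax: "\<And>l. g ^ l dvd ?f \<Longrightarrow> l \<le> k"
    using Nat.ex_has_greatest_nat[of "\<lambda>k. g ^ k dvd ?f" 1 p] bound g by auto
  obtain h where h: "?f = g ^ k * h" using k by (auto elim: dvdE)
  have gh: "\<not> g dvd h"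
  proof
    assume "g dvd h"
    then have "g ^ Suc k dvd ?f" unfolding h by (metis mult.commute mult_dvd_mono dvd_refl power_Suc)
    then show False using kmax by fastforce
  qed
  have cop: "\<not> g dvd pderiv g"
  proof
    assume "g dvd pderiv g"
    moreover have "coprime g (pderiv g)" using perf gi by (auto simp: perfect_field_def)
    then have "\<forall>c. c dvd g \<longrightarrow> c dvd pderiv g \<longrightarrow> is_unit c"
      by (simp only: coprime_def)
    ultimately have "is_unit g" by simp
    then show False using g g0 by (auto simp: is_unit_iff_degree)
  qed
  have k0: "k > 0" using kmax[of 1] g by simp
  then obtain l where l: "k = Suc l" by (cases k) auto
  have "g ^ l * (smult (of_nat k) (pderiv g * h) + g * pderiv h) = 0"
    using df unfolding h l
    by (simp only: pderiv_mult pderiv_power_Suc) (simp add: algebra_simps smult_add_left)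
  then have "smult (of_nat k) (pderiv g * h) + g * pderiv h = 0" using g0 by simp
  then have "g dvd pderiv g * (smult (of_nat k) h)"
    by (metis add.commute add_eq_0_iff dvd_minus_iff dvd_triv_left mult_smult_right)
  then have "g dvd smult (of_nat k) h" using cop gp prime_elem_dvd_mult_iff by blast
  then have "(of_nat k :: 'k) = 0" using gh by (metis dvd_smult_cancel)
  then have "p dvd k" using p by (simp add: of_nat_eq_0_iff_char_dvd)
  then have pk: "p \<le> k" using k0 by (auto dest: dvd_imp_le)
  have h0: "h \<noteq> 0" using h f0 by auto
  have d: "p = k * degree g + degree h"
    using deg unfolding h by (simp add: degree_mult_eq degree_power_eq g0 h0)
  have "degree g = 1"
  proof (rule ccontr)
    assume "degree g \<noteq> 1"
    then have "2 \<le> degree g" using g(2) by simp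
    then have "k * 2 \<le> k * degree g" by simp
    then show False using d pk k0 by linarith
  qed
  then obtain a b where ab: "g = [:a, b:]" "b \<noteq> 0"
    by (metis One_nat_def degree_0 degree_pCons_0 degree_pCons_eq nat.inject pCons_cases zero_neq_one pCons_0_0 degree_eq_zeroE)
  define x where "x = - a / b"
  have x: "poly g x = 0" using ab by (simp add: x_def)
  then have "poly ?f x = 0" unfolding h using k0 by simp
  then show ?thesis by (auto simp: poly_monom add_eq_0_iff2)
qed

section \<open>Total degrees, p-th roots of polynomials and the descent\<close>

definition tdeg :: "(nat \<Rightarrow>\<^sub>0 nat) \<Rightarrow> nat" where
  "tdeg e = (\<Sum>x\<in>Poly_Mapping.keys e. Poly_Mapping.lookup e x)"

lemma tdeg_superset:
  assumes "finite A" "Poly_Mapping.keys e \<subseteq> A"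
  shows "tdeg e = (\<Sum>x\<in>A. Poly_Mapping.lookup e x)"
  unfolding tdeg_def by (rule sum.mono_neutral_left) (use assms in \<open>auto simp: in_keys_iff\<close>)

lemma tdeg_add: "tdeg (a + b) = tdeg a + tdeg b"
proof -
  let ?A = "Poly_Mapping.keys a \<union> Poly_Mapping.keys b"
  have "Poly_Mapping.keys (a + b) \<subseteq> ?A" by (rule Poly_Mapping.keys_add)
  then show ?thesis
    by (simp add: tdeg_superset[of ?A] lookup_add sum.distrib)
qed

lemma tdeg_0_iff [simp]: "tdeg e = 0 \<longleftrightarrow> e = 0"
  by (auto simp: tdeg_def in_keys_iff intro: poly_mapping_eqI)

lemma tdeg_single: "tdeg (Poly_Mapping.single j k) = k"
  by (cases "k = 0") (simp_all add: tdeg_def)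

lemma tdeg_sum_const: "tdeg (\<Sum>i<k. a) = k * tdeg a" for k :: nat
  by (induction k) (simp_all add: tdeg_add del: sum_constant)

lemma single_power: "Poly_Mapping.single (a :: nat \<Rightarrow>\<^sub>0 nat) (x :: 'k::field) ^ k =
    Poly_Mapping.single (\<Sum>i<k. a) (x ^ k)"
  by (induction k) (simp_all add: mult_single add.commute del: sum_constant)

text \<open>The measure of the descent. It drops strictly under a nonzero partial derivative and
  under a p-th root of a nonconstant polynomial, and as a sum it needs no convention for the zero
  polynomial.\<close>

definition pol_size :: "'k::field mpol \<Rightarrow> nat" where
  "pol_size g = (\<Sum>e\<in>Poly_Mapping.keys g. tdeg e)"

text \<open>Multiplying by x_j embeds the monomials of the derivative into those of \<open>g\<close>
  and raises each degree by one; there is at least one such monomial.\<close>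

lemma pol_size_pderiv:
  assumes "pol_pderiv j g \<noteq> 0"
  shows "pol_size (pol_pderiv j g) < pol_size g"
proof -
  let ?K = "Poly_Mapping.keys (pol_pderiv j g)" and ?u = "Poly_Mapping.single j (1::nat)"
  have "?K \<noteq> {}" using assms by simp
  then have "pol_size (pol_pderiv j g) < (\<Sum>e\<in>?K. tdeg (e + ?u))"
    unfolding pol_size_def by (intro sum_strict_mono) (auto simp: tdeg_add tdeg_single)
  also have "\<dots> = sum tdeg ((\<lambda>e. e + ?u) ` ?K)"
    by (simp add: sum.reindex)
  also have "\<dots> \<le> pol_size g"
    unfolding pol_size_def
    by (intro sum_mono2) (auto simp: in_keys_iff lookup_pol_pderiv)
  finally show ?thesis .
qed

lemma CHAR_mpol: "CHAR('k::field mpol) = CHAR('k)"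
proof (rule CHAR_eqI)
  show "of_nat CHAR('k) = (0 :: 'k mpol)"
    by (subst single_of_nat[symmetric]) simp
  fix x :: nat assume "of_nat x = (0 :: 'k mpol)"
  then have "Poly_Mapping.lookup (of_nat x :: 'k mpol) 0 = 0" by simp
  then show "CHAR('k) dvd x" by (simp add: lookup_of_nat of_nat_eq_0_iff_char_dvd)
qed

text \<open>A vanishing derivative forces p to divide the exponent of x_j in every monomial.
  Dividing all exponents by p and taking p-th roots of the coefficients gives \<open>h\<close>,
  because p-th powers are additive in characteristic p.\<close>

lemma pol_pth_root:
  fixes g :: "'k::field mpol"
  assumes p: "CHAR('k) = p" "p > 0" and perf: "perfect_field TYPE('k)"
    and g: "g \<in> pols_in V" and d: "\<And>j. j \<in> V \<Longrightarrow> pol_pderiv j g = 0"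
  obtains h where "h \<in> pols_in V" "h ^ p = g" "pol_size g = 0 \<or> pol_size h < pol_size g"
proof -
  define rt where "rt c = (SOME b. b ^ p = c)" for c :: 'k
  have rt: "rt c ^ p = c" for c
    using someI_ex[OF perfect_field_root[OF p perf]] unfolding rt_def .
  define dv where "dv e = Poly_Mapping.map (\<lambda>x. x div p) e" for e :: "nat \<Rightarrow>\<^sub>0 nat"
  have lookup_dv: "Poly_Mapping.lookup (dv e) x = Poly_Mapping.lookup e x div p" for e x
    by (simp add: dv_def map.rep_eq when_def)
  have dvd: "p dvd Poly_Mapping.lookup e j" if e: "e \<in> Poly_Mapping.keys g" for e j
  proof (cases "Poly_Mapping.lookup e j = 0")
    case False
    then have "j \<in> Poly_Mapping.keys e" by (simp add: in_keys_iff)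
    then have "pol_pderiv j g = 0" using g e d by (auto simp: pols_in_def)
    moreover have "e - Poly_Mapping.single j 1 + Poly_Mapping.single j 1 = e"
      using False by (intro poly_mapping_eqI) (auto simp: lookup_add lookup_minus lookup_single when_def)
    moreover have "Suc (Poly_Mapping.lookup e j - Suc 0) = Poly_Mapping.lookup e j"
      using False by simp
    ultimately have "of_nat (Poly_Mapping.lookup e j) * Poly_Mapping.lookup g e = 0"
      using lookup_pol_pderiv[of j g "e - Poly_Mapping.single j 1"]
      by (metis Suc_eq_plus1 lookup_minus lookup_single_eq lookup_zero One_nat_def)
    then show ?thesis using e p by (auto simp: in_keys_iff of_nat_eq_0_iff_char_dvd)
  qed simp
  have pdv: "(\<Sum>i<p. dv e) = e" if "e \<in> Poly_Mapping.keys g" for e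
    using dvd[OF that] by (intro poly_mapping_eqI) (simp del: sum_constant add: lookup_sum lookup_dv, simp)
  have tdv: "p * tdeg (dv e) = tdeg e" if "e \<in> Poly_Mapping.keys g" for e
    using tdeg_sum_const[where k = p and a = "dv e"] by (simp only: pdv[OF that])
  define h where "h = (\<Sum>e\<in>Poly_Mapping.keys g. Poly_Mapping.single (dv e) (rt (Poly_Mapping.lookup g e)))"
  have pp: "prime CHAR('k mpol)" using p prime_CHAR_semidom[where 'a='k] by (simp add: CHAR_mpol)
  have "h ^ p = (\<Sum>e\<in>Poly_Mapping.keys g. Poly_Mapping.single (dv e) (rt (Poly_Mapping.lookup g e)) ^ p)"
    unfolding h_def using freshmans_dream_sum[OF pp, of p] p by (simp add: CHAR_mpol)
  also have "\<dots> = (\<Sum>e\<in>Poly_Mapping.keys g. Poly_Mapping.single e (Poly_Mapping.lookup g e))"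
    by (rule sum.cong) (simp_all add: single_power pdv rt del: sum_constant)
  also have "\<dots> = g" by (rule sum_single[symmetric])
  finally have hp: "h ^ p = g" .
  have hV: "h \<in> pols_in V" unfolding h_def
  proof (rule pols_in_sum, rule pols_in_single)
    fix e assume "e \<in> Poly_Mapping.keys g"
    then have "Poly_Mapping.keys e \<subseteq> V" using g by (auto simp: pols_in_def)
    moreover have "Poly_Mapping.keys (dv e) \<subseteq> Poly_Mapping.keys e"
      by (rule subsetI, rule ccontr) (simp add: in_keys_iff lookup_dv)
    ultimately show "Poly_Mapping.keys (dv e) \<subseteq> V" by blast
  qed
  have keys_h: "Poly_Mapping.keys h \<subseteq> dv ` Poly_Mapping.keys g"
  proof
    fix e assume "e \<in> Poly_Mapping.keys h"
    then have "(\<Sum>i\<in>Poly_Mapping.keys g.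
        Poly_Mapping.lookup (Poly_Mapping.single (dv i) (rt (Poly_Mapping.lookup g i))) e) \<noteq> 0"
      by (simp add: h_def in_keys_iff lookup_sum)
    then obtain i where "i \<in> Poly_Mapping.keys g"
      "Poly_Mapping.lookup (Poly_Mapping.single (dv i) (rt (Poly_Mapping.lookup g i))) e \<noteq> 0"
      by (rule sum.not_neutral_contains_not_neutral)
    then show "e \<in> dv ` Poly_Mapping.keys g" by (auto simp: lookup_single when_def split: if_splits)
  qed
  have p2: "p \<ge> 2" using pp p by (simp add: CHAR_mpol prime_ge_2_nat)
  have size: "pol_size g = 0 \<or> pol_size h < pol_size g"
  proof -
    have "p * pol_size h \<le> p * sum tdeg (dv ` Poly_Mapping.keys g)"
      unfolding pol_size_def using keys_h by (intro mult_le_mono2 sum_mono2) auto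
    also have "\<dots> \<le> p * (\<Sum>e\<in>Poly_Mapping.keys g. tdeg (dv e))"
      using sum_image_le[of "Poly_Mapping.keys g" tdeg dv] by (intro mult_le_mono2) (simp add: comp_def)
    also have "\<dots> = pol_size g"
      unfolding pol_size_def sum_distrib_left by (rule sum.cong[OF refl]) (rule tdv)
    finally have *: "p * pol_size h \<le> pol_size g" .
    \<comment> \<open>At least halving the size is what makes the drop strict unless the size of
      \<open>g\<close> is 0.\<close>
    have "2 * pol_size h \<le> p * pol_size h" using p2 by (rule mult_le_mono1)
    then show ?thesis using * by linarith
  qed
  show thesis using that[OF hV hp size] .
qed

text \<open>\<open>Z\<close> stands for the polynomials in the free variables whose image lies in a
  prime. Constants are treated apart, since a p-th root of a constant is not smaller.\<close>

lemma perfect_descent: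
  fixes Z :: "'k::field mpol set"
  assumes p: "CHAR('k) = p" "p > 0" and perf: "perfect_field TYPE('k)"
    and Z: "Z \<subseteq> pols_in V"
    and const: "\<And>c. pol_const c \<in> Z \<Longrightarrow> c = 0"
    and deriv: "\<And>g j. g \<in> Z \<Longrightarrow> pol_pderiv j g \<in> Z"
    and root: "\<And>h. h \<in> pols_in V \<Longrightarrow> h ^ p \<in> Z \<Longrightarrow> h \<in> Z"
    and g: "g \<in> Z"
  shows "g = 0"
  using g
proof (induction "pol_size g" arbitrary: g rule: less_induct)
  case less
  have d: "pol_pderiv j g = 0" for j
    using less.hyps[of "pol_pderiv j g"] pol_size_pderiv[of j g] deriv[OF less.prems] by blast
  obtain h where h: "h \<in> pols_in V" "h ^ p = g" "pol_size g = 0 \<or> pol_size h < pol_size g"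
    using pol_pth_root[OF p perf _ d] Z less.prems by blast
  have hZ: "h \<in> Z" using root h less.prems by simp
  show ?case
  proof (cases "pol_size g = 0")
    case True
    then have "Poly_Mapping.keys g \<subseteq> {0}" by (auto simp: pol_size_def)
    then have "g = pol_const (Poly_Mapping.lookup g 0)"
      by (intro poly_mapping_eqI) (auto simp: pol_const_def lookup_single when_def in_keys_iff)
    then show ?thesis using const less.prems by (metis pol_const_def single_zero)
  next
    case False
    then have "h = 0" using h(3) less.hyps[of h] hZ by metis
    then show ?thesis using h(2) p(2) by (simp add: zero_power)
  qed
qed

section \<open>Rank modulo a prime ideal\<close>

text \<open>Prime ideals as plain subsets of a type, so that congruences use the type class
  arithmetic; \<open>primeideal_of_type\<close> passes to the notion in which regularity is
  stated.\<close>

locale prime_set =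
  fixes p :: "'a::comm_ring_1 set"
  assumes zero_in [simp]: "0 \<in> p"
    and add_in: "a \<in> p \<Longrightarrow> b \<in> p \<Longrightarrow> a + b \<in> p"
    and mult_in: "b \<in> p \<Longrightarrow> a * b \<in> p"
    and one_notin [simp]: "1 \<notin> p"
    and primeD: "a * b \<in> p \<Longrightarrow> a \<in> p \<or> b \<in> p"
begin

lemma mult_in_iff [simp]: "a * b \<in> p \<longleftrightarrow> a \<in> p \<or> b \<in> p"
  using primeD mult_in mult.commute by metis

lemma uminus_in [simp]: "- a \<in> p \<longleftrightarrow> a \<in> p"
  using mult_in[of a "-1"] mult_in[of "-a" "-1"] by auto

lemma diff_in: "a \<in> p \<Longrightarrow> b \<in> p \<Longrightarrow> a - b \<in> p"
  using add_in[of a "- b"] by simp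

lemma sum_in: "(\<And>i. i \<in> A \<Longrightarrow> f i \<in> p) \<Longrightarrow> sum f A \<in> p"
  by (induction A rule: infinite_finite_induct) (auto intro: add_in)

lemma power_in_iff: "a ^ k \<in> p \<longleftrightarrow> a \<in> p \<and> k > 0"
  by (induction k) auto

lemma minus_one_power_notin: "(-1) ^ k \<notin> p"
  by (simp add: power_in_iff)

lemma diff_in_cancel: "a - b \<in> p \<Longrightarrow> b \<in> p \<Longrightarrow> a \<in> p"
  using add_in[of "a - b" b] by simp

lemma diff_in_cancel': "a - b \<in> p \<Longrightarrow> a \<in> p \<Longrightarrow> b \<in> p"
  using diff_in[of a "a - b"] by simp

end

text \<open>For a submodule \<open>E\<close> the least size of a set \<open>C\<close> with \<open>determined p C E\<close> is the rank of \<open>E\<close>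
  over the residue field of \<open>p\<close>; this avoids fraction fields and bases.\<close>

definition determined :: "'a::comm_ring_1 set \<Rightarrow> nat set \<Rightarrow> (nat \<Rightarrow> 'a) set \<Rightarrow> bool" where
  "determined p C E \<longleftrightarrow> (\<forall>e\<in>E. (\<forall>c\<in>C. e c \<in> p) \<longrightarrow> (\<forall>j. e j \<in> p))"

text \<open>Represents the span of \<open>E\<close> and \<open>v\<close> over the residue field of
  \<open>p\<close>: the factor \<open>c\<close> outside \<open>p\<close> clears denominators, and
  equality is weakened to congruence modulo \<open>p\<close>.\<close>

definition extend_by :: "'a::comm_ring_1 set \<Rightarrow> (nat \<Rightarrow> 'a) set \<Rightarrow> (nat \<Rightarrow> 'a) \<Rightarrow> (nat \<Rightarrow> 'a) set" where
  "extend_by p E v = {u. \<exists>c q w. c \<notin> p \<and> w \<in> E \<and> (\<forall>j. c * u j - q * v j - w j \<in> p)}"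

lemma determined_mono: "determined p C E \<Longrightarrow> F \<subseteq> E \<Longrightarrow> determined p C F"
  unfolding determined_def by blast

context prime_set
begin

lemma subspace_extend_by:
  assumes E: "fmod.subspace E"
  shows "fmod.subspace (extend_by p E v)"
proof (rule fmod.subspaceI)
  have "1 \<notin> p \<and> 0 \<in> E \<and> (\<forall>j. 1 * (0 :: nat \<Rightarrow> 'a) j - 0 * v j - (0 :: nat \<Rightarrow> 'a) j \<in> p)"
    using fmod.subspace_0[OF E] by simp
  then show "0 \<in> extend_by p E v" unfolding extend_by_def by blast
next
  fix x y assume xy: "x \<in> extend_by p E v" "y \<in> extend_by p E v"
  then obtain c q w where x: "c \<notin> p" "w \<in> E" "\<And>j. c * x j - q * v j - w j \<in> p"
    unfolding extend_by_def by auto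
  obtain c' q' w' where y: "c' \<notin> p" "w' \<in> E" "\<And>j. c' * y j - q' * v j - w' j \<in> p"
    using xy(2) unfolding extend_by_def by auto
  have "fscale c' w + fscale c w' \<in> E"
    using x y E by (intro fmod.subspace_add fmod.subspace_scale)
  moreover have "(c * c') * (x + y) j - (c' * q + c * q') * v j - (fscale c' w + fscale c w') j \<in> p" for j
  proof -
    have "(c * c') * (x + y) j - (c' * q + c * q') * v j - (fscale c' w + fscale c w') j
      = c' * (c * x j - q * v j - w j) + c * (c' * y j - q' * v j - w' j)"
      by (simp add: fscale_def algebra_simps)
    then show ?thesis using x(3)[of j] y(3)[of j] by (metis add_in mult_in)
  qed
  moreover have "c * c' \<notin> p" using x y by simp
  ultimately show "x + y \<in> extend_by p E v" unfolding extend_by_def by blast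
next
  fix a x assume "x \<in> extend_by p E v"
  then obtain c q w where x: "c \<notin> p" "w \<in> E" "\<And>j. c * x j - q * v j - w j \<in> p"
    unfolding extend_by_def by auto
  have "c * fscale a x j - (a * q) * v j - fscale a w j \<in> p" for j
  proof -
    have "c * fscale a x j - (a * q) * v j - fscale a w j = a * (c * x j - q * v j - w j)"
      by (simp add: fscale_def algebra_simps)
    then show ?thesis using x(3)[of j] by (metis mult_in)
  qed
  moreover have "fscale a w \<in> E" using x E by (intro fmod.subspace_scale)
  ultimately show "fscale a x \<in> extend_by p E v" unfolding extend_by_def using x(1) by blast
qed

text \<open>If \<open>C\<close> no longer suffices, some \<open>e\<close> in the extension vanishes
  on \<open>C\<close> but not at \<open>j\<close>. It must involve \<open>v\<close> with a
  coefficient outside \<open>p\<close>, as otherwise it would be congruent to an element of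
  \<open>E\<close> up to such a factor. Hence \<open>e\<close> can eliminate \<open>v\<close> from
  every other vector, and the single new coordinate \<open>j\<close> controls the multiple of
  \<open>e\<close> that was subtracted.\<close>

lemma determined_extend_by:
  assumes E: "fmod.subspace E" and C: "determined p C E" "finite C"
  obtains C' where "finite C'" "card C' \<le> Suc (card C)" "determined p C' (extend_by p E v)"
proof (cases "determined p C (extend_by p E v)")
  case True
  then show ?thesis using that[of C] C by simp
next
  case False
  then obtain e j where e: "e \<in> extend_by p E v" "\<And>c. c \<in> C \<Longrightarrow> e c \<in> p" "e j \<notin> p"
    unfolding determined_def by blast
  then obtain c q w where cqw: "c \<notin> p" "w \<in> E" "\<And>j. c * e j - q * v j - w j \<in> p"
    unfolding extend_by_def by auto
  have q: "q \<notin> p"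
  proof
    assume q: "q \<in> p"
    have *: "c * e i - w i \<in> p" for i
    proof -
      have "c * e i - w i = (c * e i - q * v i - w i) + v i * q" by (simp add: algebra_simps)
      then show ?thesis using cqw(3)[of i] q by (metis add_in mult_in)
    qed
    have "w i \<in> p" if "i \<in> C" for i using *[of i] e(2)[OF that] by (metis diff_in_cancel' mult_in)
    then have "w j \<in> p" using C cqw(2) unfolding determined_def by blast
    then have "c * e j \<in> p" using *[of j] by (metis diff_in_cancel)
    then show False using cqw(1) e(3) by simp
  qed
  have "determined p (insert j C) (extend_by p E v)"
    unfolding determined_def
  proof (intro ballI impI allI)
    fix u i assume u: "u \<in> extend_by p E v" and uC: "\<forall>c\<in>insert j C. u c \<in> p"
    obtain c' q' w' where cqw': "c' \<notin> p" "w' \<in> E" "\<And>j. c' * u j - q' * v j - w' j \<in> p"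
      using u unfolding extend_by_def by auto
    \<comment> \<open>Cross-multiplying the congruences for \<open>u\<close> and \<open>e\<close>
      cancels \<open>v\<close> and leaves an element of \<open>E\<close>.\<close>
    define z where "z = fscale q w' + fscale (- q') w"
    have zE: "z \<in> E" unfolding z_def using E cqw cqw'
      by (intro fmod.subspace_add fmod.subspace_scale)
    have zeq: "(q * c' * u i - q' * c * e i) - z i \<in> p" for i
    proof -
      have "(q * c' * u i - q' * c * e i) - z i
         = q * (c' * u i - q' * v i - w' i) - q' * (c * e i - q * v i - w i)"
        unfolding z_def by (simp add: fscale_def algebra_simps)
      then show ?thesis using cqw(3)[of i] cqw'(3)[of i] by (metis diff_in mult_in)
    qed
    have "z k \<in> p" if "k \<in> C" for k
    proof -
      have "q * c' * u k - q' * c * e k \<in> p"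
        using uC that e(2)[OF that] by (intro diff_in) (auto intro: mult_in)
      then show ?thesis using zeq[of k] diff_in_cancel' by blast
    qed
    then have z: "z k \<in> p" for k using C zE unfolding determined_def by blast
    have 1: "q * c' * u k - q' * c * e k \<in> p" for k using zeq[of k] z[of k] diff_in_cancel by blast
    have "q * c' * u j \<in> p" using uC by simp
    then have "q' * c * e j \<in> p" using 1[of j] diff_in_cancel' by blast
    then have "q' \<in> p" using cqw(1) e(3) by simp
    then have "q' * c * e i \<in> p" by simp
    then have "q * c' * u i \<in> p" using 1[of i] diff_in_cancel by blast
    then show "u i \<in> p" using q cqw'(1) by simp
  qed
  moreover have "card (insert j C) \<le> Suc (card C)" using C(2) by (simp add: card_insert_if)
  ultimately show ?thesis using that[of "insert j C"] C(2) by blast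
qed

text \<open>Extending by 0 only saturates: it admits factors outside \<open>p\<close> and
  congruences modulo \<open>p\<close>, neither of which affects the rank.\<close>

lemma determined_extend_by_0:
  assumes "determined p C E"
  shows "determined p C (extend_by p E 0)"
  unfolding determined_def
proof (intro ballI impI)
  fix u assume "u \<in> extend_by p E 0" and uC: "\<forall>c\<in>C. u c \<in> p"
  then obtain c w where cw: "c \<notin> p" "w \<in> E" "\<And>j. c * u j - w j \<in> p"
    unfolding extend_by_def by auto
  have "\<forall>c\<in>C. w c \<in> p" using cw(3) uC by (metis diff_in_cancel' mult_in)
  then have "\<forall>j. w j \<in> p" using assms cw(2) unfolding determined_def by blast
  then have "c * u j \<in> p" for j using cw(3) diff_in_cancel by blast
  then show "\<forall>j. u j \<in> p" using cw(1) by simp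
qed

lemma span_subset_extend_by:
  assumes "fmod.subspace E" "B \<subseteq> extend_by p E v"
  shows "fmod.span B \<subseteq> extend_by p E v"
  using assms by (intro fmod.span_minimal subspace_extend_by)

end

definition det_rank :: "'a::comm_ring_1 set \<Rightarrow> (nat \<Rightarrow> 'a) set \<Rightarrow> nat" where
  "det_rank p E = (LEAST k. \<exists>C. finite C \<and> card C = k \<and> determined p C E)"

lemma det_rank_le: "finite C \<Longrightarrow> determined p C E \<Longrightarrow> det_rank p E \<le> card C"
  unfolding det_rank_def by (rule Least_le) blast

lemma det_rank_obtain:
  assumes "finite C" "determined p C E"
  obtains D where "finite D" "card D = det_rank p E" "determined p D E"
proof -
  have "\<exists>D. finite D \<and> card D = det_rank p E \<and> determined p D E"
    unfolding det_rank_def by (rule LeastI_ex) (use assms in blast)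
  then show ?thesis using that by blast
qed

section \<open>Pseudo-division\<close>

definition coeffs_in :: "'b::comm_ring_1 set \<Rightarrow> 'b poly set" where
  "coeffs_in R = {F. \<forall>i. coeff F i \<in> R}"

text \<open>The polynomials in a set of variables form a subset of one type, so division by a
  polynomial in x_k has to record that all coefficients stay in that subset.\<close>

locale subring_set =
  fixes R :: "'b::comm_ring_1 set"
  assumes zero_R [simp]: "0 \<in> R" and one_R [simp]: "1 \<in> R"
    and add_R: "a \<in> R \<Longrightarrow> b \<in> R \<Longrightarrow> a + b \<in> R"
    and uminus_R: "a \<in> R \<Longrightarrow> - a \<in> R"
    and mult_R: "a \<in> R \<Longrightarrow> b \<in> R \<Longrightarrow> a * b \<in> R"
begin

lemma diff_R: "a \<in> R \<Longrightarrow> b \<in> R \<Longrightarrow> a - b \<in> R"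
  using add_R[of a "- b"] uminus_R by simp

lemma sum_R: "(\<And>i. i \<in> A \<Longrightarrow> f i \<in> R) \<Longrightarrow> sum f A \<in> R"
  by (induction A rule: infinite_finite_induct) (auto intro: add_R)

lemma power_R: "a \<in> R \<Longrightarrow> a ^ k \<in> R"
  by (induction k) (auto intro: mult_R)

lemma coeffs_in_0 [simp]: "0 \<in> coeffs_in R"
  by (simp add: coeffs_in_def)

lemma coeffs_in_add: "F \<in> coeffs_in R \<Longrightarrow> G \<in> coeffs_in R \<Longrightarrow> F + G \<in> coeffs_in R"
  by (simp add: coeffs_in_def add_R)

lemma coeffs_in_diff: "F \<in> coeffs_in R \<Longrightarrow> G \<in> coeffs_in R \<Longrightarrow> F - G \<in> coeffs_in R"
  by (simp add: coeffs_in_def diff_R)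

lemma coeffs_in_smult: "c \<in> R \<Longrightarrow> F \<in> coeffs_in R \<Longrightarrow> smult c F \<in> coeffs_in R"
  by (simp add: coeffs_in_def mult_R)

lemma coeffs_in_mult: "F \<in> coeffs_in R \<Longrightarrow> G \<in> coeffs_in R \<Longrightarrow> F * G \<in> coeffs_in R"
  by (auto simp: coeffs_in_def coeff_mult intro: sum_R mult_R)

lemma coeffs_in_monom: "c \<in> R \<Longrightarrow> monom c k \<in> coeffs_in R"
  by (simp add: coeffs_in_def)

lemma coeffs_in_sum: "(\<And>i. i \<in> A \<Longrightarrow> f i \<in> coeffs_in R) \<Longrightarrow> sum f A \<in> coeffs_in R"
  by (induction A rule: infinite_finite_induct) (auto intro: coeffs_in_add)

text \<open>Multiplication by a power of the leading coefficient replaces division by it. The degree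
  of the zero polynomial is 0, which is why \<open>r = 0\<close> is a separate alternative when
  \<open>G\<close> is constant. The bound on the degree of \<open>q\<close> serves to keep quotients
  below a relation of minimal degree.\<close>

lemma pseudo_division:
  assumes "F \<in> coeffs_in R" and G: "G \<in> coeffs_in R"
  obtains N q r where "q \<in> coeffs_in R" "r \<in> coeffs_in R"
    "smult (lead_coeff G ^ N) F = q * G + r" "degree r < degree G \<or> r = 0"
    "degree q \<le> degree F - degree G"
proof -
  let ?c = "lead_coeff G" and ?d = "degree G"
  have cR: "?c \<in> R" using G by (simp add: coeffs_in_def)
  have "\<exists>N q r. q \<in> coeffs_in R \<and> r \<in> coeffs_in R \<and> smult (?c ^ N) F = q * G + r
      \<and> (degree r < ?d \<or> r = 0) \<and> degree q \<le> degree F - ?d"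
    using assms(1)
  proof (induction "degree F" arbitrary: F rule: less_induct)
    case less
    show ?case
    proof (cases "degree F < ?d")
      case True
      then show ?thesis using less.prems
        by (intro exI[of _ 0] exI[of _ "0 :: 'b poly"] exI[of _ F]) simp
    next
      case False
      define k where "k = degree F - ?d"
      define m where "m = monom (lead_coeff F) k"
      define F' where "F' = smult ?c F - m * G"
      have mR: "m \<in> coeffs_in R"
        unfolding m_def using less.prems by (intro coeffs_in_monom) (simp add: coeffs_in_def)
      have F'R: "F' \<in> coeffs_in R"
        unfolding F'_def using less.prems mR G cR
        by (intro coeffs_in_diff coeffs_in_smult coeffs_in_mult)
      have mdeg: "degree m \<le> k" unfolding m_def by (rule degree_monom_le)
      have "degree (m * G) \<le> degree F"
        using degree_mult_le[of m G] mdeg False unfolding k_def by linarith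
      then have le: "degree F' \<le> degree F"
        unfolding F'_def by (intro degree_diff_le) (auto intro: order_trans[OF degree_smult_le])
      have "coeff (m * G) (degree F) = lead_coeff F * ?c"
        unfolding m_def coeff_monom_mult using False by (simp add: k_def)
      then have top: "coeff F' (degree F) = 0"
        unfolding F'_def by (simp add: mult.commute)
      have eq: "smult (?c ^ Suc N) F = smult (?c ^ N) F' + smult (?c ^ N) m * G" for N
        unfolding F'_def by (simp add: smult_diff_right mult.commute)
      show ?thesis
      \<comment> \<open>For constant \<open>F\<close> and \<open>G\<close> the difference is 0,
        whose degree is again 0; the induction hypothesis would not apply.\<close>
      proof (cases "F' = 0")
        case True
        then show ?thesis using mR mdeg eq[of 0] k_def
          by (intro exI[of _ "Suc 0"] exI[of _ m] exI[of _ "0 :: 'b poly"]) simp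
      next
        case False
        have lt: "degree F' < degree F"
        proof (rule ccontr)
          assume "\<not> ?thesis"
          then have "degree F' = degree F" using le by simp
          then show False using top False by (metis leading_coeff_0_iff)
        qed
        obtain N q r where IH: "q \<in> coeffs_in R" "r \<in> coeffs_in R" "smult (?c ^ N) F' = q * G + r"
            "degree r < ?d \<or> r = 0" "degree q \<le> degree F' - ?d"
          using less.hyps[OF lt F'R] by blast
        have "smult (?c ^ Suc N) F = (q + smult (?c ^ N) m) * G + r"
          unfolding eq IH(3) by (simp add: algebra_simps)
        moreover have "q + smult (?c ^ N) m \<in> coeffs_in R"
          using IH mR cR by (intro coeffs_in_add coeffs_in_smult power_R)
        moreover have "degree (q + smult (?c ^ N) m) \<le> degree F - ?d"
        proof (rule degree_add_le)
          show "degree q \<le> degree F - ?d" using IH(5) lt by linarith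
          show "degree (smult (?c ^ N) m) \<le> degree F - ?d"
            using degree_smult_le[of "?c ^ N" m] mdeg unfolding k_def by linarith
        qed
        ultimately show ?thesis using IH(2,4) by blast
      qed
    qed
  qed
  then show thesis using that by blast
qed

end

lemma subring_pols_in: "subring_set (pols_in V)"
  by unfold_locales (auto intro: pols_in_add pols_in_mult)

lemma pol_var_power: "pol_var k ^ m = Poly_Mapping.single (Poly_Mapping.single k m) 1"
proof (induction m)
  case (Suc m)
  then show ?case by (simp add: pol_var_def mult_single flip: single_add)
qed simp

lemma pols_in_insert:
  assumes "g \<in> pols_in (insert k V)"
  obtains F where "F \<in> coeffs_in (pols_in V)" "g = poly F (pol_var k)"
proof -
  interpret subring_set "pols_in V" by (rule subring_pols_in)
  define e' where "e' e = e - Poly_Mapping.single k (Poly_Mapping.lookup e k)" for e :: "nat \<Rightarrow>\<^sub>0 nat"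
  define F where "F = (\<Sum>e\<in>Poly_Mapping.keys g.
    monom (Poly_Mapping.single (e' e) (Poly_Mapping.lookup g e)) (Poly_Mapping.lookup e k))"
  have e': "e' e + Poly_Mapping.single k (Poly_Mapping.lookup e k) = e" for e
    unfolding e'_def
    by (rule poly_mapping_eqI) (auto simp: lookup_add lookup_minus lookup_single when_def)
  have "F \<in> coeffs_in (pols_in V)"
    unfolding F_def
  proof (intro coeffs_in_sum coeffs_in_monom pols_in_single)
    fix e assume "e \<in> Poly_Mapping.keys g"
    then have "Poly_Mapping.keys e \<subseteq> insert k V" using assms by (auto simp: pols_in_def)
    moreover have "Poly_Mapping.keys (e' e) \<subseteq> Poly_Mapping.keys e - {k}"
      by (auto simp: e'_def in_keys_iff lookup_minus lookup_single when_def)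
    ultimately show "Poly_Mapping.keys (e' e) \<subseteq> V" by blast
  qed
  moreover have "poly F (pol_var k) = (\<Sum>e\<in>Poly_Mapping.keys g. Poly_Mapping.single e (Poly_Mapping.lookup g e))"
    unfolding F_def by (simp add: poly_sum poly_monom pol_var_power mult_single e')
  ultimately show thesis using that sum_single[of g] by metis
qed

lemma poly_in_pols_in:
  assumes "F \<in> coeffs_in (pols_in V)" "V \<subseteq> W" "k \<in> W"
  shows "poly F (pol_var k) \<in> pols_in W"
  unfolding poly_altdef
  using assms by (intro pols_in_sum pols_in_mult pols_in_power pol_var_in)
    (auto simp: coeffs_in_def intro: pols_in_mono)

section \<open>The conormal rank of a prime\<close>

text \<open>What is used of A as a localized quotient: \<open>bar\<close> is a homomorphism on the
  polynomials in the first \<open>n\<close> variables (the type has infinitely many), and every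
  element is a fraction of images whose denominator is a unit, with inverse
  \<open>t\<close>.\<close>

locale presented_algebra =
  fixes n :: nat and bar :: "'k::field mpol \<Rightarrow> 'a::idom"
  assumes bar_add: "f \<in> pols_in {..<n} \<Longrightarrow> g \<in> pols_in {..<n} \<Longrightarrow> bar (f + g) = bar f + bar g"
    and bar_mult: "f \<in> pols_in {..<n} \<Longrightarrow> g \<in> pols_in {..<n} \<Longrightarrow> bar (f * g) = bar f * bar g"
    and bar_1 [simp]: "bar 1 = 1"
    and bar_frac: "\<exists>g\<in>pols_in {..<n}. \<exists>s\<in>pols_in {..<n}. \<exists>t. a * bar s = bar g \<and> t * bar s = 1"
begin

abbreviation P :: "'k mpol set" where "P \<equiv> pols_in {..<n}"

lemma bar_0 [simp]: "bar 0 = 0"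
proof -
  have "bar (0 + 0) = bar 0 + bar 0" by (rule bar_add) simp_all
  then show ?thesis by (simp only: add_0_left add_cancel_right_right)
qed

lemma bar_uminus: "f \<in> P \<Longrightarrow> bar (- f) = - bar f"
  using bar_add[of f "- f"] by (simp add: add_eq_0_iff2)

lemma bar_diff: "f \<in> P \<Longrightarrow> g \<in> P \<Longrightarrow> bar (f - g) = bar f - bar g"
  using bar_add[of f "- g"] bar_uminus[of g] by simp

lemma bar_sum: "(\<And>i. i \<in> A \<Longrightarrow> f i \<in> P) \<Longrightarrow> bar (sum f A) = (\<Sum>i\<in>A. bar (f i))"
  by (induction A rule: infinite_finite_induct) (auto simp: bar_add pols_in_sum)

lemma bar_power: "f \<in> P \<Longrightarrow> bar (f ^ k) = bar f ^ k"
  by (induction k) (auto simp: bar_mult pols_in_power)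

lemma bar_const_unit:
  assumes "c \<noteq> 0"
  shows "bar (pol_const c) * bar (pol_const (1 / c)) = 1"
proof -
  have "pol_const c * pol_const (1 / c) = (1 :: 'k mpol)"
    using assms by (simp add: pol_const_def mult_single)
  then show ?thesis using bar_mult[of "pol_const c" "pol_const (1 / c)"] by simp
qed

definition grad :: "'k mpol \<Rightarrow> nat \<Rightarrow> 'a" where
  "grad g = (\<lambda>j. bar (pol_pderiv j g))"

lemma grad_0 [simp]: "grad 0 = 0"
  by (simp add: grad_def fun_eq_iff)

lemma grad_1 [simp]: "grad 1 = 0"
  by (simp add: grad_def fun_eq_iff)

lemma grad_add: "f \<in> P \<Longrightarrow> g \<in> P \<Longrightarrow> grad (f + g) = grad f + grad g"
  by (simp add: grad_def fun_eq_iff pol_pderiv_add bar_add pol_pderiv_in)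

lemma grad_diff: "f \<in> P \<Longrightarrow> g \<in> P \<Longrightarrow> grad (f - g) = grad f - grad g"
  by (simp add: grad_def fun_eq_iff pol_pderiv_diff bar_diff pol_pderiv_in)

lemma grad_mult: "f \<in> P \<Longrightarrow> g \<in> P \<Longrightarrow>
    grad (f * g) = fscale (bar f) (grad g) + fscale (bar g) (grad f)"
  by (simp add: grad_def fun_eq_iff pol_pderiv_mult bar_add bar_mult pol_pderiv_in pols_in_mult fscale_def)

lemma sum_apply: "(\<Sum>i\<in>A. F i) x = (\<Sum>i\<in>A. F i x :: 'a)"
  by (induction A rule: infinite_finite_induct) auto

lemma grad_sum: "(\<And>i. i \<in> A \<Longrightarrow> f i \<in> P) \<Longrightarrow> grad (sum f A) = (\<Sum>i\<in>A. grad (f i))"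
  by (induction A rule: infinite_finite_induct) (auto simp: grad_add pols_in_sum)

text \<open>Over the residue field this becomes the image, under the differential, of the conormal
  module of the prime that \<open>p\<close> cuts out in the polynomials in \<open>V\<close>. For
  \<open>V = {..<n}\<close> its \<open>det_rank\<close> is the number rho of the overview.\<close>

definition conormal :: "'a set \<Rightarrow> nat set \<Rightarrow> (nat \<Rightarrow> 'a) set" where
  "conormal p V = fmod.span {grad g |g. g \<in> pols_in V \<and> bar g \<in> p}"

lemma subspace_conormal: "fmod.subspace (conormal p V)"
  unfolding conormal_def by (rule fmod.subspace_span)

lemma grad_in_conormal: "g \<in> pols_in V \<Longrightarrow> bar g \<in> p \<Longrightarrow> grad g \<in> conormal p V"
  unfolding conormal_def by (rule fmod.span_base) blast

lemma conormal_notin: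
  assumes "e \<in> conormal p V" "j \<notin> V"
  shows "e j = 0"
proof -
  have "fmod.subspace {e :: nat \<Rightarrow> 'a. e j = 0}"
    by (auto intro!: fmod.subspaceI simp: fscale_def)
  moreover have "{grad g |g. g \<in> pols_in V \<and> bar g \<in> p} \<subseteq> {e. e j = 0}"
    using assms(2) by (auto simp: grad_def pol_pderiv_notin)
  ultimately show ?thesis using assms(1) fmod.span_minimal unfolding conormal_def by blast
qed

lemma conormal_determined_restrict:
  assumes "determined p C (conormal p {..<n})" "0 \<in> p"
  shows "determined p (C \<inter> {..<n}) (conormal p {..<n})"
  unfolding determined_def
proof (intro ballI impI)
  fix e assume e: "e \<in> conormal p {..<n}" and C: "\<forall>c\<in>C \<inter> {..<n}. e c \<in> p"
  then have "\<forall>c\<in>C. e c \<in> p"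
    using conormal_notin[OF e] assms(2) by (metis IntI)
  then show "\<forall>j. e j \<in> p" using assms(1) e unfolding determined_def by blast
qed

lemma conormal_determined_all:
  assumes "0 \<in> p"
  shows "determined p {..<n} (conormal p {..<n})"
  unfolding determined_def
proof (intro ballI impI allI)
  fix e j assume "e \<in> conormal p {..<n}" "\<forall>c\<in>{..<n}. e c \<in> p"
  then show "e j \<in> p" using conormal_notin[of e p "{..<n}" j] assms by (cases "j < n") auto
qed

text \<open>The variables outside a determining set are algebraically independent modulo \<open>q\<close>.\<close>

lemma conormal_independent:
  assumes q: "prime_set q" and C: "determined q C (conormal q {..<n})"
    and K: "CHAR('k) > 0" "perfect_field TYPE('k)"
    and g: "g \<in> pols_in ({..<n} - C)" "bar g \<in> q"
  shows "g = 0"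
proof -
  interpret q: prime_set q by (rule q)
  let ?V = "{..<n} - C"
  let ?Z = "{g \<in> pols_in ?V. bar g \<in> q}"
  have VP: "g \<in> P" if "g \<in> pols_in ?V" for g using that by (rule pols_in_mono[rotated]) auto
  show ?thesis
  proof (rule perfect_descent[OF refl K, of ?Z ?V])
    fix c assume c: "pol_const c \<in> ?Z"
    show "c = 0"
    proof (rule ccontr)
      assume "c \<noteq> 0"
      from bar_const_unit[OF this] have "1 = bar (pol_const c) * bar (pol_const (1 / c))" by simp
      also have "\<dots> \<in> q" using c by simp
      finally show False by simp
    qed
  next
    fix g j assume gZ: "g \<in> ?Z"
    then have "grad g \<in> conormal q {..<n}" using VP by (auto intro: grad_in_conormal)
    \<comment> \<open>The point of the choice of variables: \<open>g\<close> does not involve those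
      in \<open>C\<close>, so its gradient vanishes there, and the determining property puts all its
      partial derivatives into \<open>q\<close>.\<close>
    moreover have "\<forall>c\<in>C. grad g c \<in> q" using gZ by (auto simp: grad_def pol_pderiv_notin[of g ?V])
    ultimately have "grad g j \<in> q" using C unfolding determined_def by blast
    then show "pol_pderiv j g \<in> ?Z" using gZ by (simp add: grad_def pol_pderiv_in)
  next
    fix h assume h: "h \<in> pols_in ?V" "h ^ CHAR('k) \<in> ?Z"
    then have "bar h ^ CHAR('k) \<in> q" using VP by (simp add: bar_power)
    then show "h \<in> ?Z" using h by (simp add: q.power_in_iff)
  qed (use g in auto)
qed

section \<open>Adjoining one variable, transcendental or algebraic modulo a prime\<close>

lemma bar_poly_in:
  assumes "prime_set p" "F \<in> coeffs_in P" "k < n" "\<And>i. bar (coeff F i) \<in> p"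
  shows "bar (poly F (pol_var k)) \<in> p"
proof -
  interpret prime_set p by fact
  have x: "pol_var k \<in> P" using assms by (intro pol_var_in) simp
  have cP: "coeff F i \<in> P" for i using assms by (auto simp: coeffs_in_def)
  have "bar (poly F (pol_var k)) = (\<Sum>i\<le>degree F. bar (coeff F i) * bar (pol_var k) ^ i)"
    unfolding poly_altdef using x cP
    by (subst bar_sum) (simp_all add: bar_mult bar_power pols_in_mult pols_in_power)
  also have "\<dots> \<in> p" using assms(4) by (intro sum_in) simp
  finally show ?thesis .
qed

lemma coeffs_in_P: "F \<in> coeffs_in (pols_in V) \<Longrightarrow> V \<subseteq> {..<n} \<Longrightarrow> F \<in> coeffs_in P"
  unfolding coeffs_in_def by (auto intro: pols_in_mono)

lemma poly_var_P: "F \<in> coeffs_in (pols_in V) \<Longrightarrow> V \<subseteq> {..<n} \<Longrightarrow> k < n \<Longrightarrow> poly F (pol_var k) \<in> P"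
  by (rule poly_in_pols_in) auto

text \<open>A relation \<open>G\<close> witnesses that \<open>x\<^sub>k\<close> is algebraic over the variables in \<open>V\<close> modulo \<open>p\<close>.\<close>

definition relation :: "'a set \<Rightarrow> nat set \<Rightarrow> nat \<Rightarrow> 'k mpol poly \<Rightarrow> bool" where
  "relation p V k G \<longleftrightarrow> G \<in> coeffs_in (pols_in V) \<and> bar (poly G (pol_var k)) \<in> p
     \<and> bar (lead_coeff G) \<notin> p"

text \<open>Leading terms with coefficient in \<open>p\<close> can be deleted without losing that
  the value lies in \<open>p\<close>. The coefficient at \<open>i\<close> is never deleted, so this
  ends at a relation, whose degree has not increased.\<close>

lemma relation_of_coeff:
  assumes "prime_set p" "V \<subseteq> {..<n}" "k < n"
    and "F \<in> coeffs_in (pols_in V)" "bar (poly F (pol_var k)) \<in> p" "bar (coeff F i) \<notin> p"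
  obtains G where "relation p V k G" "degree G \<le> degree F"
proof -
  interpret prime_set p by fact
  interpret R: subring_set "pols_in V" by (rule subring_pols_in)
  have "\<exists>G. relation p V k G \<and> degree G \<le> degree F"
    using assms(4-6)
  proof (induction "degree F" arbitrary: F rule: less_induct)
    case less
    show ?case
    proof (cases "bar (lead_coeff F) \<in> p")
      case False
      then show ?thesis using less.prems unfolding relation_def by blast
    next
      case True
      define m where "m = monom (lead_coeff F) (degree F)"
      have m: "m \<in> coeffs_in (pols_in V)"
        unfolding m_def using less.prems(1) by (intro R.coeffs_in_monom) (simp add: coeffs_in_def)
      have F': "F - m \<in> coeffs_in (pols_in V)" using m less.prems(1) by (rule R.coeffs_in_diff[rotated])
      have "bar (coeff m j) \<in> p" for j using True by (auto simp: m_def)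
      then have "bar (poly m (pol_var k)) \<in> p"
        using m assms(1-3) by (intro bar_poly_in coeffs_in_P)
      then have 1: "bar (poly (F - m) (pol_var k)) \<in> p"
        using less.prems m assms(2,3) by (simp add: bar_diff poly_var_P diff_in)
      have "i \<noteq> degree F" using True less.prems(3) by auto
      then have 2: "bar (coeff (F - m) i) \<notin> p" using less.prems(3) by (simp add: m_def)
      have "degree m \<le> degree F" unfolding m_def by (rule degree_monom_le)
      then have "degree (F - m) \<le> degree F" by (intro degree_diff_le) auto
      moreover have "degree (F - m) \<noteq> degree F"
      proof
        assume "degree (F - m) = degree F"
        then have "lead_coeff (F - m) = 0" by (simp add: m_def)
        then have "F - m = 0" by (simp only: leading_coeff_0_iff)
        then show False using 2 by simp
      qed
      ultimately have lt: "degree (F - m) < degree F" by simp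
      obtain G where "relation p V k G" "degree G \<le> degree (F - m)"
        using less.hyps[OF lt F' 1 2] by blast
      then show ?thesis using lt by (intro exI[of _ G]) simp
    qed
  qed
  then show thesis using that by blast
qed

text \<open>By the product rule, the terms that differentiate powers of x_k have coefficients in
  \<open>p\<close>; what remains is a combination of gradients of the coefficients of
  \<open>F\<close>.\<close>

lemma grad_poly_coeffs:
  assumes "prime_set p" "V \<subseteq> {..<n}" "k < n"
    and F: "F \<in> coeffs_in (pols_in V)" "\<And>i. bar (coeff F i) \<in> p"
  obtains w where "w \<in> conormal p V" "\<And>j. grad (poly F (pol_var k)) j - w j \<in> p"
proof -
  interpret prime_set p by fact
  let ?x = "pol_var k :: 'k mpol"
  have x: "?x ^ i \<in> P" for i using assms by (intro pols_in_power pol_var_in) simp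
  have cV: "coeff F i \<in> pols_in V" for i using F by (simp add: coeffs_in_def)
  then have cP: "coeff F i \<in> P" for i using assms(2) pols_in_mono by blast
  define w where "w = (\<Sum>i\<le>degree F. fscale (bar (?x ^ i)) (grad (coeff F i)))"
  have "w \<in> conormal p V"
    unfolding w_def using cV F(2)
    by (intro fmod.subspace_sum fmod.subspace_scale subspace_conormal grad_in_conormal)
  moreover have "grad (poly F ?x) j - w j \<in> p" for j
  proof -
    have "grad (poly F ?x) = (\<Sum>i\<le>degree F. grad (coeff F i * ?x ^ i))"
      unfolding poly_altdef using cP x by (intro grad_sum pols_in_mult)
    also have "\<dots> = (\<Sum>i\<le>degree F. fscale (bar (coeff F i)) (grad (?x ^ i))) + w"
      unfolding w_def using cP x by (simp add: grad_mult sum.distrib)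
    finally have "grad (poly F ?x) j - w j = (\<Sum>i\<le>degree F. bar (coeff F i) * grad (?x ^ i) j)"
      by (simp add: fscale_def sum_apply)
    also have "\<dots> \<in> p" using F(2) by (intro sum_in) simp
    finally show ?thesis .
  qed
  ultimately show thesis using that by blast
qed

text \<open>Without a relation, a polynomial in x_k that vanishes modulo \<open>p\<close> has all
  its coefficients in the prime, so its gradient is already known from \<open>V\<close>.\<close>

lemma conormal_insert_free:
  assumes "prime_set p" "V \<subseteq> {..<n}" "k < n" and no: "\<nexists>G. relation p V k G"
  shows "conormal p (insert k V) \<subseteq> extend_by p (conormal p V) 0"
proof -
  interpret prime_set p by fact
  show ?thesis
    unfolding conormal_def[of p "insert k V"]
  proof (rule span_subset_extend_by[OF subspace_conormal], safe)
    fix g assume g: "g \<in> pols_in (insert k V)" "bar g \<in> p"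
    obtain F where F: "F \<in> coeffs_in (pols_in V)" "g = poly F (pol_var k)"
      using pols_in_insert[OF g(1)] .
    have "bar (coeff F i) \<in> p" for i
      using relation_of_coeff[OF assms(1-3) F(1), of i] no g(2) F(2) by blast
    then obtain w where w: "w \<in> conormal p V" "\<And>j. grad g j - w j \<in> p"
      using grad_poly_coeffs[OF assms(1-3) F(1)] F(2) by blast
    have "1 \<notin> p \<and> w \<in> conormal p V \<and> (\<forall>j. 1 * grad g j - 0 * (0 :: nat \<Rightarrow> 'a) j - w j \<in> p)"
      using w by simp
    then show "grad g \<in> extend_by p (conormal p V) 0" unfolding extend_by_def by blast
  qed
qed

text \<open>Pseudo-division by a relation \<open>G\<close> of least degree leaves a remainder that
  vanishes modulo \<open>p\<close>; by minimality all its coefficients do, so its gradient comes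
  from \<open>V\<close>. Modulo \<open>p\<close> the gradient of \<open>g\<close>, times a power of
  the leading coefficient of \<open>G\<close>, is then a multiple of the gradient of
  \<open>G\<close> plus that contribution: one new vector is enough.\<close>

lemma conormal_insert_algebraic:
  assumes "prime_set p" "V \<subseteq> {..<n}" "k < n" and G: "relation p V k G"
    and min: "\<And>H. relation p V k H \<Longrightarrow> degree G \<le> degree H"
  shows "conormal p (insert k V) \<subseteq> extend_by p (conormal p V) (grad (poly G (pol_var k)))"
proof -
  interpret prime_set p by fact
  interpret R: subring_set "pols_in V" by (rule subring_pols_in)
  let ?x = "pol_var k :: 'k mpol"
  note G' = G[unfolded relation_def]
  show ?thesis
    unfolding conormal_def[of p "insert k V"]
  proof (rule span_subset_extend_by[OF subspace_conormal], safe)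
    fix g assume g: "g \<in> pols_in (insert k V)" "bar g \<in> p"
    obtain F where F: "F \<in> coeffs_in (pols_in V)" "g = poly F ?x"
      using pols_in_insert[OF g(1)] .
    obtain N q r where qr: "q \<in> coeffs_in (pols_in V)" "r \<in> coeffs_in (pols_in V)"
      "smult (lead_coeff G ^ N) F = q * G + r" "degree r < degree G \<or> r = 0"
      using R.pseudo_division[OF F(1)] G' by metis
    define c where "c = lead_coeff G ^ N"
    have lcP: "lead_coeff G \<in> P" using G' coeffs_in_P[OF _ assms(2)] by (auto simp: coeffs_in_def)
    have cP: "c \<in> P" unfolding c_def by (rule pols_in_power[OF lcP])
    have cp: "bar c \<notin> p" using G' lcP by (simp add: c_def bar_power power_in_iff)
    have P: "poly F ?x \<in> P" "poly q ?x \<in> P" "poly G ?x \<in> P" "poly r ?x \<in> P"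
      using F qr G' assms(2,3) by (auto intro: poly_var_P)
    have eq: "c * g = poly q ?x * poly G ?x + poly r ?x"
      unfolding F(2) c_def by (metis poly_add poly_mult poly_smult qr(3))
    have "bar (poly r ?x) = bar c * bar g - bar (poly q ?x) * bar (poly G ?x)"
      using arg_cong[OF eq, of bar] P cP F(2) by (simp add: bar_add bar_mult pols_in_mult)
    then have rp: "bar (poly r ?x) \<in> p" using g(2) G' by (simp add: diff_in)
    have "bar (coeff r i) \<in> p" for i
    proof (rule ccontr)
      assume i: "bar (coeff r i) \<notin> p"
      then have "r \<noteq> 0" by auto
      then have "degree r < degree G" using qr(4) by simp
      moreover obtain H where "relation p V k H" "degree H \<le> degree r"
        using relation_of_coeff[OF assms(1-3) qr(2) rp i] .
      ultimately show False using min by fastforce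
    qed
    then obtain w where w: "w \<in> conormal p V" "\<And>j. grad (poly r ?x) j - w j \<in> p"
      using grad_poly_coeffs[OF assms(1-3) qr(2)] by blast
    have "grad (c * g) = grad (poly q ?x * poly G ?x + poly r ?x)" by (simp only: eq)
    then have gr: "fscale (bar c) (grad g) + fscale (bar g) (grad c) =
      fscale (bar (poly q ?x)) (grad (poly G ?x)) + fscale (bar (poly G ?x)) (grad (poly q ?x)) + grad (poly r ?x)"
      using P cP F(2) by (simp add: grad_add grad_mult pols_in_mult)
    have "bar c * grad g j - bar (poly q ?x) * grad (poly G ?x) j - w j \<in> p" for j
    proof -
      have "bar c * grad g j - bar (poly q ?x) * grad (poly G ?x) j - w j
        = bar (poly G ?x) * grad (poly q ?x) j - bar g * grad c j + (grad (poly r ?x) j - w j)"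
        using fun_cong[OF gr, of j] by (simp add: fscale_def algebra_simps)
      also have "\<dots> \<in> p" using g(2) G' by (intro add_in[OF diff_in w(2)]) simp_all
      finally show ?thesis .
    qed
    then show "grad g \<in> extend_by p (conormal p V) (grad (poly G ?x))"
      unfolding extend_by_def using cp w(1) by blast
  qed
qed

text \<open>Incomparability of primes in an algebraic extension, in elementary form. Call
  \<open>H\<close> bad if its value lies in \<open>q\<close> but not in \<open>p\<close>, and let
  \<open>H\<close> have least degree. Division by \<open>G\<close> shows that \<open>H\<close> has
  smaller degree than \<open>G\<close>; deleting a leading term in \<open>p\<close> would keep it
  bad, so its leading coefficient is outside \<open>p\<close>; the hypothesis on \<open>V\<close>
  makes it nonconstant. Now divide \<open>G\<close> by \<open>H\<close>. The remainder is too small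
  to be bad, so its value is in \<open>p\<close>, and hence so is that of the quotient
  \<open>u\<close>. As \<open>u\<close> has smaller degree than \<open>G\<close>, all its
  coefficients lie in \<open>p\<close>.\<close>

lemma prime_eq_insert_algebraic:
  assumes "prime_set p" "prime_set q" "p \<subseteq> q" "V \<subseteq> {..<n}" "k < n" and G: "relation p V k G"
    and min: "\<And>H. relation p V k H \<Longrightarrow> degree G \<le> degree H"
    and V: "\<And>g. g \<in> pols_in V \<Longrightarrow> bar g \<in> q \<Longrightarrow> bar g \<in> p"
    and g: "g \<in> pols_in (insert k V)" "bar g \<in> q"
  shows "bar g \<in> p"
proof (rule ccontr)
  assume gp: "bar g \<notin> p"
  interpret prime_set p by fact
  interpret q: prime_set q by fact
  interpret R: subring_set "pols_in V" by (rule subring_pols_in)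
  let ?x = "pol_var k :: 'k mpol"
  note G' = G[unfolded relation_def]
  note PI = poly_var_P[OF _ assms(4,5)]
  have lead_P: "H \<in> coeffs_in (pols_in V) \<Longrightarrow> lead_coeff H \<in> P" for H
    using coeffs_in_P[OF _ assms(4)] by (auto simp: coeffs_in_def)
  define bad where "bad H \<longleftrightarrow> H \<in> coeffs_in (pols_in V) \<and> bar (poly H ?x) \<in> q \<and> bar (poly H ?x) \<notin> p" for H
  have div: "bar (poly r ?x) = bar (lead_coeff D) ^ N * bar (poly F ?x) - bar (poly u ?x) * bar (poly D ?x)"
    if "smult (lead_coeff D ^ N) F = u * D + r" "F \<in> coeffs_in (pols_in V)" "D \<in> coeffs_in (pols_in V)"
      "u \<in> coeffs_in (pols_in V)" "r \<in> coeffs_in (pols_in V)" for r D N F u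
  proof -
    have "lead_coeff D ^ N * poly F ?x = poly u ?x * poly D ?x + poly r ?x"
      using arg_cong[OF that(1), of "\<lambda>F. poly F ?x"] by simp
    from arg_cong[OF this, of bar] show ?thesis
      using that(2-5) by (simp add: bar_add bar_mult bar_power pols_in_mult pols_in_power PI lead_P)
  qed
  obtain F where F: "F \<in> coeffs_in (pols_in V)" "g = poly F ?x"
    using pols_in_insert[OF g(1)] .
  have badF: "bad F" using F g(2) gp by (simp add: bad_def)
  then obtain H where H: "bad H" and Hmin: "\<And>H'. bad H' \<Longrightarrow> degree H \<le> degree H'"
    using ex_has_least_nat[of bad F degree] by blast
  have Hlt: "degree H < degree G"
  proof -
    obtain N u r where ur: "u \<in> coeffs_in (pols_in V)" "r \<in> coeffs_in (pols_in V)"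
      "smult (lead_coeff G ^ N) H = u * G + r" "degree r < degree G \<or> r = 0"
      using R.pseudo_division H G' bad_def by metis
    have r: "bar (poly r ?x) = bar (lead_coeff G) ^ N * bar (poly H ?x) - bar (poly u ?x) * bar (poly G ?x)"
      using div[OF ur(3)] ur H G' by (simp add: bad_def)
    have Gq: "bar (poly G ?x) \<in> q" using G' assms(3) by blast
    have "bar (poly r ?x) \<in> q" unfolding r using H Gq by (intro q.diff_in) (simp_all add: bad_def)
    moreover have rp: "bar (poly r ?x) \<notin> p"
    proof
      assume "bar (poly r ?x) \<in> p"
      then have "bar (lead_coeff G) ^ N * bar (poly H ?x) \<in> p"
        unfolding r using G' by (metis diff_in_cancel mult_in)
      then show False using G' H by (simp add: bad_def power_in_iff)
    qed
    ultimately have "bad r" using ur(2) by (simp add: bad_def)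
    then have "degree H \<le> degree r" by (rule Hmin)
    moreover have "r \<noteq> 0" using rp by auto
    ultimately show ?thesis using ur(4) by simp
  qed
  have Hlead: "bar (lead_coeff H) \<notin> p"
  proof
    assume lp: "bar (lead_coeff H) \<in> p"
    define m where "m = monom (lead_coeff H) (degree H)"
    have mV: "m \<in> coeffs_in (pols_in V)"
      unfolding m_def using H by (intro R.coeffs_in_monom) (simp add: coeffs_in_def bad_def)
    have "bar (coeff m j) \<in> p" for j using lp by (auto simp: m_def)
    then have mp: "bar (poly m ?x) \<in> p"
      using mV assms by (intro bar_poly_in coeffs_in_P)
    have e: "bar (poly (H - m) ?x) = bar (poly H ?x) - bar (poly m ?x)"
      using H mV by (simp add: bar_diff PI bad_def)
    have "bar (poly (H - m) ?x) \<in> q" unfolding e using H mp assms(3)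
      by (intro q.diff_in) (auto simp: bad_def)
    moreover have np: "bar (poly (H - m) ?x) \<notin> p" unfolding e using H mp diff_in_cancel by (auto simp: bad_def)
    ultimately have "bad (H - m)" using H mV by (simp add: bad_def R.coeffs_in_diff)
    then have "degree H \<le> degree (H - m)" by (rule Hmin)
    moreover have "degree (H - m) \<le> degree H"
      unfolding m_def by (intro degree_diff_le degree_monom_le) auto
    ultimately have "lead_coeff (H - m) = 0" by (simp add: m_def)
    then have "H - m = 0" by (simp only: leading_coeff_0_iff)
    then show False using np by simp
  qed
  have Hpos: "degree H > 0"
  proof (rule ccontr)
    assume "\<not> ?thesis"
    then obtain a where a: "H = [:a:]" using degree_eq_zeroE by blast
    then have "coeff H 0 \<in> pols_in V" using H unfolding bad_def coeffs_in_def by blast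
    then have "a \<in> pols_in V" using a by simp
    then show False using V[of a] H a by (simp add: bad_def)
  qed
  obtain N u r where ur: "u \<in> coeffs_in (pols_in V)" "r \<in> coeffs_in (pols_in V)"
    "smult (lead_coeff H ^ N) G = u * H + r" "degree r < degree H \<or> r = 0" "degree u \<le> degree G - degree H"
    using R.pseudo_division[of G H] H G' bad_def by metis
  have r: "bar (poly r ?x) = bar (lead_coeff H) ^ N * bar (poly G ?x) - bar (poly u ?x) * bar (poly H ?x)"
    using div[OF ur(3)] ur H G' by (simp add: bad_def)
  have Gq: "bar (poly G ?x) \<in> q" using G' assms(3) by blast
  have "bar (poly r ?x) \<in> q" unfolding r using H Gq by (intro q.diff_in) (simp_all add: bad_def)
  moreover have "\<not> bad r" using Hmin[of r] ur(4) Hpos by auto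
  ultimately have rp: "bar (poly r ?x) \<in> p" using ur(2) by (simp add: bad_def)
  have "bar (poly u ?x) * bar (poly H ?x) \<in> p"
    using rp G' unfolding r by (metis diff_in_cancel' mult_in)
  then have up: "bar (poly u ?x) \<in> p" using H by (simp add: bad_def)
  have ucoeff: "bar (coeff u i) \<in> p" for i
  proof (rule ccontr)
    assume i: "bar (coeff u i) \<notin> p"
    obtain G2 where "relation p V k G2" "degree G2 \<le> degree u"
      using relation_of_coeff[OF assms(1) assms(4,5) ur(1) up i] .
    then show False using min[of G2] ur(5) Hpos Hlt by linarith
  qed
  have cP: "coeff u i \<in> P" "coeff H i \<in> P" for i
    using ur(1) H coeffs_in_P[OF _ assms(4)] by (auto simp: coeffs_in_def bad_def)
  \<comment> \<open>Comparison in the degree of \<open>G\<close>: the product of leading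
    coefficients is outside \<open>p\<close>, whereas the right-hand side only has terms containing
    a coefficient of \<open>u\<close>.\<close>
  have "coeff r (degree G) = 0" using ur(4) Hlt by (auto intro: coeff_eq_0)
  then have "lead_coeff H ^ N * lead_coeff G = (\<Sum>i\<le>degree G. coeff u i * coeff H (degree G - i))"
    using arg_cong[OF ur(3), of "\<lambda>F. coeff F (degree G)"] by (simp add: coeff_mult)
  from arg_cong[OF this, of bar]
  have "bar (lead_coeff H) ^ N * bar (lead_coeff G) = (\<Sum>i\<le>degree G. bar (coeff u i) * bar (coeff H (degree G - i)))"
    using H G' cP by (simp add: bar_mult bar_power bar_sum pols_in_mult pols_in_power lead_P bad_def)
  also have "\<dots> \<in> p" using ucoeff by (intro sum_in) simp
  finally show False using G' Hlead by (simp add: power_in_iff)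
qed

text \<open>The indicator tells whether the variables used so far already separate \<open>p\<close>
  from \<open>q\<close>. A transcendental variable may switch it on but leaves the determining set
  as it is; an algebraic variable may enlarge that set by one but cannot switch it on. So each
  variable costs at most one.\<close>

lemma conormal_rank_induct:
  assumes p: "prime_set p" and q: "prime_set q" and pq: "p \<subseteq> q"
    and T: "T \<subseteq> {..<n}" "\<And>g. g \<in> pols_in T \<Longrightarrow> bar g \<in> q \<Longrightarrow> g = 0"
    and D: "D \<subseteq> {..<n} - T"
  shows "\<exists>C. finite C \<and> determined p C (conormal p (T \<union> D)) \<and>
    card C + (if \<exists>g\<in>pols_in (T \<union> D). bar g \<in> q - p then 1 else 0) \<le> card D"
proof -
  interpret prime_set p by fact
  interpret q: prime_set q by fact
  have "finite D" using D finite_subset by blast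
  then show ?thesis using D
  proof (induction D rule: finite_induct)
    case empty
    have "{grad g |g. g \<in> pols_in T \<and> bar g \<in> p} \<subseteq> {0}" using T(2) pq by fastforce
    then have "conormal p T \<subseteq> {0}"
      unfolding conormal_def by (intro fmod.span_minimal fmod.subspace_single_0)
    then have "determined p {} (conormal p (T \<union> {}))" unfolding determined_def by auto
    moreover have "\<not> (\<exists>g\<in>pols_in (T \<union> {}). bar g \<in> q - p)"
      using T(2) by (metis DiffD1 DiffD2 Un_empty_right bar_0 zero_in)
    ultimately show ?case by (intro exI[of _ "{}"]) simp
  next
    case (insert k D)
    let ?V = "T \<union> D"
    have k: "k < n" "?V \<subseteq> {..<n}" using insert.prems T(1) by auto
    have eq: "T \<union> insert k D = insert k ?V" by auto
    obtain C where C: "finite C" "determined p C (conormal p ?V)"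
      "card C + (if \<exists>g\<in>pols_in ?V. bar g \<in> q - p then 1 else 0) \<le> card D"
      using insert.IH insert.prems by auto
    have card: "card (insert k D) = Suc (card D)" using insert.hyps by simp
    show ?case
    proof (cases "\<exists>G. relation p ?V k G")
      case False
      have "determined p C (extend_by p (conormal p ?V) 0)" using C(2) by (rule determined_extend_by_0)
      then have "determined p C (conormal p (insert k ?V))"
        using conormal_insert_free[OF p k(2) k(1) False] determined_mono by blast
      then show ?thesis unfolding eq card using C by (intro exI[of _ C]) (auto split: if_splits)
    next
      case True
      then obtain G where G: "relation p ?V k G" "\<And>H. relation p ?V k H \<Longrightarrow> degree G \<le> degree H"
        using ex_has_least_nat[of "relation p ?V k" _ degree] by blast
      obtain C' where C': "finite C'" "card C' \<le> Suc (card C)"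
        "determined p C' (extend_by p (conormal p ?V) (grad (poly G (pol_var k))))"
        using determined_extend_by[OF subspace_conormal C(2,1)] .
      have det: "determined p C' (conormal p (insert k ?V))"
        using C'(3) conormal_insert_algebraic[OF p k(2) k(1) G] determined_mono by blast
      show ?thesis
      proof (cases "\<exists>g\<in>pols_in ?V. bar g \<in> q - p")
        case True
        then show ?thesis unfolding eq card using C C' det by (intro exI[of _ C']) auto
      next
        case False
        have "bar g \<in> p" if "g \<in> pols_in (insert k ?V)" "bar g \<in> q" for g
          by (rule prime_eq_insert_algebraic[OF p q pq k(2,1) G _ that]) (use False in auto)
        then have "\<not> (\<exists>g\<in>pols_in (insert k ?V). bar g \<in> q - p)" by blast
        then show ?thesis unfolding eq card using C C' det by (intro exI[of _ C']) auto
      qed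
    qed
  qed
qed

lemma det_rank_conormal_mono:
  assumes K: "CHAR('k) > 0" "perfect_field TYPE('k)"
    and p: "prime_set p" and q: "prime_set q" and pq: "p \<subseteq> q"
  shows "det_rank p (conormal p {..<n}) + (if p = q then 0 else 1) \<le> det_rank q (conormal q {..<n})"
proof -
  interpret prime_set p by fact
  interpret q: prime_set q by fact
  obtain C0 where C0: "finite C0" "card C0 = det_rank q (conormal q {..<n})" "determined q C0 (conormal q {..<n})"
    using det_rank_obtain[OF _ conormal_determined_all] by (metis finite_lessThan q.zero_in)
  define C where "C = C0 \<inter> {..<n}"
  have C: "determined q C (conormal q {..<n})"
    unfolding C_def using C0(3) by (rule conormal_determined_restrict) simp
  have Cn: "C \<subseteq> {..<n}" "finite C" by (auto simp: C_def)
  let ?T = "{..<n} - C"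
  have un: "?T \<union> C = {..<n}" using Cn by auto
  obtain D where D: "finite D" "determined p D (conormal p {..<n})"
    "card D + (if \<exists>g\<in>P. bar g \<in> q - p then 1 else 0) \<le> card C"
    using conormal_rank_induct[OF p q pq, of ?T C] conormal_independent[OF q C K] Cn un by auto
  \<comment> \<open>Primes that differ in A already differ on images of polynomials, because
    denominators are units and lie in neither prime.\<close>
  have "\<exists>g\<in>P. bar g \<in> q - p" if ne: "p \<noteq> q"
  proof -
    obtain a where a: "a \<in> q" "a \<notin> p" using pq ne by blast
    obtain g s t where gs: "g \<in> P" "s \<in> P" "a * bar s = bar g" "t * bar s = 1"
      using bar_frac[of a] by blast
    have "bar s \<notin> p" using gs(4) mult_in[of "bar s" t] by auto
    then have "bar g \<notin> p" using a gs(3) by (metis primeD)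
    moreover have "bar g \<in> q" using a gs(3) by (metis q.mult_in mult.commute)
    ultimately show ?thesis using gs(1) by blast
  qed
  moreover have "card C \<le> card C0" unfolding C_def using C0(1) by (intro card_mono) auto
  ultimately show ?thesis using D det_rank_le[OF D(1,2)] C0(2) by (auto split: if_splits)
qed

end

section \<open>Minors and rank\<close>

lemma length_omit [simp]: "\<nu> < length xs \<Longrightarrow> length (omit \<nu> xs) = length xs - 1"
  by (simp add: omit_def)

lemma nth_omit:
  assumes "\<nu> < length xs" "b < length xs - 1"
  shows "omit \<nu> xs ! b = xs ! (if b < \<nu> then b else Suc b)"
proof (cases "b < \<nu>")
  case True
  then show ?thesis using assms by (simp add: omit_def nth_append)
next
  case False
  then have "omit \<nu> xs ! b = drop (Suc \<nu>) xs ! (b - \<nu>)" using assms by (simp add: omit_def nth_append)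
  also have "\<dots> = xs ! (Suc \<nu> + (b - \<nu>))" using assms False by (intro nth_drop) simp
  finally show ?thesis using False by simp
qed

lemma omit_last [simp]: "omit (length xs) (xs @ [x]) = xs"
  by (simp add: omit_def)

lemma minor_Nil [simp]: "minor J [] [] = 1"
  unfolding minor_def by (rule det_dim_zero) simp

text \<open>The signs are those in the definition of the derivations, so that applying such a
  derivation to f_l yields a minor with one more row and column.\<close>

lemma minor_laplace:
  assumes "length cc = Suc (length ii)"
  shows "minor J (ii @ [l]) cc =
    (\<Sum>\<nu><length cc. (-1) ^ (length ii + \<nu>) * minor J ii (omit \<nu> cc) * J $$ (l, cc ! \<nu>))"
proof -
  let ?r = "length ii"
  define A where "A = mat (Suc ?r) (Suc ?r) (\<lambda>(a, b). J $$ ((ii @ [l]) ! a, cc ! b))"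
  have "minor J (ii @ [l]) cc = (\<Sum>\<nu><Suc ?r. A $$ (?r, \<nu>) * cofactor A ?r \<nu>)"
    unfolding minor_def using assms laplace_expansion_row[of A "Suc ?r" ?r] by (simp add: A_def)
  also have "\<dots> = (\<Sum>\<nu><Suc ?r. (-1) ^ (?r + \<nu>) * minor J ii (omit \<nu> cc) * J $$ (l, cc ! \<nu>))"
  proof (rule sum.cong[OF refl])
    fix \<nu> assume "\<nu> \<in> {..<Suc ?r}"
    then have \<nu>: "\<nu> < Suc ?r" by simp
    have "mat_delete A ?r \<nu> = mat ?r ?r (\<lambda>(a, b). J $$ (ii ! a, omit \<nu> cc ! b))"
      unfolding mat_delete_def
      by (rule eq_matI) (use \<nu> assms in \<open>auto simp: A_def nth_omit nth_append\<close>)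
    then have "cofactor A ?r \<nu> = (-1) ^ (?r + \<nu>) * minor J ii (omit \<nu> cc)"
      unfolding cofactor_def minor_def using \<nu> assms by simp
    moreover have "A $$ (?r, \<nu>) = J $$ (l, cc ! \<nu>)" using \<nu> by (simp add: A_def)
    ultimately show "A $$ (?r, \<nu>) * cofactor A ?r \<nu> =
        (-1) ^ (?r + \<nu>) * minor J ii (omit \<nu> cc) * J $$ (l, cc ! \<nu>)"
      by (simp add: mult.commute mult.left_commute)
  qed
  finally show ?thesis using assms by simp
qed

lemma minor_not_distinct_cols:
  assumes "length ii = length jj" "\<not> distinct jj"
  shows "minor J ii jj = 0"
proof -
  obtain a b where ab: "a < length jj" "b < length jj" "a \<noteq> b" "jj ! a = jj ! b"
    using assms(2) by (auto simp: distinct_conv_nth)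
  show ?thesis
    unfolding minor_def
    by (rule det_identical_columns[OF _ ab(3,1,2)]) (use ab assms in \<open>auto intro!: eq_vecI\<close>)
qed

lemma minor_not_distinct_rows:
  assumes "length ii = length jj" "\<not> distinct ii"
  shows "minor J ii jj = 0"
proof -
  obtain a b where ab: "a < length ii" "b < length ii" "a \<noteq> b" "ii ! a = ii ! b"
    using assms(2) by (auto simp: distinct_conv_nth)
  show ?thesis
    unfolding minor_def
    by (rule det_identical_rows[OF _ ab(3,1,2)]) (use ab assms in \<open>auto intro!: eq_vecI\<close>)
qed

lemma det_transpose_fun: "det (mat r r (\<lambda>(a, b). F b a)) = det (mat r r (\<lambda>(a, b). F a b))"
proof -
  have "mat r r (\<lambda>(a, b). F b a) = transpose_mat (mat r r (\<lambda>(a, b). F a b))"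
    by (rule eq_matI) auto
  then show ?thesis using det_transpose[of "mat r r (\<lambda>(a, b). F a b)" r] by simp
qed

lemma det_sort:
  fixes F :: "nat \<Rightarrow> nat \<Rightarrow> 'a::comm_ring_1"
  obtains \<epsilon> where "\<epsilon> = 1 \<or> \<epsilon> = -1"
    "det (mat (length xs) (length xs) (\<lambda>(a, b). F (sort xs ! a) b)) =
     \<epsilon> * det (mat (length xs) (length xs) (\<lambda>(a, b). F (xs ! a) b))"
proof -
  let ?r = "length xs"
  obtain p where p: "p permutes {..<?r}" "permute_list p xs = sort xs"
    using mset_eq_permutation[of "sort xs" xs] by auto
  have nth: "sort xs ! a = xs ! p a" if "a < ?r" for a
    using permute_list_nth[OF p(1) that] p(2) by simp
  let ?A = "mat ?r ?r (\<lambda>(a, b). F (xs ! a) b)"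
  have pa: "p a < ?r" if "a < ?r" for a using permutes_in_image[OF p(1)] that by auto
  have "mat ?r ?r (\<lambda>(a, b). F (sort xs ! a) b) = mat ?r ?r (\<lambda>(a, b). ?A $$ (p a, b))"
    by (rule eq_matI) (auto simp: nth pa)
  then have "det (mat ?r ?r (\<lambda>(a, b). F (sort xs ! a) b)) = signof p * det ?A"
    using det_permute_rows[of ?A ?r p] p(1) by (simp add: atLeast0LessThan)
  then show thesis using that[of "signof p"] by (auto simp: sign_def)
qed

lemma minor_sort:
  fixes J :: "'a::comm_ring_1 mat"
  assumes "length ii = length jj"
  obtains \<epsilon> where "\<epsilon> = 1 \<or> \<epsilon> = -1" "minor J (sort ii) (sort jj) = \<epsilon> * minor J ii jj"
proof -
  obtain \<epsilon> where e: "\<epsilon> = 1 \<or> \<epsilon> = -1"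
    "det (mat (length ii) (length ii) (\<lambda>(a, b). J $$ (sort ii ! a, sort jj ! b))) =
     \<epsilon> * det (mat (length ii) (length ii) (\<lambda>(a, b). J $$ (ii ! a, sort jj ! b)))"
    using det_sort[of ii "\<lambda>i b. J $$ (i, sort jj ! b)"] by metis
  obtain \<epsilon>' where e': "\<epsilon>' = 1 \<or> \<epsilon>' = -1"
    "det (mat (length jj) (length jj) (\<lambda>(a, b). J $$ (ii ! b, sort jj ! a))) =
     \<epsilon>' * det (mat (length jj) (length jj) (\<lambda>(a, b). J $$ (ii ! b, jj ! a)))"
    using det_sort[of jj "\<lambda>j a. J $$ (ii ! a, j)"] by metis
  have "minor J (sort ii) (sort jj) = \<epsilon> * (\<epsilon>' * minor J ii jj)"
    unfolding minor_def using e(2) e'(2) assms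
      det_transpose_fun[of "length jj" "\<lambda>a b. J $$ (ii ! a, sort jj ! b)"]
      det_transpose_fun[of "length jj" "\<lambda>a b. J $$ (ii ! a, jj ! b)"]
    by simp
  moreover have "\<epsilon> * \<epsilon>' = 1 \<or> \<epsilon> * \<epsilon>' = -1" using e(1) e'(1) by auto
  ultimately show thesis using that[of "\<epsilon> * \<epsilon>'"] by (simp add: mult.assoc)
qed

section \<open>Vanishing minors, linear dependence and rank\<close>

lemma det_0_iff_fun:
  fixes F :: "nat \<Rightarrow> nat \<Rightarrow> 'a::idom"
  shows "det (mat r r (\<lambda>(a, b). F a b)) = 0 \<longleftrightarrow>
    (\<exists>v. (\<exists>b<r. v b \<noteq> 0) \<and> (\<forall>a<r. (\<Sum>b<r. F a b * v b) = 0))" (is "?L \<longleftrightarrow> ?R")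
proof -
  let ?A = "mat r r (\<lambda>(a, b). F a b)"
  have iff: "?A *\<^sub>v w = 0\<^sub>v r \<longleftrightarrow> (\<forall>a<r. (\<Sum>b<r. F a b * w $ b) = 0)" if w: "w \<in> carrier_vec r" for w
  proof -
    have "(?A *\<^sub>v w) $ a = (\<Sum>b<r. F a b * w $ b)" if "a < r" for a
      using that w by (simp add: scalar_prod_def atLeast0LessThan)
    then show ?thesis by (auto simp: vec_eq_iff)
  qed
  have "?L \<longleftrightarrow> (\<exists>w\<in>carrier_vec r. w \<noteq> 0\<^sub>v r \<and> (\<forall>a<r. (\<Sum>b<r. F a b * w $ b) = 0))"
    using det_0_iff_vec_prod_zero[of ?A r] iff by auto
  also have "\<dots> \<longleftrightarrow> ?R"
  proof
    assume "\<exists>w\<in>carrier_vec r. w \<noteq> 0\<^sub>v r \<and> (\<forall>a<r. (\<Sum>b<r. F a b * w $ b) = 0)"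
    then obtain w :: "'a vec" where w: "w \<in> carrier_vec r" "w \<noteq> 0\<^sub>v r" "\<forall>a<r. (\<Sum>b<r. F a b * w $ b) = 0" by blast
    then have "\<exists>b<r. w $ b \<noteq> 0" by (auto simp: vec_eq_iff)
    then show ?R using w(3) by blast
  next
    assume ?R
    then obtain v b where v: "b < r" "v b \<noteq> 0" "\<forall>a<r. (\<Sum>b<r. F a b * v b) = 0" by blast
    have "vec r v \<noteq> 0\<^sub>v r" using v(1,2) by (auto simp: vec_eq_iff)
    moreover have "\<forall>a<r. (\<Sum>b<r. F a b * vec r v $ b) = 0" using v(3) by simp
    ultimately show "\<exists>w\<in>carrier_vec r. w \<noteq> 0\<^sub>v r \<and> (\<forall>a<r. (\<Sum>b<r. F a b * w $ b) = 0)"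
      by (intro bexI[of _ "vec r v"]) auto
  qed
  finally show ?thesis .
qed

lemma minor_0_iff_cols:
  fixes J :: "'a::idom mat"
  assumes "length ii = length jj"
  shows "minor J ii jj = 0 \<longleftrightarrow>
    (\<exists>v. (\<exists>b<length jj. v b \<noteq> 0) \<and> (\<forall>a<length ii. (\<Sum>b<length jj. J $$ (ii ! a, jj ! b) * v b) = 0))"
  unfolding minor_def using assms det_0_iff_fun[of "length jj" "\<lambda>a b. J $$ (ii ! a, jj ! b)"] by simp

lemma minor_0_iff_rows:
  fixes J :: "'a::idom mat"
  assumes "length ii = length jj"
  shows "minor J ii jj = 0 \<longleftrightarrow>
    (\<exists>v. (\<exists>a<length ii. v a \<noteq> 0) \<and> (\<forall>b<length jj. (\<Sum>a<length ii. J $$ (ii ! a, jj ! b) * v a) = 0))"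
  unfolding minor_def using assms det_0_iff_fun[of "length jj" "\<lambda>a b. J $$ (ii ! b, jj ! a)"]
    det_transpose_fun[of "length jj" "\<lambda>a b. J $$ (ii ! a, jj ! b)"]
  by simp

text \<open>Weight the bordered minors with the coefficients \<open>a\<close> and expand each along
  its new row. The sum becomes a combination of the entries of \<open>e\<close>; those at
  \<open>jj\<close> lie in \<open>p\<close>, and the last one has coefficient plus or minus the
  given minor, hence survives. So not all bordered minors lie in \<open>p\<close>.\<close>

lemma (in prime_set) minor_extend:
  fixes J :: "'a mat"
  assumes len: "length ii = length jj" and nz: "minor J ii jj \<notin> p"
    and e: "\<And>k. k \<in> insert k0 (set jj) \<Longrightarrow> e k = (\<Sum>l<m. a l * J $$ (l, k))"
    and ejj: "\<And>k. k \<in> set jj \<Longrightarrow> e k \<in> p" and ek: "e k0 \<notin> p"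
  shows "\<exists>l<m. minor J (ii @ [l]) (jj @ [k0]) \<notin> p"
proof (rule ccontr)
  assume "\<not> ?thesis"
  then have all: "minor J (ii @ [l]) (jj @ [k0]) \<in> p" if "l < m" for l using that by blast
  let ?cc = "jj @ [k0]" and ?r = "length jj"
  let ?c = "\<lambda>\<nu>. (-1) ^ (?r + \<nu>) * minor J ii (omit \<nu> ?cc)"
  have "(\<Sum>l<m. a l * minor J (ii @ [l]) ?cc) = (\<Sum>l<m. \<Sum>\<nu><Suc ?r. ?c \<nu> * (a l * J $$ (l, ?cc ! \<nu>)))"
    using len by (simp add: minor_laplace sum_distrib_left algebra_simps)
  also have "\<dots> = (\<Sum>\<nu><Suc ?r. ?c \<nu> * e (?cc ! \<nu>))"
    by (subst sum.swap, rule sum.cong[OF refl]) (auto simp: e nth_append sum_distrib_left)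
  also have "\<dots> = (\<Sum>\<nu><?r. ?c \<nu> * e (jj ! \<nu>)) + (-1) ^ (?r + ?r) * minor J ii jj * e k0"
    by (simp add: nth_append)
  finally have eq: "(\<Sum>l<m. a l * minor J (ii @ [l]) ?cc) =
    (\<Sum>\<nu><?r. ?c \<nu> * e (jj ! \<nu>)) + (-1) ^ (?r + ?r) * minor J ii jj * e k0" .
  have "(\<Sum>l<m. a l * minor J (ii @ [l]) ?cc) \<in> p"
    using all by (intro sum_in) simp
  note 1 = this[unfolded eq]
  have 2: "(\<Sum>\<nu><?r. ?c \<nu> * e (jj ! \<nu>)) \<in> p"
    using ejj by (intro sum_in) simp
  have "(-1) ^ (?r + ?r) * minor J ii jj * e k0 \<in> p"
    using diff_in[OF 1 2] by (simp only: add_diff_cancel_left')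
  then show False using nz ek minus_one_power_notin by auto
qed

lemma prime_set_0: "prime_set ({0} :: 'a::idom set)"
  by unfold_locales auto

lemma minor_row_combination:
  fixes J :: "'a::idom mat"
  assumes len: "length ii = length jj" and nz: "minor J ii jj \<noteq> 0"
    and van: "\<And>l. l < m \<Longrightarrow> minor J (ii @ [l]) (jj @ [k]) = 0"
    and e: "\<And>k. k \<in> set jj \<Longrightarrow> (\<Sum>l<m. a l * J $$ (l, k)) = 0"
  shows "(\<Sum>l<m. a l * J $$ (l, k)) = 0"
proof (rule ccontr)
  assume "\<not> ?thesis"
  then show False
    using prime_set.minor_extend[OF prime_set_0 len, where J = J and ?k0.0 = k and m = m and a = a
        and e = "\<lambda>k. \<Sum>l<m. a l * J $$ (l, k)"] nz van e
    by auto
qed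

text \<open>The rank is defined by column spaces over the fraction field. The nonzero minor makes
  the columns \<open>jj\<close> independent, and the vanishing of the minors that border it makes
  each further column depend on them; so these columns form a maximal independent set.\<close>

lemma mat_rank_minor:
  fixes J :: "'a::idom mat"
  assumes J: "J \<in> carrier_mat m n" and len: "length ii = length jj"
    and ii: "set ii \<subseteq> {..<m}" and jj: "set jj \<subseteq> {..<n}" and nz: "minor J ii jj \<noteq> 0"
    and van: "\<And>l k. l < m \<Longrightarrow> k < n \<Longrightarrow> minor J (ii @ [l]) (jj @ [k]) = 0"
  shows "mat_rank J = length jj"
proof -
  let ?h = "\<lambda>a. Fraction_Field.Fract a 1 :: 'a fract" and ?s = "length jj"
  interpret h: inj_comm_ring_hom ?h
    by unfold_locales (auto simp: One_fract_def Zero_fract_def eq_fract)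
  interpret V: vec_space "TYPE('a fract)" m .
  define A where "A = map_mat ?h J"
  have A: "A \<in> carrier_mat m n" using J by (simp add: A_def)
  define B where "B xs = mat m (length xs) (\<lambda>(a, b). A $$ (a, xs ! b))" for xs
  have B: "B xs \<in> carrier_mat m (length xs)" for xs by (simp add: B_def)
  have colB: "col (B xs) b = col A (xs ! b)" if "b < length xs" "set xs \<subseteq> {..<n}" for xs b
  proof -
    have "xs ! b < n" using that by (metis lessThan_iff nth_mem subsetD)
    then show ?thesis using that A by (intro eq_vecI) (auto simp: B_def)
  qed
  have cols: "cols (B xs) = map (col A) xs" if "set xs \<subseteq> {..<n}" for xs
    using that by (intro nth_equalityI) (auto simp: colB B_def[THEN arg_cong, of dim_col])
  have colsA: "set (cols (B xs)) \<subseteq> set (cols A)" if "set xs \<subseteq> {..<n}" for xs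
    by (subst cols[OF that]) (use that A in \<open>auto simp: cols_def\<close>)
  have hA: "A $$ (a, b) = ?h (J $$ (a, b))" if "a < m" "b < n" for a b
    using that J by (simp add: A_def)
  have iil: "ii ! a < m" if "a < ?s" for a using that ii len by (metis lessThan_iff nth_mem subsetD)
  have jjl: "jj ! b < n" if "b < ?s" for b using that jj by (metis lessThan_iff nth_mem subsetD)
  have inj: "v = 0\<^sub>v ?s" if v: "v \<in> carrier_vec ?s" "B jj *\<^sub>v v = 0\<^sub>v m" for v
  proof (rule ccontr)
    assume "v \<noteq> 0\<^sub>v ?s"
    then have ex: "\<exists>b<?s. v $ b \<noteq> 0" using v(1) by (auto simp: vec_eq_iff)
    have "(\<Sum>b<?s. ?h (J $$ (ii ! a, jj ! b)) * v $ b) = 0" if a: "a < ?s" for a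
    proof -
      have "(B jj *\<^sub>v v) $ (ii ! a) = (\<Sum>b<?s. A $$ (ii ! a, jj ! b) * v $ b)"
        using v(1) iil[OF a] by (simp add: B_def scalar_prod_def atLeast0LessThan)
      then show ?thesis using v(2) iil[OF a] by (simp add: hA jjl)
    qed
    then have "det (mat ?s ?s (\<lambda>(a, b). ?h (J $$ (ii ! a, jj ! b)))) = 0"
      using ex det_0_iff_fun[of ?s "\<lambda>a b. ?h (J $$ (ii ! a, jj ! b))"] by blast
    moreover have "mat ?s ?s (\<lambda>(a, b). ?h (J $$ (ii ! a, jj ! b)))
        = map_mat ?h (mat ?s ?s (\<lambda>(a, b). J $$ (ii ! a, jj ! b)))"
      by (rule eq_matI) auto
    ultimately have "minor J ii jj = 0" using len by (simp add: minor_def)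
    then show False using nz by simp
  qed
  \<comment> \<open>Independence is a property of the set of columns, so repeated columns have to be
    excluded before the cardinality can be read off.\<close>
  have dist: "distinct (cols (B jj))"
  proof (rule ccontr)
    assume "\<not> distinct (cols (B jj))"
    then obtain a b where ab: "a < ?s" "b < ?s" "a \<noteq> b" "col A (jj ! a) = col A (jj ! b)"
      unfolding cols[OF jj] by (auto simp: distinct_conv_nth)
    define v where "v = vec ?s (\<lambda>c. (if c = a then 1 else 0) - (if c = b then 1 else 0) :: 'a fract)"
    have "A $$ (l, jj ! a) = A $$ (l, jj ! b)" if "l < m" for l
    proof -
      have "vec_index (col A (jj ! c)) l = A $$ (l, jj ! c)" if "c < ?s" for c
        using \<open>l < m\<close> that A jjl by simp
      from this[OF ab(1)] this[OF ab(2)] show ?thesis using ab(4) by (simp only:)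
    qed
    moreover have "(\<Sum>c<?s. A $$ (l, jj ! c) * ((if c = a then 1 else 0) - (if c = b then 1 else 0)))
        = A $$ (l, jj ! a) - A $$ (l, jj ! b)" for l
      using ab(1,2) by (simp add: right_diff_distrib sum_subtractf if_distrib[of "(*) _"] cong: if_cong)
    ultimately have "B jj *\<^sub>v v = 0\<^sub>v m"
      by (intro eq_vecI) (simp_all add: B_def v_def scalar_prod_def atLeast0LessThan)
    then have "v = 0\<^sub>v ?s" by (intro inj) (simp_all add: v_def)
    then have "v $ a = 0" using ab by simp
    then show False using ab by (simp add: v_def)
  qed
  have "V.lin_indpt (set (cols (B jj)))"
    using V.lin_depE[OF B _ dist] inj by metis
  moreover have "\<not> V.lin_indpt T"
    if T: "set (cols (B jj)) \<subset> T" "T \<subseteq> set (cols A)" for T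
  proof
    assume li: "V.lin_indpt T"
    obtain x where x: "x \<in> T" "x \<notin> set (cols (B jj))" using T(1) by blast
    then obtain k where k: "k < n" "x = col A k" using T(2) A by (auto simp: cols_def)
    let ?cc = "jj @ [k]"
    have cc: "set ?cc \<subseteq> {..<n}" using jj k by auto
    have dist': "distinct (cols (B ?cc))"
      using dist x(2) k(2) by (simp add: cols[OF cc] cols[OF jj])
    have "set (cols (B ?cc)) \<subseteq> T"
      using T(1) x(1) k(2) by (auto simp: cols[OF cc] cols[OF jj])
    then have li': "V.lin_indpt (set (cols (B ?cc)))" using li V.subset_li_is_li by blast
    \<comment> \<open>The cofactors along the added row: pairing them with row \<open>l\<close>
      gives the bordered minor, which is 0. The last cofactor is the given nonzero minor, up to
      sign.\<close>
    define v where "v = vec (Suc ?s) (\<lambda>\<nu>. ?h ((-1) ^ (?s + \<nu>) * minor J ii (omit \<nu> ?cc)))"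
    have "v $ ?s \<noteq> 0" using nz by (simp add: v_def)
    then have "v \<noteq> 0\<^sub>v (Suc ?s)" by auto
    moreover have "B ?cc *\<^sub>v v = 0\<^sub>v m"
    proof (rule eq_vecI)
      fix l assume "l < dim_vec (0\<^sub>v m)"
      then have l: "l < m" by simp
      have ccl: "?cc ! \<nu> < n" if "\<nu> < Suc ?s" for \<nu>
        using cc that nth_mem[of \<nu> ?cc] by (metis length_append_singleton lessThan_iff subsetD)
      have "(B ?cc *\<^sub>v v) $ l = (\<Sum>\<nu><Suc ?s. ?h (J $$ (l, ?cc ! \<nu>)) * v $ \<nu>)"
        using l by (simp add: B_def v_def scalar_prod_def atLeast0LessThan hA ccl del: sum.lessThan_Suc)
      also have "\<dots> = (\<Sum>\<nu><Suc ?s. ?h ((-1) ^ (?s + \<nu>) * minor J ii (omit \<nu> ?cc) * J $$ (l, ?cc ! \<nu>)))"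
        by (rule sum.cong) (auto simp: v_def mult.commute)
      also have "\<dots> = ?h (minor J (ii @ [l]) ?cc)"
        using len by (simp add: minor_laplace h.hom_sum del: sum.lessThan_Suc)
      also have "\<dots> = 0" using van l k by simp
      finally show "(B ?cc *\<^sub>v v) $ l = 0\<^sub>v m $ l" using l by simp
    qed (simp add: B_def)
    ultimately show False
      using V.lin_depI[of "B ?cc" "Suc ?s" v] B[of ?cc] dist' li' by (simp add: v_def)
  qed
  ultimately have "maximal (set (cols (B jj))) (\<lambda>T. T \<subseteq> set (cols A) \<and> V.lin_indpt T)"
    unfolding maximal_def using colsA[OF jj] by blast
  from V.rank_card_indpt[OF A this] have "V.rank A = card (set (cols (B jj)))" .
  also have "\<dots> = ?s" using dist distinct_card[of "cols (B jj)"] by (simp add: cols[OF jj])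
  finally show ?thesis using J by (simp add: mat_rank_def A_def)
qed

text \<open>Take a nonzero minor of greatest size. The size is bounded by \<open>n\<close>, since a
  minor with a repeated column vanishes.\<close>

lemma mat_rank_obtain:
  fixes J :: "'a::idom mat"
  assumes J: "J \<in> carrier_mat m n"
  obtains ii jj where "length ii = mat_rank J" "length jj = mat_rank J"
    "set ii \<subseteq> {..<m}" "set jj \<subseteq> {..<n}" "minor J ii jj \<noteq> 0"
    "\<And>ii jj. length ii = Suc (mat_rank J) \<Longrightarrow> length jj = Suc (mat_rank J) \<Longrightarrow>
      set ii \<subseteq> {..<m} \<Longrightarrow> set jj \<subseteq> {..<n} \<Longrightarrow> minor J ii jj = 0"
proof -
  define Q where "Q s \<longleftrightarrow> (\<exists>ii jj. length ii = s \<and> length jj = s \<and> set ii \<subseteq> {..<m} \<and> set jj \<subseteq> {..<n}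
    \<and> minor J ii jj \<noteq> 0)" for s
  have "Q 0" unfolding Q_def by (auto intro!: exI[of _ "[]"])
  moreover have "s \<le> n" if Qs: "Q s" for s
  proof -
    obtain ii jj where "length ii = s" "length jj = s" "set jj \<subseteq> {..<n}" "minor J ii jj \<noteq> 0"
      using Qs unfolding Q_def by blast
    then show ?thesis
      using minor_not_distinct_cols[of ii jj J] distinct_card[of jj] card_mono[of "{..<n}" "set jj"]
      by (metis card_lessThan finite_lessThan)
  qed
  ultimately obtain s where s: "Q s" "\<And>t. Q t \<Longrightarrow> t \<le> s"
    using Nat.ex_has_greatest_nat[of Q 0 n] by blast
  then have ns: "\<not> Q (Suc s)" by fastforce
  obtain ii jj where ij: "length ii = s" "length jj = s" "set ii \<subseteq> {..<m}" "set jj \<subseteq> {..<n}" "minor J ii jj \<noteq> 0"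
    using s(1) unfolding Q_def by blast
  have van: "minor J ii' jj' = 0" if "length ii' = Suc s" "length jj' = Suc s" "set ii' \<subseteq> {..<m}" "set jj' \<subseteq> {..<n}"
    for ii' jj' using ns that unfolding Q_def by blast
  have "mat_rank J = length jj"
    by (rule mat_rank_minor[OF J _ ij(3-5)]) (use ij in \<open>auto intro!: van\<close>)
  then show thesis using that[of ii jj] ij van by simp
qed

lemma minor_Suc_mat_rank:
  fixes J :: "'a::idom mat"
  assumes "J \<in> carrier_mat m n" "length ii = Suc (mat_rank J)" "length jj = Suc (mat_rank J)"
    "set ii \<subseteq> {..<m}" "set jj \<subseteq> {..<n}"
  shows "minor J ii jj = 0"
  using mat_rank_obtain[OF assms(1)] assms(2-) by metis

text \<open>If the minor were 0, a nontrivial combination of the rows \<open>ii\<close> would vanish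
  on the columns \<open>jj\<close>. These columns span all others, because a nonzero minor on them
  has no nonzero bordering minor; so the combination would vanish on every column, also on the
  columns where the rows \<open>ii\<close> have a nonzero minor.\<close>

lemma minor_nonsing:
  fixes J :: "'a::idom mat"
  assumes J: "J \<in> carrier_mat m n" and ii: "ii \<in> nonsing_rows J" and jj: "jj \<in> nonsing_cols J"
  shows "minor J ii jj \<noteq> 0"
proof
  let ?r = "mat_rank J"
  have dims: "dim_row J = m" "dim_col J = n" using J by auto
  obtain jj0 where jj0: "jj0 \<in> incr_tuples ?r n" "minor J ii jj0 \<noteq> 0"
    using ii unfolding nonsing_rows_def dims by blast
  obtain ii0 where ii0: "ii0 \<in> incr_tuples ?r m" "minor J ii0 jj \<noteq> 0"
    using jj unfolding nonsing_cols_def dims by blast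
  have len: "length ii = ?r" "length jj = ?r" "length jj0 = ?r" "length ii0 = ?r"
    and sub: "set ii \<subseteq> {..<m}" "set jj \<subseteq> {..<n}" "set jj0 \<subseteq> {..<n}" "set ii0 \<subseteq> {..<m}"
    using ii jj jj0 ii0 unfolding nonsing_rows_def nonsing_cols_def incr_tuples_def dims by auto
  assume "minor J ii jj = 0"
  then obtain v where v: "\<exists>a<?r. v a \<noteq> 0" "\<And>b. b < ?r \<Longrightarrow> (\<Sum>a<?r. J $$ (ii ! a, jj ! b) * v a) = 0"
    using minor_0_iff_rows[of ii jj J] len by auto
  have iil: "ii ! a < m" if "a < ?r" for a using that len(1) sub(1) by (metis lessThan_iff nth_mem subsetD)
  \<comment> \<open>Moves the coefficients from positions in \<open>ii\<close> to row indices, as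
    demanded by \<open>minor_row_combination\<close>.\<close>
  define c where "c l = (\<Sum>a | a < ?r \<and> ii ! a = l. v a)" for l
  have c: "(\<Sum>l<m. c l * J $$ (l, k)) = (\<Sum>a<?r. J $$ (ii ! a, k) * v a)" for k
  proof -
    have "(\<Sum>l<m. c l * J $$ (l, k)) = (\<Sum>l<m. \<Sum>a | a \<in> {..<?r} \<and> ii ! a = l. J $$ (ii ! a, k) * v a)"
      unfolding c_def sum_distrib_right by (intro sum.cong) (auto simp: mult.commute)
    also have "\<dots> = (\<Sum>a<?r. J $$ (ii ! a, k) * v a)"
      using iil by (intro sum.group) auto
    finally show ?thesis .
  qed
  have "(\<Sum>l<m. c l * J $$ (l, k)) = 0" if "k < n" for k
  proof (rule minor_row_combination[of ii0 jj J])
    fix l assume "l < m"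
    then show "minor J (ii0 @ [l]) (jj @ [k]) = 0"
      using that len sub by (intro minor_Suc_mat_rank[OF J]) auto
  next
    fix k assume "k \<in> set jj"
    then show "(\<Sum>l<m. c l * J $$ (l, k)) = 0"
      unfolding c using v(2) len(2) by (auto simp: in_set_conv_nth)
  qed (use len ii0 in auto)
  then have "(\<Sum>a<?r. J $$ (ii ! a, jj0 ! b) * v a) = 0" if "b < ?r" for b
    using that len(3) sub(3) unfolding c by (metis lessThan_iff nth_mem subsetD)
  then have "minor J ii jj0 = 0"
    using minor_0_iff_rows[of ii jj0 J] len v(1) by auto
  then show False using jj0(2) by simp
qed

section \<open>Localization and regularity\<close>

lemma cring_ideal_from_closure:
  fixes R (structure)
  assumes "cring R" "A \<subseteq> carrier R" "A \<noteq> {}"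
    and add: "\<And>a b. a \<in> A \<Longrightarrow> b \<in> A \<Longrightarrow> a \<oplus> b \<in> A"
    and mult: "\<And>a x. a \<in> A \<Longrightarrow> x \<in> carrier R \<Longrightarrow> x \<otimes> a \<in> A"
  shows "ideal A R"
proof -
  interpret cring R by fact
  have inv: "\<ominus> a \<in> A" if "a \<in> A" for a
  proof -
    have "\<ominus> a = (\<ominus> \<one>) \<otimes> a" using that assms(2) by (simp add: subsetD l_minus)
    then show ?thesis using mult[OF that, of "\<ominus> \<one>"] by simp
  qed
  show ?thesis
  proof (rule idealI)
    show "subgroup A (add_monoid R)"
      by (rule add.subgroupI) (use assms inv in \<open>auto simp: a_inv_def[symmetric]\<close>)
  next
    fix a x assume a: "a \<in> A" and x: "x \<in> carrier R"
    show "x \<otimes> a \<in> A" by (rule mult[OF a x])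
    then show "a \<otimes> x \<in> A" using m_comm[of a x] a x assms(2) by (simp add: subsetD)
  qed (rule ring_axioms)
qed

text \<open>The operations of \<open>localization\<close> are unions over all representatives; one
  representative on each side keeps the union from being empty.\<close>

lemma UN_pair_constant:
  assumes "(a, s) \<in> U" "(b, t) \<in> V"
    and "\<And>a' s' b' t'. (a', s') \<in> U \<Longrightarrow> (b', t') \<in> V \<Longrightarrow> f a' s' b' t' = W"
  shows "(\<Union>(a', s')\<in>U. \<Union>(b', t')\<in>V. f a' s' b' t') = W"
proof -
  have "(\<Union>(a', s')\<in>U. \<Union>(b', t')\<in>V. f a' s' b' t') = (\<Union>x\<in>U. \<Union>y\<in>V. W)"
    using assms(3) by (intro SUP_cong refl) (auto intro!: SUP_cong)
  also have "\<dots> = W" using assms(1,2) by auto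
  finally show ?thesis .
qed

context domain
begin

text \<open>In a domain the auxiliary factor \<open>u\<close> is nonzero and cancels, which leaves
  cross-multiplication.\<close>

lemma loc_rel_iff:
  assumes "submonoid S R" "\<zero> \<notin> S"
  shows "((a, s), (b, t)) \<in> loc_rel R S \<longleftrightarrow>
    a \<in> carrier R \<and> b \<in> carrier R \<and> s \<in> S \<and> t \<in> S \<and> a \<otimes> t = b \<otimes> s"
proof -
  interpret S: submonoid S R by fact
  note c = subsetD[OF S.subset]
  have "(\<exists>u\<in>S. u \<otimes> (a \<otimes> t \<ominus> b \<otimes> s) = \<zero>) \<longleftrightarrow> a \<otimes> t = b \<otimes> s"
    if "a \<in> carrier R" "b \<in> carrier R" "s \<in> S" "t \<in> S"
  proof
    assume "\<exists>u\<in>S. u \<otimes> (a \<otimes> t \<ominus> b \<otimes> s) = \<zero>"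
    then obtain u where u: "u \<in> S" "u \<otimes> (a \<otimes> t \<ominus> b \<otimes> s) = \<zero>" by blast
    have "u \<noteq> \<zero>" using u assms(2) by auto
    then have "a \<otimes> t \<ominus> b \<otimes> s = \<zero>" using u(2) integral[of u] c[OF u(1)] that c by auto
    then show "a \<otimes> t = b \<otimes> s" using that c by simp
  next
    assume "a \<otimes> t = b \<otimes> s"
    then have "\<one> \<otimes> (a \<otimes> t \<ominus> b \<otimes> s) = \<zero>" using that c by (simp add: r_right_minus_eq)
    then show "\<exists>u\<in>S. u \<otimes> (a \<otimes> t \<ominus> b \<otimes> s) = \<zero>" using S.one_closed by blast
  qed
  then show ?thesis unfolding loc_rel_def by auto
qed

lemma equiv_loc_rel:
  assumes S: "submonoid S R" "\<zero> \<notin> S"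
  shows "equiv (carrier R \<times> S) (loc_rel R S)"
proof -
  interpret S: submonoid S R by fact
  note c = subsetD[OF S.subset]
  note iff = loc_rel_iff[OF S]
  show ?thesis
  proof (rule equivI)
    show "loc_rel R S \<subseteq> (carrier R \<times> S) \<times> carrier R \<times> S" by (auto simp: loc_rel_def)
    show "refl_on (carrier R \<times> S) (loc_rel R S)" by (auto simp: refl_on_def iff)
    show "sym (loc_rel R S)" by (auto simp: sym_def iff)
    show "trans (loc_rel R S)"
    proof (rule transI, clarify)
      fix a s b t d u assume "((a, s), (b, t)) \<in> loc_rel R S" "((b, t), (d, u)) \<in> loc_rel R S"
      then have h: "a \<in> carrier R" "b \<in> carrier R" "d \<in> carrier R" "s \<in> S" "t \<in> S" "u \<in> S"
        "a \<otimes> t = b \<otimes> s" "b \<otimes> u = d \<otimes> t" by (auto simp: iff)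
      note hc = h(1-3) c[OF h(4)] c[OF h(5)] c[OF h(6)]
      have "t \<otimes> (a \<otimes> u) = (a \<otimes> t) \<otimes> u" using hc by (simp add: m_ac)
      also have "\<dots> = (b \<otimes> u) \<otimes> s" unfolding h(7) using hc by (simp add: m_ac)
      also have "\<dots> = t \<otimes> (d \<otimes> s)" unfolding h(8) using hc by (simp add: m_ac)
      finally have "t \<otimes> (a \<otimes> u) = t \<otimes> (d \<otimes> s)" .
      moreover have "t \<noteq> \<zero>" using h(5) S(2) by auto
      ultimately have "a \<otimes> u = d \<otimes> s" using m_lcancel[of t "a \<otimes> u" "d \<otimes> s"] hc by simp
      then show "((a, s), (d, u)) \<in> loc_rel R S" using h by (simp add: iff)
    qed
  qed
qed

lemma loc_frac_eq:
  assumes S: "submonoid S R" "\<zero> \<notin> S" and "a \<in> carrier R" "b \<in> carrier R" "s \<in> S" "t \<in> S"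
  shows "loc_frac R S a s = loc_frac R S b t \<longleftrightarrow> a \<otimes> t = b \<otimes> s"
  unfolding loc_frac_def using eq_equiv_class_iff[OF equiv_loc_rel[OF S], of "(a, s)" "(b, t)"] assms
  by (simp add: loc_rel_iff)

lemma loc_frac_self:
  assumes S: "submonoid S R" "\<zero> \<notin> S" and "a \<in> carrier R" "s \<in> S"
  shows "(a, s) \<in> loc_frac R S a s"
  unfolding loc_frac_def using assms by (simp add: loc_rel_iff)

lemma loc_frac_mem:
  assumes S: "submonoid S R" "\<zero> \<notin> S" and "(b, t) \<in> loc_frac R S a s"
  shows "b \<in> carrier R \<and> t \<in> S \<and> a \<otimes> t = b \<otimes> s"
  using assms unfolding loc_frac_def by (simp add: loc_rel_iff)

lemma carrier_localization:
  "carrier (localization R S) = {loc_frac R S a s |a s. a \<in> carrier R \<and> s \<in> S}"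
  by (auto simp: localization_def loc_frac_def quotient_def)

lemma localization_mult:
  assumes S: "submonoid S R" "\<zero> \<notin> S" and abst: "a \<in> carrier R" "b \<in> carrier R" "s \<in> S" "t \<in> S"
  shows "loc_frac R S a s \<otimes>\<^bsub>localization R S\<^esub> loc_frac R S b t = loc_frac R S (a \<otimes> b) (s \<otimes> t)"
proof -
  interpret S: submonoid S R by fact
  note c = subsetD[OF S.subset]
  have "loc_frac R S (a' \<otimes> b') (s' \<otimes> t') = loc_frac R S (a \<otimes> b) (s \<otimes> t)"
    if as: "(a', s') \<in> loc_frac R S a s" and bt: "(b', t') \<in> loc_frac R S b t" for a' s' b' t'
  proof -
    note h = loc_frac_mem[OF S as] loc_frac_mem[OF S bt]
    have hc: "a' \<in> carrier R" "b' \<in> carrier R" "s' \<in> carrier R" "t' \<in> carrier R"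
      "s \<in> carrier R" "t \<in> carrier R" using h c abst by auto
    have "(a' \<otimes> b') \<otimes> (s \<otimes> t) = (a' \<otimes> s) \<otimes> (b' \<otimes> t)" using hc abst by (simp add: m_ac)
    also have "\<dots> = (a \<otimes> s') \<otimes> (b \<otimes> t')" using h by simp
    also have "\<dots> = (a \<otimes> b) \<otimes> (s' \<otimes> t')" using hc abst by (simp add: m_ac)
    finally show ?thesis using loc_frac_eq[OF S] hc abst h by simp
  qed
  then have "(\<Union>(a', s')\<in>loc_frac R S a s. \<Union>(b', t')\<in>loc_frac R S b t. loc_frac R S (a' \<otimes> b') (s' \<otimes> t')) = loc_frac R S (a \<otimes> b) (s \<otimes> t)"
    by (rule UN_pair_constant[OF loc_frac_self[OF S abst(1,3)] loc_frac_self[OF S abst(2,4)]])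
  then show ?thesis by (simp add: localization_def)
qed

lemma localization_add:
  assumes S: "submonoid S R" "\<zero> \<notin> S" and abst: "a \<in> carrier R" "b \<in> carrier R" "s \<in> S" "t \<in> S"
  shows "loc_frac R S a s \<oplus>\<^bsub>localization R S\<^esub> loc_frac R S b t =
    loc_frac R S (a \<otimes> t \<oplus> b \<otimes> s) (s \<otimes> t)"
proof -
  interpret S: submonoid S R by fact
  note c = subsetD[OF S.subset]
  have "loc_frac R S (a' \<otimes> t' \<oplus> b' \<otimes> s') (s' \<otimes> t') = loc_frac R S (a \<otimes> t \<oplus> b \<otimes> s) (s \<otimes> t)"
    if as: "(a', s') \<in> loc_frac R S a s" and bt: "(b', t') \<in> loc_frac R S b t" for a' s' b' t'
  proof -
    note h = loc_frac_mem[OF S as] loc_frac_mem[OF S bt]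
    have hc: "a' \<in> carrier R" "b' \<in> carrier R" "s' \<in> carrier R" "t' \<in> carrier R"
      "s \<in> carrier R" "t \<in> carrier R" using h c abst by auto
    have "(a' \<otimes> t' \<oplus> b' \<otimes> s') \<otimes> (s \<otimes> t) = (a' \<otimes> s) \<otimes> (t' \<otimes> t) \<oplus> (b' \<otimes> t) \<otimes> (s' \<otimes> s)"
      using hc abst by (simp add: m_ac l_distr r_distr)
    also have "\<dots> = (a \<otimes> s') \<otimes> (t' \<otimes> t) \<oplus> (b \<otimes> t') \<otimes> (s' \<otimes> s)" using h by simp
    also have "\<dots> = (a \<otimes> t \<oplus> b \<otimes> s) \<otimes> (s' \<otimes> t')" using hc abst by (simp add: m_ac l_distr r_distr)
    finally show ?thesis using loc_frac_eq[OF S] hc abst h by simp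
  qed
  then have "(\<Union>(a', s')\<in>loc_frac R S a s. \<Union>(b', t')\<in>loc_frac R S b t. loc_frac R S (a' \<otimes> t' \<oplus> b' \<otimes> s') (s' \<otimes> t')) = loc_frac R S (a \<otimes> t \<oplus> b \<otimes> s) (s \<otimes> t)"
    by (rule UN_pair_constant[OF loc_frac_self[OF S abst(1,3)] loc_frac_self[OF S abst(2,4)]])
  then show ?thesis by (simp add: localization_def)
qed

end

section \<open>Regularity and primes of a ring given as a type\<close>

lemma ring_of_type_simps [simp]:
  "carrier (ring_of_type_algebra :: 'a::comm_ring_1 ring) = UNIV"
  "x \<otimes>\<^bsub>ring_of_type_algebra\<^esub> y = x * (y :: 'a)"
  "x \<oplus>\<^bsub>ring_of_type_algebra\<^esub> y = x + (y :: 'a)"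
  "\<one>\<^bsub>ring_of_type_algebra\<^esub> = (1 :: 'a)"
  "\<zero>\<^bsub>ring_of_type_algebra\<^esub> = (0 :: 'a)"
  by (simp_all add: ring_of_type_algebra_def)

lemma domain_of_type: "domain (ring_of_type_algebra :: 'a::idom ring)"
  by (rule domain.intro[OF cring_from_type_algebra]) (unfold_locales, auto)

lemma (in prime_set) primeideal_of_type: "primeideal p (ring_of_type_algebra :: 'a ring)"
proof (rule primeidealI)
  show cr: "cring (ring_of_type_algebra :: 'a ring)" by (rule cring_from_type_algebra)
  show "ideal p (ring_of_type_algebra :: 'a ring)"
  proof (rule cring_ideal_from_closure[OF cr])
    show "p \<noteq> {}" using zero_in by blast
  qed (simp_all add: add_in)
  show "carrier ring_of_type_algebra \<noteq> p" using one_notin by (metis UNIV_I ring_of_type_simps(1))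
qed simp

text \<open>Regularity of \<open>A\<^sub>p\<close>, read off in \<open>A\<close>: denominators are cleared from the \<open>d\<close> generators of the
  maximal ideal, and the chain of \<open>d\<close> primes below it is contracted.\<close>

lemma regular_ring_prime:
  fixes p :: "'a::idom set"
  assumes p: "prime_set p" and reg: "regular_ring (ring_of_type_algebra :: 'a ring)"
  shows "\<exists>d (h :: nat \<Rightarrow> 'a) (C :: nat \<Rightarrow> 'a set).
    (\<forall>i<d. h i \<in> p) \<and> (\<forall>x\<in>p. \<exists>u c. u \<notin> p \<and> u * x = (\<Sum>i<d. c i * h i)) \<and>
    (\<forall>i\<le>d. prime_set (C i) \<and> C i \<subseteq> p) \<and> (\<forall>i<d. C i \<subset> C (Suc i))"
proof -
  interpret prime_set p by fact
  let ?R = "ring_of_type_algebra :: 'a ring"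
  interpret R: domain ?R by (rule domain_of_type)
  define S where "S = carrier ?R - p"
  define L where "L = localization ?R S"
  define fr where "fr a s = loc_frac ?R S a s" for a s
  have S_iff: "s \<in> S \<longleftrightarrow> s \<notin> p" for s by (simp add: S_def)
  have S: "submonoid S ?R" "\<zero>\<^bsub>?R\<^esub> \<notin> S" by unfold_locales (auto simp: S_def)
  have fr_eq: "fr a s = fr b t \<longleftrightarrow> a * t = b * s" if "s \<notin> p" "t \<notin> p" for a b s t
    unfolding fr_def using R.loc_frac_eq[OF S, of a b s t] that by (simp add: S_iff)
  have fr_mult: "fr a s \<otimes>\<^bsub>L\<^esub> fr b t = fr (a * b) (s * t)" if "s \<notin> p" "t \<notin> p" for a b s t
    unfolding fr_def L_def using R.localization_mult[OF S, of a b s t] that by (simp add: S_iff)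
  have fr_add: "fr a s \<oplus>\<^bsub>L\<^esub> fr b t = fr (a * t + b * s) (s * t)" if "s \<notin> p" "t \<notin> p" for a b s t
    unfolding fr_def L_def using R.localization_add[OF S, of a b s t] that by (simp add: S_iff)
  have carr: "carrier L = {fr a s |a s. s \<notin> p}"
    unfolding fr_def L_def R.carrier_localization by (simp add: S_iff)
  have frc: "fr a s \<in> carrier L" if "s \<notin> p" for a s using that carr by blast
  have one: "\<one>\<^bsub>L\<^esub> = fr 1 1" and zero: "\<zero>\<^bsub>L\<^esub> = fr 0 1" by (simp_all add: L_def localization_def fr_def)
  have "regular_local_ring L"
    using reg primeideal_of_type unfolding regular_ring_def L_def S_def by blast
  then obtain M where cL: "cring L" and nL: "noetherian_ring L" and Muniq: "{M'. maximalideal M' L} = {M}"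
    and dim: "krull_dim L = enat (LEAST d. \<exists>B\<subseteq>carrier L. finite B \<and> card B = d \<and> M = genideal L B)"
    unfolding regular_local_ring_def by blast
  interpret L: cring L by (rule cL)
  have ideal_unit: "J = carrier L" if J: "ideal J L" "fr a s \<in> J" "a \<notin> p" "s \<notin> p" for J a s
  proof -
    interpret J: ideal J L by fact
    have "fr s a \<otimes>\<^bsub>L\<^esub> fr a s \<in> J" using J by (intro J.I_l_closed frc)
    also have "fr s a \<otimes>\<^bsub>L\<^esub> fr a s = \<one>\<^bsub>L\<^esub>" using J by (simp add: fr_mult one fr_eq)
    finally show ?thesis by (rule J.one_imp_carrier)
  qed
  \<comment> \<open>The ideal \<open>M\<close> is known only as the unique maximal ideal; it is
    identified here with the fractions whose numerator lies in \<open>p\<close>.\<close>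
  define M0 where "M0 = {fr a s |a s. a \<in> p \<and> s \<notin> p}"
  have M0_iff: "fr a s \<in> M0 \<longleftrightarrow> a \<in> p" if s: "s \<notin> p" for a s
  proof
    assume "fr a s \<in> M0"
    then obtain b t where bt: "b \<in> p" "t \<notin> p" "fr a s = fr b t" unfolding M0_def by blast
    then have "a * t = b * s" using s fr_eq by simp
    then have "a * t \<in> p" using bt(1) by simp
    then show "a \<in> p" using bt(2) by simp
  qed (use s M0_def in blast)
  have "maximalideal M0 L"
  proof (rule maximalidealI)
    show idM0: "ideal M0 L"
    proof (rule cring_ideal_from_closure[OF cL])
      show "M0 \<subseteq> carrier L" using frc unfolding M0_def by blast
      show "M0 \<noteq> {}" using M0_iff[of 1 0] by auto
    next
      fix x y assume "x \<in> M0" "y \<in> M0"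
      then obtain a s b t where "x = fr a s" "y = fr b t" "a \<in> p" "b \<in> p" "s \<notin> p" "t \<notin> p"
        unfolding M0_def by blast
      then show "x \<oplus>\<^bsub>L\<^esub> y \<in> M0" by (simp add: fr_add M0_iff add_in)
    next
      fix x y assume "x \<in> M0" "y \<in> carrier L"
      then obtain a s b t where "x = fr a s" "y = fr b t" "a \<in> p" "s \<notin> p" "t \<notin> p"
        unfolding M0_def carr by blast
      then show "y \<otimes>\<^bsub>L\<^esub> x \<in> M0" by (simp add: fr_mult M0_iff)
    qed
    show "carrier L \<noteq> M0" using M0_iff[of 1 1] frc[of 1 1] by auto
    fix J assume J: "ideal J L" "M0 \<subseteq> J" "J \<subseteq> carrier L"
    show "J = M0 \<or> J = carrier L"
    proof (rule disjCI)
      assume "J \<noteq> carrier L"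
      have "x \<in> M0" if xJ: "x \<in> J" for x
      proof -
        obtain a s where x: "x = fr a s" "s \<notin> p" using xJ J(3) carr by blast
        then have "a \<in> p" using ideal_unit[OF J(1)] xJ \<open>J \<noteq> carrier L\<close> by blast
        then show ?thesis using x M0_iff by simp
      qed
      then show "J = M0" using J(2) by blast
    qed
  qed
  then have M: "M = M0" using Muniq by blast
  define d where "d = (LEAST d. \<exists>B\<subseteq>carrier L. finite B \<and> card B = d \<and> M = genideal L B)"
  have "ideal M L" using Muniq maximalideal.axioms(1) by blast
  then have "\<exists>d. \<exists>B\<subseteq>carrier L. finite B \<and> card B = d \<and> M = genideal L B"
    using noetherian_ring.finetely_gen[OF nL] by blast
  then have "\<exists>B\<subseteq>carrier L. finite B \<and> card B = d \<and> M = genideal L B"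
    unfolding d_def by (rule LeastI_ex)
  then obtain B where B: "B \<subseteq> carrier L" "finite B" "card B = d" "M = genideal L B" by blast
  obtain e where e: "bij_betw e {..<d} B" using ex_bij_betw_nat_finite[OF B(2)] B(3) by (auto simp: atLeast0LessThan)
  have "\<exists>a s. e i = fr a s \<and> a \<in> p \<and> s \<notin> p" if "i < d" for i
  proof -
    have "e i \<in> B" using e that by (auto dest: bij_betwE)
    then have "e i \<in> M0" using L.genideal_self[OF B(1)] B(4) M by blast
    then show ?thesis unfolding M0_def by blast
  qed
  then obtain h hs where h: "e i = fr (h i) (hs i)" "h i \<in> p" "hs i \<notin> p" if "i < d" for i by metis
  \<comment> \<open>Fractions whose numerator is a combination of the numerators \<open>h\<close>,
    up to a factor outside \<open>p\<close>. This is an ideal containing the generators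
    \<open>B\<close>, hence all of \<open>M\<close>.\<close>
  define N where "N = {fr a s |a s. s \<notin> p \<and> (\<exists>u c. u \<notin> p \<and> u * a = (\<Sum>i<d. c i * h i))}"
  have "ideal N L"
  proof (rule cring_ideal_from_closure[OF cL])
    show "N \<subseteq> carrier L" using frc unfolding N_def by blast
    have "fr 0 1 \<in> N" unfolding N_def
      by (rule CollectI, rule exI[of _ 0], rule exI[of _ 1]) (auto intro!: exI[of _ 1] exI[of _ "\<lambda>_. 0"])
    then show "N \<noteq> {}" by blast
  next
    fix x y assume "x \<in> N" "y \<in> N"
    then obtain a s u c b t v c' where
      x: "x = fr a s" "s \<notin> p" "u \<notin> p" "u * a = (\<Sum>i<d. c i * h i)" and
      y: "y = fr b t" "t \<notin> p" "v \<notin> p" "v * b = (\<Sum>i<d. c' i * h i)"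
      unfolding N_def by blast
    have "u * v * (a * t + b * s) = v * t * (u * a) + u * s * (v * b)" by (simp add: algebra_simps)
    also have "\<dots> = (\<Sum>i<d. (v * t * c i + u * s * c' i) * h i)"
      unfolding x y by (simp add: sum_distrib_left sum.distrib algebra_simps)
    finally have "\<exists>u c. u \<notin> p \<and> u * (a * t + b * s) = (\<Sum>i<d. c i * h i)"
      using x(3) y(3) by (intro exI[of _ "u * v"] exI conjI) auto
    moreover have "x \<oplus>\<^bsub>L\<^esub> y = fr (a * t + b * s) (s * t)" "s * t \<notin> p"
      using x y by (simp_all add: fr_add)
    ultimately show "x \<oplus>\<^bsub>L\<^esub> y \<in> N" unfolding N_def by blast
  next
    fix x y assume "x \<in> N" "y \<in> carrier L"
    then obtain a s u c b t where
      x: "x = fr a s" "s \<notin> p" "u \<notin> p" "u * a = (\<Sum>i<d. c i * h i)" and y: "y = fr b t" "t \<notin> p"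
      unfolding N_def carr by blast
    have "u * (b * a) = b * (u * a)" by (simp add: algebra_simps)
    also have "\<dots> = (\<Sum>i<d. (b * c i) * h i)" unfolding x by (simp add: sum_distrib_left algebra_simps)
    finally have "\<exists>u c. u \<notin> p \<and> u * (b * a) = (\<Sum>i<d. c i * h i)"
      using x(3) by (intro exI[of _ u] exI conjI) auto
    moreover have "y \<otimes>\<^bsub>L\<^esub> x = fr (b * a) (t * s)" "t * s \<notin> p"
      using x y by (simp_all add: fr_mult)
    ultimately show "y \<otimes>\<^bsub>L\<^esub> x \<in> N" unfolding N_def by blast
  qed
  moreover have "B \<subseteq> N"
  proof
    fix b assume "b \<in> B"
    then obtain i where i: "i < d" "b = e i" using e by (auto simp: bij_betw_def)
    have "(if j = i then 1 else 0) * h j = (if j = i then h j else 0)" for j by simp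
    then have "1 * h i = (\<Sum>j<d. (if j = i then 1 else 0) * h j)" using i(1) by simp
    then have "\<exists>u c. u \<notin> p \<and> u * h i = (\<Sum>j<d. c j * h j)"
      using one_notin by (intro exI[of _ "1::'a"] exI[of _ "\<lambda>j. if j = i then 1 else 0"] conjI)
    then show "b \<in> N" unfolding N_def i(2) h(1)[OF i(1)] using h(3)[OF i(1)] by blast
  qed
  ultimately have MN: "M \<subseteq> N" unfolding B(4) by (rule L.genideal_minimal)
  have gen: "\<exists>u c. u \<notin> p \<and> u * x = (\<Sum>i<d. c i * h i)" if "x \<in> p" for x
  proof -
    have "fr x 1 \<in> N" using that M0_iff[of 1 x] M MN by auto
    then obtain a s u c where a: "fr x 1 = fr a s" "s \<notin> p" "u \<notin> p" "u * a = (\<Sum>i<d. c i * h i)"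
      unfolding N_def by blast
    have "x * s = a" using a fr_eq[of 1 s x a] by simp
    moreover have "(u * s) * x = u * (x * s)" by (simp add: mult_ac)
    ultimately have "(u * s) * x = (\<Sum>i<d. c i * h i)" using a(4) by simp
    moreover have "u * s \<notin> p" using a by simp
    ultimately show ?thesis by blast
  qed
  define ctr where "ctr Q = {a. fr a 1 \<in> Q}" for Q
  have ctr: "prime_set (ctr Q)" "ctr Q \<subseteq> p" if "primeideal Q L" for Q
  proof -
    interpret Q: primeideal Q L by fact
    show "prime_set (ctr Q)"
    proof
      show "0 \<in> ctr Q" using Q.zero_closed by (simp add: ctr_def zero)
      show "1 \<notin> ctr Q" using Q.one_imp_carrier Q.I_notcarr by (auto simp: ctr_def one)
    next
      fix a b assume "a \<in> ctr Q" "b \<in> ctr Q"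
      then have "fr a 1 \<oplus>\<^bsub>L\<^esub> fr b 1 \<in> Q" by (simp add: ctr_def Q.a_closed)
      then show "a + b \<in> ctr Q" by (simp add: ctr_def fr_add)
    next
      fix a b assume "b \<in> ctr Q"
      then have "fr a 1 \<otimes>\<^bsub>L\<^esub> fr b 1 \<in> Q" by (simp add: ctr_def Q.I_l_closed frc)
      then show "a * b \<in> ctr Q" by (simp add: ctr_def fr_mult)
    next
      fix a b assume "a * b \<in> ctr Q"
      then have "fr a 1 \<otimes>\<^bsub>L\<^esub> fr b 1 \<in> Q" by (simp add: ctr_def fr_mult)
      then show "a \<in> ctr Q \<or> b \<in> ctr Q" using Q.I_prime frc by (auto simp: ctr_def)
    qed
    show "ctr Q \<subseteq> p"
    proof
      fix a assume "a \<in> ctr Q"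
      then show "a \<in> p" using ideal_unit[OF Q.is_ideal, of a 1] Q.I_notcarr by (auto simp: ctr_def)
    qed
  qed
  have ctr_strict: "ctr Q \<subset> ctr Q'" if Q: "primeideal Q L" "primeideal Q' L" "Q \<subset> Q'" for Q Q'
  proof -
    interpret Q: primeideal Q L by fact
    interpret Q': primeideal Q' L by fact
    obtain x where x: "x \<in> Q'" "x \<notin> Q" using Q(3) by blast
    obtain a s where as: "x = fr a s" "s \<notin> p" using Q'.Icarr[OF x(1)] carr by blast
    have "fr s 1 \<otimes>\<^bsub>L\<^esub> x \<in> Q'" by (rule Q'.I_l_closed[OF x(1) frc]) simp
    moreover have "fr s 1 \<otimes>\<^bsub>L\<^esub> x = fr a 1" using as by (simp add: fr_mult fr_eq mult.commute)
    ultimately have "a \<in> ctr Q'" by (simp add: ctr_def)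
    moreover have "a \<notin> ctr Q"
    proof
      assume "a \<in> ctr Q"
      then have "fr 1 s \<otimes>\<^bsub>L\<^esub> fr a 1 \<in> Q" using as(2) by (intro Q.I_l_closed frc) (auto simp: ctr_def)
      then show False using x(2) as by (simp add: fr_mult)
    qed
    ultimately show ?thesis using Q(3) unfolding ctr_def by blast
  qed
  obtain C where C: "\<And>i. i \<le> d \<Longrightarrow> prime_set (C i)" "\<And>i. i \<le> d \<Longrightarrow> C i \<subseteq> p" "\<And>i. i < d \<Longrightarrow> C i \<subset> C (Suc i)"
  \<comment> \<open>Without a chain of length at least \<open>d\<close> the supremum would be at
    most \<open>d - 1\<close>, which contradicts its value \<open>d\<close> only for positive
    \<open>d\<close>.\<close>
  proof (cases "d = 0")
    case True
    then show ?thesis using that[of "\<lambda>_. p"] p by simp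
  next
    case False
    let ?chain = "\<lambda>k. \<exists>C :: nat \<Rightarrow> ('a \<times> 'a) set set. (\<forall>i\<le>k. primeideal (C i) L) \<and> (\<forall>i<k. C i \<subset> C (Suc i))"
    have "\<exists>k\<ge>d. ?chain k"
    proof (rule ccontr)
      assume no: "\<not> ?thesis"
      have "krull_dim L \<le> enat (d - 1)"
        unfolding krull_dim_def
      proof (rule Sup_least)
        fix x assume "x \<in> {enat k |k. ?chain k}"
        then obtain k where k: "x = enat k" "?chain k" by blast
        then have "\<not> d \<le> k" using no by blast
        then show "x \<le> enat (d - 1)" using k(1) by simp
      qed
      then show False using dim False unfolding d_def[symmetric] by simp
    qed
    then obtain k C where k: "d \<le> k" "\<And>i. i \<le> k \<Longrightarrow> primeideal (C i) L" "\<And>i. i < k \<Longrightarrow> C i \<subset> C (Suc i)" by blast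
    show ?thesis
      by (rule that[of "\<lambda>i. ctr (C i)"]) (use k ctr ctr_strict in auto)
  qed
  show ?thesis by (rule exI[of _ d], rule exI[of _ h], rule exI[of _ C]) (use h(2) gen C in auto)
qed

text \<open>A maximal proper ideal over \<open>W\<close> exists by Zorn's lemma. For
  \<open>a\<close> and \<open>b\<close> outside it, multiplying two representations of 1 would put 1
  into it if \<open>a * b\<close> were there.\<close>

lemma ideal_in_prime:
  fixes W :: "'a::comm_ring_1 set"
  assumes "0 \<in> W" "\<And>a b. a \<in> W \<Longrightarrow> b \<in> W \<Longrightarrow> a + b \<in> W" "\<And>a b. b \<in> W \<Longrightarrow> a * b \<in> W" "1 \<notin> W"
  obtains p where "prime_set p" "W \<subseteq> p"
proof -
  define F where "F = {V :: 'a set. W \<subseteq> V \<and> (\<forall>a\<in>V. \<forall>b\<in>V. a + b \<in> V) \<and> (\<forall>a. \<forall>b\<in>V. a * b \<in> V) \<and> 1 \<notin> V}"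
  have "\<exists>M\<in>F. \<forall>V\<in>F. M \<subseteq> V \<longrightarrow> V = M"
  proof (rule subset_Zorn_nonempty)
    have "W \<in> F" using assms by (simp add: F_def)
    then show "F \<noteq> {}" by blast
    fix \<C> assume C: "\<C> \<noteq> {}" "subset.chain F \<C>"
    have CF: "V \<in> F" if "V \<in> \<C>" for V using C(2) that by (auto simp: subset.chain_def)
    have "a + b \<in> \<Union>\<C>" if ab: "a \<in> \<Union>\<C>" "b \<in> \<Union>\<C>" for a b
    proof -
      obtain V V' where V: "V \<in> \<C>" "a \<in> V" "V' \<in> \<C>" "b \<in> V'" using ab by blast
      then have "V \<subseteq> V' \<or> V' \<subseteq> V" using C(2) by (auto simp: subset.chain_def)
      then obtain U where "U \<in> \<C>" "a \<in> U" "b \<in> U" using V by blast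
      then have "a + b \<in> U" using CF[of U] by (simp add: F_def)
      then show ?thesis using \<open>U \<in> \<C>\<close> by blast
    qed
    moreover have "a * b \<in> \<Union>\<C>" if "b \<in> \<Union>\<C>" for a b
      using that CF by (auto simp: F_def)
    moreover obtain V0 where V0: "V0 \<in> \<C>" using C(1) by blast
    then have "W \<subseteq> \<Union>\<C>" using CF[OF V0] by (auto simp: F_def)
    moreover have "1 \<notin> \<Union>\<C>" using CF by (auto simp: F_def)
    ultimately show "\<Union>\<C> \<in> F" unfolding F_def by blast
  qed
  then obtain M where MF: "M \<in> F" and Mmax: "\<And>V. V \<in> F \<Longrightarrow> M \<subseteq> V \<Longrightarrow> V = M" by blast
  have M: "W \<subseteq> M" "\<And>a b. a \<in> M \<Longrightarrow> b \<in> M \<Longrightarrow> a + b \<in> M" "\<And>a b. b \<in> M \<Longrightarrow> a * b \<in> M" "1 \<notin> M"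
    using MF by (simp_all add: F_def)
  have M0: "0 \<in> M" using M(1) assms(1) by blast
  have max: "\<exists>x\<in>M. \<exists>y. 1 = x + y * a" if a: "a \<notin> M" for a
  proof (rule ccontr)
    assume no: "\<not> ?thesis"
    define V where "V = {x + y * a |x y. x \<in> M}"
    have sub: "M \<subseteq> V"
    proof
      fix x assume "x \<in> M"
      moreover have "x = x + 0 * a" by simp
      ultimately show "x \<in> V" unfolding V_def by blast
    qed
    have add: "u + v \<in> V" if uv: "u \<in> V" "v \<in> V" for u v
    proof -
      obtain x y x' y' where xy: "u = x + y * a" "v = x' + y' * a" "x \<in> M" "x' \<in> M"
        using uv unfolding V_def by blast
      then have "u + v = (x + x') + (y + y') * a" by (simp add: algebra_simps)
      moreover have "x + x' \<in> M" by (rule M(2)[OF xy(3,4)])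
      ultimately show ?thesis unfolding V_def by blast
    qed
    have mult: "c * u \<in> V" if uV: "u \<in> V" for c u
    proof -
      obtain x y where xy: "u = x + y * a" "x \<in> M" using uV unfolding V_def by blast
      then have "c * u = c * x + (c * y) * a" by (simp add: algebra_simps)
      moreover have "c * x \<in> M" by (rule M(3)[OF xy(2)])
      ultimately show ?thesis unfolding V_def by blast
    qed
    have "1 \<notin> V" using no unfolding V_def by blast
    then have "V \<in> F" unfolding F_def using subset_trans[OF M(1) sub] add mult by simp
    then have "V = M" using Mmax sub by blast
    moreover have "a = 0 + 1 * a" by simp
    then have "a \<in> V" unfolding V_def using M0 by blast
    ultimately show False using a by simp
  qed
  have "prime_set M"
  proof
    fix a b assume ab: "a * b \<in> M"
    show "a \<in> M \<or> b \<in> M"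
    proof (rule ccontr)
      assume "\<not> ?thesis"
      then obtain x y x' y' where x: "x \<in> M" "1 = x + y * a" and x': "x' \<in> M" "1 = x' + y' * b"
        using max by blast
      have "1 = (x + y * a) * (x' + y' * b)" using x(2) x'(2) by simp
      also have "\<dots> = (x' + y' * b) * x + ((y * a) * x' + (y * y') * (a * b))" by (simp add: algebra_simps)
      also have "\<dots> \<in> M" by (intro M(2,3) x(1) x'(1) ab)
      finally show False using M(4) by simp
    qed
  qed (use M M0 in auto)
  then show thesis using that M(1) by blast
qed

section \<open>The Jacobian criterion\<close>

text \<open>One application of \<open>determined_extend_by\<close> for each vector; only the
  existence of a module \<open>F\<close> with the required combinations matters, not its
  shape.\<close>

lemma (in prime_set) extend_iterated:
  fixes v :: "nat \<Rightarrow> nat \<Rightarrow> 'a"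
  assumes E: "fmod.subspace E" and C: "finite C" "determined p C E"
  shows "\<exists>F C'. fmod.subspace F \<and> finite C' \<and> determined p C' F \<and> card C' \<le> card C + d \<and>
    (\<forall>b w. w \<in> E \<longrightarrow> (\<Sum>i<d. fscale (b i) (v i)) + w \<in> F)"
proof (induction d)
  case 0
  then show ?case using E C by (intro exI[of _ E] exI[of _ C]) simp
next
  case (Suc d)
  then obtain F C' where F: "fmod.subspace F" "finite C'" "determined p C' F" "card C' \<le> card C + d"
    "\<And>b w. w \<in> E \<Longrightarrow> (\<Sum>i<d. fscale (b i) (v i)) + w \<in> F" by blast
  obtain C'' where C'': "finite C''" "card C'' \<le> Suc (card C')" "determined p C'' (extend_by p F (v d))"
    using determined_extend_by[OF F(1,3,2)] .
  have "(\<Sum>i<Suc d. fscale (b i) (v i)) + w \<in> extend_by p F (v d)" if w: "w \<in> E" for b w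
  proof -
    let ?y = "(\<Sum>i<d. fscale (b i) (v i)) + w"
    have "1 * ((\<Sum>i<Suc d. fscale (b i) (v i)) + w) j - b d * v d j - ?y j = 0" for j
      by (simp add: fscale_def)
    then have "1 \<notin> p \<and> ?y \<in> F \<and>
      (\<forall>j. 1 * ((\<Sum>i<Suc d. fscale (b i) (v i)) + w) j - b d * v d j - ?y j \<in> p)"
      using F(5)[OF w] by (simp only: zero_in one_notin) simp
    then show ?thesis unfolding extend_by_def by blast
  qed
  moreover have "card C'' \<le> card C + Suc d" using C''(2) F(4) by simp
  ultimately show ?case using subspace_extend_by[OF F(1)] C''(1,3) by blast
qed

text \<open>Gradients exist for polynomials only, so finitely many elements of A are multiplied by
  one unit to become images of polynomials.\<close>

lemma (in presented_algebra) common_denominator: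
  fixes d :: nat
  shows "\<exists>s t \<beta>. s \<in> P \<and> t * bar s = 1 \<and> (\<forall>i<d. \<beta> i \<in> P \<and> a i * bar s = bar (\<beta> i))"
proof (induction d)
    case 0
    show ?case by (rule exI[of _ 1], rule exI[of _ 1]) simp
  next
    case (Suc d)
    then obtain s t \<beta> where IH: "s \<in> P" "t * bar s = 1" "\<And>i. i < d \<Longrightarrow> \<beta> i \<in> P \<and> a i * bar s = bar (\<beta> i)"
      by blast
    obtain g u w where g: "g \<in> P" "u \<in> P" "a d * bar u = bar g" "w * bar u = 1"
      using bar_frac[of "a d"] by blast
    define \<beta>' where "\<beta>' i = (if i = d then g * s else \<beta> i * u)" for i
    have "s * u \<in> P" using IH g by (simp add: pols_in_mult)
    moreover have "(t * w) * bar (s * u) = (t * bar s) * (w * bar u)"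
      using IH g by (simp add: bar_mult algebra_simps)
    then have "(t * w) * bar (s * u) = 1" using IH(2) g(4) by simp
    moreover have "\<beta>' i \<in> P \<and> a i * bar (s * u) = bar (\<beta>' i)" if i: "i < Suc d" for i
    proof (cases "i = d")
      case True
      have "a d * bar (s * u) = (a d * bar u) * bar s" using IH g by (simp add: bar_mult algebra_simps)
      then show ?thesis using True IH(1) g by (simp add: \<beta>'_def bar_mult pols_in_mult)
    next
      case False
      then have i': "i < d" using i by simp
      have "a i * bar (s * u) = (a i * bar s) * bar u" using IH g by (simp add: bar_mult algebra_simps)
      then show ?thesis using False IH(3)[OF i'] g by (simp add: \<beta>'_def bar_mult pols_in_mult)
    qed
    ultimately show ?case by blast
qed

text \<open>Together, \<open>bar_f\<close> and \<open>kernel\<close> say that the \<open>f l\<close>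
  generate the kernel of \<open>bar\<close>.\<close>

locale jacobian_algebra = presented_algebra n bar
  for n and bar :: "'k::field mpol \<Rightarrow> 'a::idom" +
  fixes m :: nat and f :: "nat \<Rightarrow> 'k mpol" and J :: "'a mat"
  assumes f_in: "l < m \<Longrightarrow> f l \<in> P"
    and bar_f: "l < m \<Longrightarrow> bar (f l) = 0"
    and kernel: "g \<in> P \<Longrightarrow> bar g = 0 \<Longrightarrow> \<exists>c. (\<forall>l<m. c l \<in> P) \<and> g = (\<Sum>l<m. c l * f l)"
    and J_def: "J = mat m n (\<lambda>(i, j). bar (pol_pderiv j (f i)))"
begin

lemma J_carrier: "J \<in> carrier_mat m n"
  by (simp add: J_def)

lemma dims [simp]: "dim_row J = m" "dim_col J = n"
  using J_carrier by auto

lemma J_grad: "l < m \<Longrightarrow> k < n \<Longrightarrow> J $$ (l, k) = grad (f l) k"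
  by (simp add: J_def grad_def)

lemma grad_f_outside: "l < m \<Longrightarrow> \<not> k < n \<Longrightarrow> grad (f l) k = 0"
  using pol_pderiv_notin[OF f_in, of l k] by (simp add: grad_def)

text \<open>Its \<open>det_rank\<close> at \<open>p\<close> is the rank of the Jacobi matrix modulo
  \<open>p\<close>, called s in the overview.\<close>

definition row_module :: "(nat \<Rightarrow> 'a) set" where
  "row_module = fmod.span {grad (f l) |l. l < m}"

lemma subspace_row_module: "fmod.subspace row_module"
  unfolding row_module_def by (rule fmod.subspace_span)

lemma row_module_sum: "(\<Sum>l<m. fscale (a l) (grad (f l))) \<in> row_module"
  unfolding row_module_def
  by (intro fmod.span_sum fmod.span_scale fmod.span_base) auto

lemma row_module_combination:
  assumes "e \<in> row_module"
  shows "\<exists>a. \<forall>k. e k = (\<Sum>l<m. a l * grad (f l) k)"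
proof -
  let ?T = "{e. \<exists>a. \<forall>k. e k = (\<Sum>l<m. a l * grad (f l) k)}"
  have "fmod.subspace ?T"
  proof (rule fmod.subspaceI)
    show "0 \<in> ?T" by (auto intro!: exI[of _ "\<lambda>_. 0"])
  next
    fix x y assume "x \<in> ?T" "y \<in> ?T"
    then obtain a b where "\<And>k. x k = (\<Sum>l<m. a l * grad (f l) k)" "\<And>k. y k = (\<Sum>l<m. b l * grad (f l) k)"
      by blast
    then have "\<forall>k. (x + y) k = (\<Sum>l<m. (a l + b l) * grad (f l) k)" by (simp add: distrib_right sum.distrib)
    then show "x + y \<in> ?T" by (intro CollectI exI)
  next
    fix c x assume "x \<in> ?T"
    then obtain a where "\<And>k. x k = (\<Sum>l<m. a l * grad (f l) k)" by blast
    then have "\<forall>k. fscale c x k = (\<Sum>l<m. (c * a l) * grad (f l) k)"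
      by (simp add: fscale_def sum_distrib_left mult.assoc)
    then show "fscale c x \<in> ?T" by (intro CollectI exI)
  qed
  moreover have "{grad (f l) |l. l < m} \<subseteq> ?T"
  proof safe
    fix l assume l: "l < m"
    have "(if i = l then 1 else 0) * grad (f i) k = (if i = l then grad (f i) k else 0)" for i k by simp
    then have "\<forall>k. grad (f l) k = (\<Sum>i<m. (if i = l then 1 else 0) * grad (f i) k)" using l by simp
    then show "\<exists>a. \<forall>k. grad (f l) k = (\<Sum>l<m. a l * grad (f l) k)"
      by (intro exI[of _ "\<lambda>i. if i = l then 1 else 0"])
  qed
  ultimately have "e \<in> ?T" using assms fmod.span_minimal unfolding row_module_def by blast
  then show ?thesis by simp
qed

lemma row_module_outside: "e \<in> row_module \<Longrightarrow> \<not> k < n \<Longrightarrow> e k = 0"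
  using row_module_combination[of e] by (auto simp: grad_f_outside)

lemma row_module_determined: "0 \<in> p \<Longrightarrow> determined p {..<n} row_module"
  unfolding determined_def using row_module_outside by (metis lessThan_iff)

text \<open>If fewer than r coordinates determined the gradients, the r rows of a nonzero minor
  would have a nontrivial combination vanishing there. It is a combination of gradients of the
  \<open>f l\<close>, hence would vanish everywhere, against the minor.\<close>

lemma mat_rank_le_det_rank: "mat_rank J \<le> det_rank {0} (conormal {0} {..<n})"
proof (rule ccontr)
  assume "\<not> ?thesis"
  moreover obtain C0 where C0: "finite C0" "card C0 = det_rank {0} (conormal {0} {..<n})"
    "determined {0} C0 (conormal {0} {..<n})"
    using det_rank_obtain[OF _ conormal_determined_all] by (metis finite_lessThan singletonI)
  moreover define C where "C = C0 \<inter> {..<n}"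
  moreover have "card C \<le> card C0" unfolding C_def using C0(1) by (intro card_mono) auto
  ultimately have lt: "card C < mat_rank J" by simp
  have C: "determined {0} C (conormal {0} {..<n})" "C \<subseteq> {..<n}" "finite C"
    unfolding C_def using C0(3) by (auto intro: conormal_determined_restrict)
  let ?r = "mat_rank J"
  obtain ii jj where ij: "length ii = ?r" "length jj = ?r"
    "set ii \<subseteq> {..<m}" "set jj \<subseteq> {..<n}" "minor J ii jj \<noteq> 0"
    using mat_rank_obtain[OF J_carrier] by metis
  define xs where "xs = sorted_list_of_set C"
  have xs: "set xs = C" "length xs = card C" using C(3) by (auto simp: xs_def)
  \<comment> \<open>The rows restricted to \<open>C\<close>, padded with zeros to a square matrix.
    Position \<open>r - 1\<close> is always padding, so the determinant is 0 and yields the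
    dependence \<open>v\<close>.\<close>
  define F where "F b a = (if b < length xs then J $$ (ii ! a, xs ! b) else 0)" for a b
  have "det (mat ?r ?r (\<lambda>(a, b). F b a)) = 0"
    unfolding det_0_iff_fun[of ?r "\<lambda>a b. F b a"]
  proof (rule exI[of _ "\<lambda>b. if b = ?r - 1 then 1 else 0"], intro conjI allI impI)
    show "\<exists>b<?r. (if b = ?r - 1 then 1 else 0 :: 'a) \<noteq> 0" using lt by (intro exI[of _ "?r - 1"]) auto
    fix a assume "a < ?r"
    have "F b a * (if b = ?r - 1 then 1 else 0) = 0" for b
      using lt xs(2) by (auto simp: F_def)
    then show "(\<Sum>b<?r. F b a * (if b = ?r - 1 then 1 else 0)) = 0" by simp
  qed
  then have "det (mat ?r ?r (\<lambda>(b, a). F b a)) = 0" using det_transpose_fun[of ?r F] by simp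
  then obtain v where v: "\<exists>a<?r. v a \<noteq> 0" "\<And>b. b < ?r \<Longrightarrow> (\<Sum>a<?r. F b a * v a) = 0"
    unfolding det_0_iff_fun by blast
  have iil: "ii ! a < m" if "a < ?r" for a using that ij by (metis lessThan_iff nth_mem subsetD)
  define e where "e = (\<Sum>a<?r. fscale (v a) (grad (f (ii ! a))))"
  have e: "e k = (\<Sum>a<?r. J $$ (ii ! a, k) * v a)" if "k < n" for k
    unfolding e_def sum_apply using that iil by (intro sum.cong) (simp_all add: fscale_def J_grad mult.commute)
  have "e \<in> conormal {0} {..<n}"
    unfolding e_def using iil f_in bar_f
    by (intro fmod.subspace_sum fmod.subspace_scale subspace_conormal grad_in_conormal) auto
  moreover have "e c \<in> {0}" if c: "c \<in> C" for c
  proof -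
    obtain b where b: "b < length xs" "c = xs ! b" using c xs(1) by (metis in_set_conv_nth)
    then have "(\<Sum>a<?r. J $$ (ii ! a, c) * v a) = 0" using v(2)[of b] lt xs(2) by (simp add: F_def)
    then show ?thesis using e c C(2) by auto
  qed
  ultimately have "e k = 0" for k using C(1) unfolding determined_def by blast
  moreover have "jj ! b < n" if "b < ?r" for b using that ij by (metis lessThan_iff nth_mem subsetD)
  ultimately have "\<forall>b<?r. (\<Sum>a<?r. J $$ (ii ! a, jj ! b) * v a) = 0" using e by metis
  then have "minor J ii jj = 0" using minor_0_iff_rows[of ii jj J] ij v(1) by auto
  then show False using ij by simp
qed

text \<open>For \<open>g\<close> vanishing modulo \<open>p\<close>, clearing denominators turns
  \<open>u * bar g\<close> as a combination of the \<open>h i\<close> into a polynomial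
  \<open>z\<close> with image 0, hence into a combination of the \<open>f l\<close>. Modulo
  \<open>p\<close> the gradient of \<open>z\<close> retains only gradients of \<open>g\<close> and
  of the lifted generators, so d vectors besides the rows suffice.\<close>

lemma det_rank_conormal_le:
  assumes p: "prime_set p" and h: "\<And>i. i < d \<Longrightarrow> h i \<in> p"
    and gen: "\<And>x. x \<in> p \<Longrightarrow> \<exists>u c. u \<notin> p \<and> u * x = (\<Sum>i<d. c i * h i)"
  shows "det_rank p (conormal p {..<n}) \<le> det_rank p row_module + d"
proof -
  interpret prime_set p by fact
  obtain C where C: "finite C" "card C = det_rank p row_module" "determined p C row_module"
    using det_rank_obtain[OF _ row_module_determined] by (metis finite_lessThan zero_in)
  obtain s t \<eta> where \<eta>: "s \<in> P" "t * bar s = 1" "\<And>i. i < d \<Longrightarrow> \<eta> i \<in> P"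
    "\<And>i. i < d \<Longrightarrow> h i * bar s = bar (\<eta> i)"
    using common_denominator[where a = h and d = d] by blast
  have hs: "h i = t * bar (\<eta> i)" if "i < d" for i
    using \<eta>(2) \<eta>(4)[OF that] by (metis mult.left_commute mult.right_neutral)
  have \<eta>p: "bar (\<eta> i) \<in> p" if "i < d" for i using \<eta>(4)[OF that] h[OF that] by (metis mult_in mult.commute)
  obtain F C' where F: "fmod.subspace F" "finite C'" "determined p C' F" "card C' \<le> card C + d"
    "\<And>b w. w \<in> row_module \<Longrightarrow> (\<Sum>i<d. fscale (b i) (grad (\<eta> i))) + w \<in> F"
    using extend_iterated[OF subspace_row_module C(1,3), of d "\<lambda>i. grad (\<eta> i)"] by blast
  have "conormal p {..<n} \<subseteq> extend_by p F 0"
    unfolding conormal_def[of p]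
  proof (rule span_subset_extend_by[OF F(1)], safe)
    fix g assume g: "g \<in> P" "bar g \<in> p"
    obtain u c where u: "u \<notin> p" "u * bar g = (\<Sum>i<d. c i * h i)" using gen[OF g(2)] by blast
    \<comment> \<open>One denominator for \<open>u\<close>, stored at index \<open>d\<close>, and
      for all coefficients; the extra factor \<open>t\<close> makes up for replacing
      \<open>h i\<close> by the image of \<open>\<eta> i\<close>.\<close>
    obtain \<sigma> \<tau> \<beta> where \<sigma>: "\<sigma> \<in> P" "\<tau> * bar \<sigma> = 1" "\<And>i. i < Suc d \<Longrightarrow> \<beta> i \<in> P"
      "\<And>i. i < Suc d \<Longrightarrow> (if i = d then u else c i * t) * bar \<sigma> = bar (\<beta> i)"
      using common_denominator[where a = "\<lambda>i. if i = d then u else c i * t" and d = "Suc d"] by blast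
    have ub: "u * bar \<sigma> = bar (\<beta> d)" using \<sigma>(4)[of d] by simp
    have "bar \<sigma> \<notin> p" using \<sigma>(2) by (metis mult_in one_notin)
    then have \<beta>d: "bar (\<beta> d) \<notin> p" using u(1) ub by (metis mult_in_iff)
    have \<beta>P: "\<beta> i \<in> P" if "i \<le> d" for i using \<sigma>(3) that by simp
    have \<beta>lt: "\<beta> i \<in> P" if "i < d" for i using \<sigma>(3) that by simp
    define z where "z = \<beta> d * g - (\<Sum>i<d. \<beta> i * \<eta> i)"
    have "(\<Sum>i<d. bar (\<beta> i) * bar (\<eta> i)) = (\<Sum>i<d. bar \<sigma> * (c i * h i))"
    proof (rule sum.cong[OF refl])
      fix i assume "i \<in> {..<d}"
      then have i: "i < d" by simp
      then have "bar (\<beta> i) = c i * t * bar \<sigma>" using \<sigma>(4)[of i] by simp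
      then show "bar (\<beta> i) * bar (\<eta> i) = bar \<sigma> * (c i * h i)" using hs[OF i] by (simp add: mult_ac)
    qed
    also have "\<dots> = bar \<sigma> * (u * bar g)" by (simp add: u(2) sum_distrib_left)
    also have "\<dots> = bar (\<beta> d) * bar g" by (simp add: mult_ac flip: ub)
    finally have bz: "(\<Sum>i<d. bar (\<beta> i) * bar (\<eta> i)) = bar (\<beta> d) * bar g" .
    have zP: "z \<in> P" unfolding z_def using g(1) \<beta>P[of d] \<beta>lt \<eta>(3)
      by (intro pols_in_diff pols_in_mult pols_in_sum) auto
    have prodP: "\<beta> i * \<eta> i \<in> P" if "i \<in> {..<d}" for i
      using that \<beta>lt \<eta>(3) by (simp add: pols_in_mult)
    have sumP: "(\<Sum>i<d. \<beta> i * \<eta> i) \<in> P" by (rule pols_in_sum[OF prodP])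
    have dP: "\<beta> d * g \<in> P" using g(1) \<beta>P[of d] by (simp add: pols_in_mult)
    have "bar z = bar (\<beta> d * g) - (\<Sum>i<d. bar (\<beta> i * \<eta> i))"
      unfolding z_def bar_diff[OF dP sumP] by (simp only: bar_sum[OF prodP])
    also have "\<dots> = bar (\<beta> d) * bar g - (\<Sum>i<d. bar (\<beta> i) * bar (\<eta> i))"
      using g(1) \<beta>P[of d] \<beta>lt \<eta>(3) by (simp add: bar_mult)
    finally have "bar z = bar (\<beta> d) * bar g - (\<Sum>i<d. bar (\<beta> i) * bar (\<eta> i))" .
    then have "bar z = 0" by (simp add: bz)
    with zP obtain \<gamma> where \<gamma>: "\<And>l. l < m \<Longrightarrow> \<gamma> l \<in> P" "z = (\<Sum>l<m. \<gamma> l * f l)" using kernel by blast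
    have gz: "grad z = (\<Sum>l<m. fscale (bar (\<gamma> l)) (grad (f l)))" (is "_ = ?w")
    proof -
      have "grad z = (\<Sum>l<m. grad (\<gamma> l * f l))"
        unfolding \<gamma>(2) using \<gamma>(1) f_in by (intro grad_sum pols_in_mult) auto
      also have "\<dots> = ?w"
        using \<gamma>(1) f_in bar_f by (intro sum.cong) (simp_all add: grad_mult fscale_def fun_eq_iff)
      finally show ?thesis .
    qed
    have "grad z = grad (\<beta> d * g) - (\<Sum>i<d. grad (\<beta> i * \<eta> i))"
      unfolding z_def grad_diff[OF dP sumP] by (simp only: grad_sum[OF prodP])
    also have "\<dots> = fscale (bar (\<beta> d)) (grad g) + fscale (bar g) (grad (\<beta> d)) -
       ((\<Sum>i<d. fscale (bar (\<beta> i)) (grad (\<eta> i))) + (\<Sum>i<d. fscale (bar (\<eta> i)) (grad (\<beta> i))))"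
      using g(1) \<beta>P[of d] \<beta>lt \<eta>(3) by (simp add: grad_mult sum.distrib)
    finally have eq: "?w = fscale (bar (\<beta> d)) (grad g) + fscale (bar g) (grad (\<beta> d)) -
       ((\<Sum>i<d. fscale (bar (\<beta> i)) (grad (\<eta> i))) + (\<Sum>i<d. fscale (bar (\<eta> i)) (grad (\<beta> i))))"
      unfolding gz .
    let ?y = "(\<Sum>i<d. fscale (bar (\<beta> i)) (grad (\<eta> i))) + ?w"
    have "?y \<in> F" by (intro F(5) row_module_sum)
    moreover have "bar (\<beta> d) * grad g j - 0 * (0 :: nat \<Rightarrow> 'a) j - ?y j \<in> p" for j
    proof -
      have "bar (\<beta> d) * grad g j - 0 * (0 :: nat \<Rightarrow> 'a) j - ?y j
        = (\<Sum>i<d. bar (\<eta> i) * grad (\<beta> i) j) - bar g * grad (\<beta> d) j"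
        unfolding eq by (simp add: fscale_def sum_apply algebra_simps)
      also have "\<dots> \<in> p" using g(2) \<eta>p by (intro diff_in sum_in) simp_all
      finally show ?thesis .
    qed
    ultimately show "grad g \<in> extend_by p F 0" unfolding extend_by_def using \<beta>d by blast
  qed
  then have "determined p C' (conormal p {..<n})"
    using determined_extend_by_0[OF F(3)] determined_mono by blast
  then show ?thesis using det_rank_le[OF F(2)] F(4) C(2) by fastforce
qed

text \<open>As long as the size is below the rank, the columns chosen so far do not determine the
  row module; a row combination witnessing this lets the minor be bordered outside
  \<open>p\<close>.\<close>

lemma minor_notin_prime:
  assumes p: "prime_set p" and s: "s \<le> det_rank p row_module"
  shows "\<exists>ii jj. length ii = s \<and> length jj = s \<and> set ii \<subseteq> {..<m} \<and> set jj \<subseteq> {..<n} \<and> minor J ii jj \<notin> p"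
  using s
proof (induction s)
  case 0
  interpret prime_set p by fact
  show ?case by simp
next
  case (Suc s)
  interpret prime_set p by fact
  obtain ii jj where ij: "length ii = s" "length jj = s" "set ii \<subseteq> {..<m}" "set jj \<subseteq> {..<n}" "minor J ii jj \<notin> p"
    using Suc by auto
  have "\<not> determined p (set jj) row_module"
    using det_rank_le[of "set jj" p row_module] card_length[of jj] ij(2) Suc.prems by auto
  then obtain e k where e: "e \<in> row_module" "\<And>c. c \<in> set jj \<Longrightarrow> e c \<in> p" "e k \<notin> p"
    unfolding determined_def by blast
  have k: "k < n" using row_module_outside[OF e(1), of k] e(3) by (metis zero_in)
  obtain a where a: "\<And>k. e k = (\<Sum>l<m. a l * grad (f l) k)" using row_module_combination[OF e(1)] by blast
  have "\<exists>l<m. minor J (ii @ [l]) (jj @ [k]) \<notin> p"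
  proof (rule minor_extend[where e = e and a = a])
    fix k' assume "k' \<in> insert k (set jj)"
    then have "k' < n" using k ij(4) by auto
    then show "e k' = (\<Sum>l<m. a l * J $$ (l, k'))" by (simp add: a J_grad)
  qed (use ij e in auto)
  then obtain l where "l < m" "minor J (ii @ [l]) (jj @ [k]) \<notin> p" by blast
  then show ?case using ij k by (intro exI[of _ "ii @ [l]"] exI[of _ "jj @ [k]"]) auto
qed

lemma regular_minor_notin_prime:
  assumes K: "CHAR('k) > 0" "perfect_field TYPE('k)" and reg: "regular_ring (ring_of_type_algebra :: 'a ring)"
    and p: "prime_set p"
  obtains ii jj where "ii \<in> nonsing_rows J" "jj \<in> nonsing_cols J" "minor J ii jj \<notin> p"
proof -
  interpret prime_set p by fact
  obtain d and h :: "nat \<Rightarrow> 'a" and C where hC: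
    "(\<forall>i<d. h i \<in> p) \<and> (\<forall>x\<in>p. \<exists>u c. u \<notin> p \<and> u * x = (\<Sum>i<d. c i * h i)) \<and>
    (\<forall>i\<le>d. prime_set (C i) \<and> C i \<subseteq> p) \<and> (\<forall>i<d. C i \<subset> C (Suc i))"
    using regular_ring_prime[OF p reg] by (elim exE) (rule that)
  have h: "\<And>i. i < d \<Longrightarrow> h i \<in> p" "\<And>x. x \<in> p \<Longrightarrow> \<exists>u c. u \<notin> p \<and> u * x = (\<Sum>i<d. c i * h i)"
    and C: "\<And>i. i \<le> d \<Longrightarrow> prime_set (C i)" "\<And>i. i \<le> d \<Longrightarrow> C i \<subseteq> p" "\<And>i. i < d \<Longrightarrow> C i \<subset> C (Suc i)"
    using hC by simp_all
  let ?\<rho> = "\<lambda>q. det_rank q (conormal q {..<n})"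
  \<comment> \<open>The chain need not start at the zero prime; the weak inequality for ranks covers
    the start, the strict one each later step.\<close>
  have chain: "?\<rho> {0} + i \<le> ?\<rho> (C i)" if "i \<le> d" for i
    using that
  proof (induction i)
    case 0
    interpret C0: prime_set "C 0" using C(1) by simp
    show ?case using det_rank_conormal_mono[OF K prime_set_0 C(1), of 0] by simp
  next
    case (Suc i)
    have "?\<rho> (C i) + 1 \<le> ?\<rho> (C (Suc i))"
      using det_rank_conormal_mono[OF K C(1)[of i] C(1)[of "Suc i"]] C(3)[of i] Suc.prems
      by (auto split: if_splits)
    then show ?case using Suc by simp
  qed
  have "?\<rho> (C d) \<le> ?\<rho> p" using det_rank_conormal_mono[OF K C(1)[of d] p] C(2)[of d] by simp
  then have "mat_rank J \<le> det_rank p row_module"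
    using mat_rank_le_det_rank chain[of d] det_rank_conormal_le[OF p h] by simp
  from minor_notin_prime[OF p this] obtain ii jj where ij: "length ii = mat_rank J" "length jj = mat_rank J"
    "set ii \<subseteq> {..<m}" "set jj \<subseteq> {..<n}" "minor J ii jj \<notin> p" by blast
  \<comment> \<open>The index sets consist of increasing tuples. A nonzero minor has distinct rows
    and columns, and sorting them changes only the sign.\<close>
  have nz: "minor J ii jj \<noteq> 0" using ij(5) by auto
  then have dist: "distinct ii" "distinct jj"
    using minor_not_distinct_rows[of ii jj J] minor_not_distinct_cols[of ii jj J] ij by metis+
  obtain \<epsilon> where \<epsilon>: "\<epsilon> = 1 \<or> \<epsilon> = -1" "minor J (sort ii) (sort jj) = \<epsilon> * minor J ii jj"
    using minor_sort[of ii jj J] ij by metis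
  have np: "minor J (sort ii) (sort jj) \<notin> p" using \<epsilon> ij(5) by auto
  have "sort ii \<in> incr_tuples (mat_rank J) m" "sort jj \<in> incr_tuples (mat_rank J) n"
    using ij dist by (auto simp: incr_tuples_def strict_sorted_iff)
  moreover have "minor J (sort ii) (sort jj) \<noteq> 0" using np by auto
  ultimately show thesis
    using that[of "sort ii" "sort jj"] np by (auto simp: nonsing_rows_def nonsing_cols_def)
qed

end

section \<open>Derivations and their relations\<close>

lemma pols_in_induct [consumes 1, case_names const var add mult]:
  assumes "g \<in> pols_in V"
    and const: "\<And>c. Q (pol_const c)" and var: "\<And>j. j \<in> V \<Longrightarrow> Q (pol_var j)"
    and add: "\<And>f g. f \<in> pols_in V \<Longrightarrow> g \<in> pols_in V \<Longrightarrow> Q f \<Longrightarrow> Q g \<Longrightarrow> Q (f + g)"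
    and mult: "\<And>f g. f \<in> pols_in V \<Longrightarrow> g \<in> pols_in V \<Longrightarrow> Q f \<Longrightarrow> Q g \<Longrightarrow> Q (f * g)"
  shows "Q g"
proof -
  have single: "Q (Poly_Mapping.single e c)" if "Poly_Mapping.keys e \<subseteq> V" for e c
    using that
  proof (induction "tdeg e" arbitrary: e)
    case 0
    then show ?case using const[of c] by (simp add: pol_const_def)
  next
    case (Suc t)
    then have "e \<noteq> 0" by (metis nat.distinct(1) tdeg_0_iff)
    then have "Poly_Mapping.keys e \<noteq> {}" by simp
    then obtain j where j: "j \<in> Poly_Mapping.keys e" by blast
    define e' where "e' = e - Poly_Mapping.single j 1"
    have e: "e = e' + Poly_Mapping.single j 1"
      unfolding e'_def using j
      by (intro poly_mapping_eqI) (auto simp: lookup_add lookup_minus lookup_single when_def in_keys_iff)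
    have "Poly_Mapping.keys e' \<subseteq> Poly_Mapping.keys e"
      unfolding e'_def by (auto simp: in_keys_iff lookup_minus)
    then have e'V: "Poly_Mapping.keys e' \<subseteq> V" using Suc.prems by blast
    moreover have "t = tdeg e'" using Suc.hyps(2) by (simp add: e tdeg_add tdeg_single)
    ultimately have "Q (Poly_Mapping.single e' c)" using Suc.hyps(1) by blast
    then have "Q (Poly_Mapping.single e' c * pol_var j)"
      using j Suc.prems e'V by (intro mult var pols_in_single pol_var_in) auto
    then show ?case by (subst e) (simp add: pol_var_def mult_single)
  qed
  have sumQ: "Q (sum F A)" if "finite A" "\<And>x. x \<in> A \<Longrightarrow> F x \<in> pols_in V \<and> Q (F x)" for F and A :: "(nat \<Rightarrow>\<^sub>0 nat) set"
    using that
  proof (induction A rule: finite_induct)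
    case empty
    then show ?case using const[of 0] by (simp add: pol_const_def)
  next
    case (insert x A)
    then show ?case by (simp add: add pols_in_sum)
  qed
  have "Q (\<Sum>e\<in>Poly_Mapping.keys g. Poly_Mapping.single e (Poly_Mapping.lookup g e))"
    using assms(1) by (intro sumQ) (auto simp: pols_in_def intro!: single)
  then show ?thesis by (simp flip: sum_single)
qed

lemma derivations_subspace: "fmod.subspace (derivations \<kappa>)"
  by (rule fmod.subspaceI) (auto simp: derivations_def fscale_def algebra_simps)

lemma derivation_add: "D \<in> derivations \<kappa> \<Longrightarrow> D (a + b) = D a + D b"
  and derivation_mult: "D \<in> derivations \<kappa> \<Longrightarrow> D (a * b) = a * D b + b * D a"
  and derivation_const_mult: "D \<in> derivations \<kappa> \<Longrightarrow> D (\<kappa> c * a) = \<kappa> c * D a"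
  unfolding derivations_def by blast+

lemma derivation_1:
  assumes "D \<in> derivations \<kappa>"
  shows "D 1 = 0"
  using derivation_mult[OF assms, of 1 1] by simp

lemma derivation_const: "D \<in> derivations \<kappa> \<Longrightarrow> D (\<kappa> c) = 0"
  using derivation_const_mult[of D \<kappa> c 1] derivation_1[of D \<kappa>] by simp

section \<open>Derivations of a presented algebra and the quotient rule\<close>

context presented_algebra
begin

abbreviation Ders :: "('a \<Rightarrow> 'a) set" where
  "Ders \<equiv> derivations (\<lambda>c. bar (pol_const c))"

lemma derivation_bar:
  assumes D: "D \<in> Ders" and g: "g \<in> P"
  shows "D (bar g) = (\<Sum>k<n. D (bar (pol_var k)) * grad g k)"
  using g
proof (induction rule: pols_in_induct)
  case (const c)
  then show ?case using derivation_const[OF D, of c] by (simp add: grad_def)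
next
  case (var j)
  have "D (bar (pol_var k)) * grad (pol_var j) k = (if k = j then D (bar (pol_var k)) else 0)" for k
    by (simp add: grad_def pol_pderiv_var)
  then show ?case using var by simp
next
  case (add f g)
  then show ?case by (simp add: bar_add derivation_add[OF D] grad_add distrib_left sum.distrib)
next
  case (mult f g)
  then show ?case
    by (simp add: bar_mult derivation_mult[OF D] grad_mult fscale_def distrib_left sum.distrib
        sum_distrib_left mult_ac)
qed

lemma derivation_eqI:
  assumes D: "D \<in> Ders" "D' \<in> Ders" and eq: "\<And>g. g \<in> P \<Longrightarrow> D (bar g) = D' (bar g)"
  shows "D = D'"
proof
  fix a
  obtain g s t where gs: "g \<in> P" "s \<in> P" "a * bar s = bar g" "t * bar s = 1" using bar_frac[of a] by blast
  have "bar s * E a = E (bar g) - a * E (bar s)" if "E \<in> Ders" for E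
    using derivation_mult[OF that, of a "bar s"] gs(3) by simp
  then have "bar s * D a = bar s * D' a" using D eq gs by simp
  moreover have "bar s \<noteq> 0" using gs(4) by auto
  ultimately show "D a = D' a" by simp
qed

lemma derivation_eqI_vars:
  assumes D: "D \<in> Ders" "D' \<in> Ders"
    and eq: "\<And>k. k < n \<Longrightarrow> D (bar (pol_var k)) = D' (bar (pol_var k))"
  shows "D = D'"
  using D by (rule derivation_eqI) (simp add: derivation_bar[OF D(1)] derivation_bar[OF D(2)] eq)

text \<open>The quotient rule dictates the value at a fraction; \<open>rel\<close> is the graph that
  it defines. The hypothesis on the kernel makes the value independent of the
  representation.\<close>

lemma derivation_lift:
  assumes add: "\<And>f g. f \<in> P \<Longrightarrow> g \<in> P \<Longrightarrow> D0 (f + g) = D0 f + D0 g"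
    and mult: "\<And>f g. f \<in> P \<Longrightarrow> g \<in> P \<Longrightarrow> D0 (f * g) = bar f * D0 g + bar g * D0 f"
    and const: "\<And>c. D0 (pol_const c) = 0"
    and ker: "\<And>g. g \<in> P \<Longrightarrow> bar g = 0 \<Longrightarrow> D0 g = 0"
  shows "\<exists>D\<in>Ders. \<forall>g\<in>P. D (bar g) = D0 g"
proof -
  have D0_1: "D0 1 = 0" using const[of 1] by (simp add: pol_const_def)
  define rel where "rel a d \<longleftrightarrow> (\<exists>g\<in>P. \<exists>s\<in>P. bar s \<noteq> 0 \<and> a * bar s = bar g \<and> d * bar s = D0 g - a * D0 s)" for a d
  have D0_diff: "D0 (f - g) = D0 f - D0 g" if "f \<in> P" "g \<in> P" for f g
    using add[of "f - g" g] that by (simp add: pols_in_diff)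
  have ex: "\<exists>d. rel a d" for a
  proof -
    obtain g s t where gs: "g \<in> P" "s \<in> P" "a * bar s = bar g" "t * bar s = 1" using bar_frac[of a] by blast
    have "(t * (D0 g - a * D0 s)) * bar s = D0 g - a * D0 s" using gs(4) by (metis mult.commute mult.left_commute mult.right_neutral)
    moreover have "bar s \<noteq> 0" using gs(4) by auto
    ultimately show ?thesis unfolding rel_def using gs by blast
  qed
  have unique: "d = d'" if rels: "rel a d" "rel a d'" for a d d'
  proof -
    obtain g s where gs: "g \<in> P" "s \<in> P" "bar s \<noteq> 0" "a * bar s = bar g" "d * bar s = D0 g - a * D0 s"
      using rels(1) unfolding rel_def by blast
    obtain g' s' where gs': "g' \<in> P" "s' \<in> P" "bar s' \<noteq> 0" "a * bar s' = bar g'" "d' * bar s' = D0 g' - a * D0 s'"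
      using rels(2) unfolding rel_def by blast
    \<comment> \<open>Two representations of \<open>a\<close> agree after cross-multiplication, so
      \<open>D0\<close> kills the difference; expanding this by the product rule compares the two
      quotients.\<close>
    have "bar (g * s' - g' * s) = 0"
      using gs gs' by (simp add: bar_diff bar_mult pols_in_mult mult_ac flip: gs(4) gs'(4))
    then have "D0 (g * s' - g' * s) = 0" using gs gs' by (intro ker pols_in_diff pols_in_mult)
    then have e: "bar g * D0 s' + bar s' * D0 g = bar g' * D0 s + bar s * D0 g'"
      using gs gs' by (simp add: D0_diff mult pols_in_mult)
    have "d * bar s * bar s' = bar s' * D0 g - bar g' * D0 s"
      unfolding gs(5) by (simp add: algebra_simps flip: gs'(4))
    also have "\<dots> = bar s * D0 g' - bar g * D0 s'" using e by (simp add: algebra_simps)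
    also have "\<dots> = d' * bar s' * bar s"
      unfolding gs'(5) by (simp add: algebra_simps flip: gs(4))
    finally have "d * (bar s * bar s') = d' * (bar s * bar s')" by (simp add: mult_ac)
    then show ?thesis using gs(3) gs'(3) by simp
  qed
  define D where "D a = (THE d. rel a d)" for a
  have D: "rel a (D a)" for a
    unfolding D_def using ex[of a] unique by (metis theI)
  have D_eq: "D a = d" if "rel a d" for a d using unique[OF D that] .
  have bar: "D (bar g) = D0 g" if "g \<in> P" for g
  proof (rule D_eq)
    show "rel (bar g) (D0 g)"
      unfolding rel_def by (rule bexI[of _ g], rule bexI[of _ 1]) (use that D0_1 in auto)
  qed
  have "D (a + b) = D a + D b \<and> D (a * b) = a * D b + b * D a" for a b
  proof -
    obtain g s where gs: "g \<in> P" "s \<in> P" "bar s \<noteq> 0" "a * bar s = bar g" "D a * bar s = D0 g - a * D0 s"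
      using D[of a] unfolding rel_def by blast
    obtain g' s' where gs': "g' \<in> P" "s' \<in> P" "bar s' \<noteq> 0" "b * bar s' = bar g'" "D b * bar s' = D0 g' - b * D0 s'"
      using D[of b] unfolding rel_def by blast
    have sP: "s * s' \<in> P" "bar (s * s') \<noteq> 0" and sum: "g * s' + g' * s \<in> P" and prod: "g * g' \<in> P"
      using gs gs' by (simp_all add: bar_mult pols_in_mult pols_in_add)
    have "rel (a + b) (D a + D b)"
      unfolding rel_def
    proof (rule bexI[OF _ sum], rule bexI[OF _ sP(1)], intro conjI sP(2))
      show "(a + b) * bar (s * s') = bar (g * s' + g' * s)"
        using gs(1,2) gs'(1,2) by (simp add: bar_add bar_mult pols_in_mult algebra_simps flip: gs(4) gs'(4))
      have "(D a + D b) * bar (s * s') = (D a * bar s) * bar s' + (D b * bar s') * bar s"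
        using gs(1,2) gs'(1,2) by (simp add: bar_mult algebra_simps)
      also have "\<dots> = D0 (g * s' + g' * s) - (a + b) * D0 (s * s')"
        unfolding gs(5) gs'(5) using gs(1,2) gs'(1,2)
        by (simp add: add mult pols_in_mult algebra_simps flip: gs(4) gs'(4))
      finally show "(D a + D b) * bar (s * s') = D0 (g * s' + g' * s) - (a + b) * D0 (s * s')" .
    qed
    moreover have "rel (a * b) (a * D b + b * D a)"
      unfolding rel_def
    proof (rule bexI[OF _ prod], rule bexI[OF _ sP(1)], intro conjI sP(2))
      show "a * b * bar (s * s') = bar (g * g')"
        using gs(1,2) gs'(1,2) by (simp add: bar_mult algebra_simps flip: gs(4) gs'(4))
      have "(a * D b + b * D a) * bar (s * s') = a * bar s * (D b * bar s') + b * bar s' * (D a * bar s)"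
        using gs(1,2) gs'(1,2) by (simp add: bar_mult algebra_simps)
      also have "\<dots> = D0 (g * g') - a * b * D0 (s * s')"
        unfolding gs(5) gs'(5) using gs(1,2) gs'(1,2)
        by (simp add: mult algebra_simps flip: gs(4) gs'(4))
      finally show "(a * D b + b * D a) * bar (s * s') = D0 (g * g') - a * b * D0 (s * s')" .
    qed
    ultimately show ?thesis using D_eq by blast
  qed
  then have "D \<in> Ders" using bar[of "pol_const c" for c] const by (simp add: derivations_def)
  then show ?thesis using bar by blast
qed

end

lemma sum_pred_delta:
  fixes N :: nat
  shows "(\<Sum>\<nu><N. F \<nu> * (if c \<nu> = k then 1 else 0)) = (\<Sum>\<nu> | \<nu> < N \<and> c \<nu> = k. F \<nu> :: 'a::comm_ring_1)"
  by (rule sum.mono_neutral_cong_right) auto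

section \<open>The derivations attached to minors of the Jacobi matrix\<close>

context jacobian_algebra
begin

lemma nonsing_rowsD:
  assumes "ii \<in> nonsing_rows J"
  shows "length ii = mat_rank J" "set ii \<subseteq> {..<m}"
  using assms by (auto simp: nonsing_rows_def incr_tuples_def)

lemma nonsing_colsD:
  assumes "jj \<in> nonsing_cols J"
  shows "length jj = mat_rank J" "set jj \<subseteq> {..<n}" "sorted_wrt (<) jj" "distinct jj"
  using assms by (auto simp: nonsing_cols_def incr_tuples_def strict_sorted_iff)

lemma ext_colsD:
  assumes "jj \<in> ext_cols J"
  shows "length jj = Suc (mat_rank J)" "set jj \<subseteq> {..<n}" "distinct jj"
  using assms by (auto simp: ext_cols_def incr_tuples_def strict_sorted_iff)

lemma finite_incr_tuples: "finite (incr_tuples k N)"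
proof (rule finite_subset[OF _ finite_lists_length_eq[OF finite_lessThan]])
  show "incr_tuples k N \<subseteq> {xs. set xs \<subseteq> {..<N} \<and> length xs = k}" by (auto simp: incr_tuples_def)
qed

lemma finite_generators: "finite (nonsing_rows J \<times> ext_cols J)"
  by (intro finite_cartesian_product)
    (auto intro: finite_subset[OF _ finite_incr_tuples] simp: nonsing_rows_def ext_cols_def)

text \<open>Applying \<open>D\<close> to the equations \<open>bar (f l) = 0\<close> for the rows
  \<open>ii\<close> gives a homogeneous linear system for its values at the variables in
  \<open>jj\<close>; its determinant is a minor that is nonzero by
  \<open>minor_nonsing\<close>.\<close>

lemma derivation_zero_if_free:
  assumes D: "D \<in> Ders" and ii: "ii \<in> nonsing_rows J" and jj: "jj \<in> nonsing_cols J"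
    and free: "\<And>k. k < n \<Longrightarrow> k \<notin> set jj \<Longrightarrow> D (bar (pol_var k)) = 0"
  shows "D = 0"
proof -
  let ?v = "\<lambda>b. D (bar (pol_var (jj ! b)))"
  note I = nonsing_rowsD[OF ii] and C = nonsing_colsD[OF jj]
  have D0: "D 0 = 0" using derivation_mult[OF D, of 0 0] by simp
  have "(\<Sum>b<length jj. J $$ (ii ! a, jj ! b) * ?v b) = 0" if a: "a < length ii" for a
  proof -
    have l: "ii ! a < m" using a I(2) by (metis lessThan_iff nth_mem subsetD)
    have "0 = D (bar (f (ii ! a)))" using D0 bar_f[OF l] by simp
    also have "\<dots> = (\<Sum>k<n. D (bar (pol_var k)) * grad (f (ii ! a)) k)"
      using D f_in[OF l] by (rule derivation_bar)
    also have "\<dots> = (\<Sum>k\<in>set jj. D (bar (pol_var k)) * grad (f (ii ! a)) k)"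
      using C(2) free by (intro sum.mono_neutral_right) auto
    also have "\<dots> = (\<Sum>b<length jj. ?v b * grad (f (ii ! a)) (jj ! b))"
      using C(4) by (intro sum.reindex_bij_betw[symmetric]) (simp add: bij_betw_nth)
    also have "\<dots> = (\<Sum>b<length jj. J $$ (ii ! a, jj ! b) * ?v b)"
      using C(2) l by (intro sum.cong refl) (simp add: J_grad subset_eq mult.commute)
    finally show ?thesis by simp
  qed
  then have v: "?v b = 0" if "b < length jj" for b
    using minor_nonsing[OF J_carrier ii jj] minor_0_iff_cols[of ii jj J] I(1) C(1) that by auto
  have "D (bar (pol_var k)) = 0" if "k < n" for k
    using free[OF that] v by (cases "k \<in> set jj") (auto simp: in_set_conv_nth)
  then show ?thesis
    using derivation_eqI_vars[OF D fmod.subspace_0[OF derivations_subspace]] by simp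
qed

text \<open>On polynomials the formula defines a derivation into A. At \<open>f l\<close> it is the
  Laplace expansion of a minor of size r + 1, which vanishes, so it descends along
  \<open>bar\<close>.\<close>

lemma jacobi_derivation_exists:
  assumes ii: "ii \<in> nonsing_rows J" and cc: "length cc = Suc (mat_rank J)" "set cc \<subseteq> {..<n}"
  shows "\<exists>D. is_jacobi_derivation n bar J ii cc D"
proof -
  note I = nonsing_rowsD[OF ii]
  define c where "c \<nu> = (-1) ^ (length ii + \<nu>) * minor J ii (omit \<nu> cc)" for \<nu>
  define D0 where "D0 g = (\<Sum>\<nu><length cc. c \<nu> * grad g (cc ! \<nu>))" for g
  have add: "D0 (f + g) = D0 f + D0 g" if "f \<in> P" "g \<in> P" for f g
    using that by (simp add: D0_def grad_add distrib_left sum.distrib)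
  have mult: "D0 (f * g) = bar f * D0 g + bar g * D0 f" if "f \<in> P" "g \<in> P" for f g
    using that by (simp add: D0_def grad_mult fscale_def distrib_left sum.distrib sum_distrib_left mult_ac)
  have const: "D0 (pol_const a) = 0" for a
    by (simp add: D0_def grad_def)
  have f: "D0 (f l) = 0" if l: "l < m" for l
  proof -
    have "D0 (f l) = (\<Sum>\<nu><length cc. c \<nu> * J $$ (l, cc ! \<nu>))"
      unfolding D0_def using cc(2) l by (intro sum.cong refl) (simp add: J_grad subset_eq)
    also have "\<dots> = minor J (ii @ [l]) cc"
      using I(1) cc(1) by (simp add: c_def minor_laplace)
    also have "\<dots> = 0" using I cc l by (intro minor_Suc_mat_rank[OF J_carrier]) auto
    finally show ?thesis .
  qed
  have ker: "D0 g = 0" if g: "g \<in> P" "bar g = 0" for g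
  proof -
    obtain a where a: "\<And>l. l < m \<Longrightarrow> a l \<in> P" "g = (\<Sum>l<m. a l * f l)" using kernel[OF g] by blast
    have "D0 (\<Sum>l\<in>A. a l * f l) = 0" if "finite A" "A \<subseteq> {..<m}" for A
      using that
    proof (induction A rule: finite_induct)
      case empty
      then show ?case by (simp add: D0_def)
    next
      case (insert l A)
      have "(\<Sum>l\<in>A. a l * f l) \<in> P" using insert.prems a(1) f_in by (intro pols_in_sum pols_in_mult) auto
      moreover have "a l * f l \<in> P" "a l \<in> P" "f l \<in> P" "l < m"
        using insert.prems a(1) f_in by (auto intro: pols_in_mult)
      ultimately show ?case using insert by (simp add: add mult f bar_f)
    qed
    then show ?thesis unfolding a(2) by simp
  qed
  have "\<exists>D\<in>Ders. \<forall>g\<in>P. D (bar g) = D0 g"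
    using add mult const ker by (rule derivation_lift)
  then show ?thesis
    unfolding is_jacobi_derivation_def carrier_pol_ring D0_def c_def grad_def by blast
qed

abbreviation "\<delta> \<equiv> jacobi_derivation n bar J"

lemma jacobi_derivation:
  assumes "ii \<in> nonsing_rows J" "length cc = Suc (mat_rank J)" "set cc \<subseteq> {..<n}"
  shows "is_jacobi_derivation n bar J ii cc (\<delta> ii cc)"
proof -
  have "D = D'" if "is_jacobi_derivation n bar J ii cc D" "is_jacobi_derivation n bar J ii cc D'" for D D'
    using that unfolding is_jacobi_derivation_def carrier_pol_ring by (intro derivation_eqI) auto
  then show ?thesis
    unfolding jacobi_derivation_def using jacobi_derivation_exists[OF assms] by (metis theI)
qed

lemma jacobi_derivation_Ders:
  "ii \<in> nonsing_rows J \<Longrightarrow> length cc = Suc (mat_rank J) \<Longrightarrow> set cc \<subseteq> {..<n} \<Longrightarrow> \<delta> ii cc \<in> Ders"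
  using jacobi_derivation unfolding is_jacobi_derivation_def by blast

lemma jacobi_derivation_var:
  assumes ii: "ii \<in> nonsing_rows J" and cc: "length cc = Suc (mat_rank J)" "set cc \<subseteq> {..<n}" and k: "k < n"
  shows "\<delta> ii cc (bar (pol_var k)) =
    (\<Sum>\<nu> | \<nu> < length cc \<and> cc ! \<nu> = k. (-1) ^ (mat_rank J + \<nu>) * minor J ii (omit \<nu> cc))"
proof -
  have "pol_var k \<in> carrier (pol_ring n)" using k by (simp add: carrier_pol_ring pol_var_in)
  then have "\<delta> ii cc (bar (pol_var k)) = (\<Sum>\<nu><length cc. (-1) ^ (length ii + \<nu>) * minor J ii (omit \<nu> cc)
      * bar (pol_pderiv (cc ! \<nu>) (pol_var k)))"
    using jacobi_derivation[OF ii cc] unfolding is_jacobi_derivation_def by blast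
  also have "\<dots> = (\<Sum>\<nu><length cc. (-1) ^ (mat_rank J + \<nu>) * minor J ii (omit \<nu> cc) * (if cc ! \<nu> = k then 1 else 0))"
    by (rule sum.cong) (auto simp: pol_pderiv_var nonsing_rowsD(1)[OF ii])
  finally show ?thesis unfolding sum_pred_delta .
qed

lemma jacobi_derivation_var_nth:
  assumes ii: "ii \<in> nonsing_rows J" and cc: "length cc = Suc (mat_rank J)" "set cc \<subseteq> {..<n}"
    and "distinct cc" "\<nu> < length cc"
  shows "\<delta> ii cc (bar (pol_var (cc ! \<nu>))) = (-1) ^ (mat_rank J + \<nu>) * minor J ii (omit \<nu> cc)"
proof -
  have "{\<nu>'. \<nu>' < length cc \<and> cc ! \<nu>' = cc ! \<nu>} = {\<nu>}"
    using assms(4,5) by (auto simp: nth_eq_iff_index_eq)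
  moreover have "cc ! \<nu> < n" using cc(2) assms(5) by (metis lessThan_iff nth_mem subsetD)
  ultimately show ?thesis using jacobi_derivation_var[OF ii cc, of "cc ! \<nu>"] by simp
qed

lemma jacobi_derivation_var_notin:
  assumes "ii \<in> nonsing_rows J" "length cc = Suc (mat_rank J)" "set cc \<subseteq> {..<n}" "k < n" "k \<notin> set cc"
  shows "\<delta> ii cc (bar (pol_var k)) = 0"
proof -
  have none: "{\<nu>. \<nu> < length cc \<and> cc ! \<nu> = k} = {}" using assms(5) by auto
  show ?thesis unfolding jacobi_derivation_var[OF assms(1-4)] none by simp
qed

text \<open>The added column is last, so its sign is (-1)^(r + r) = 1. Thus, on the variables
  outside \<open>jj\<close>, these derivations are dual to the variables up to the minor.\<close>

lemma jacobi_derivation_snoc: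
  assumes ii: "ii \<in> nonsing_rows J" and jj: "jj \<in> nonsing_cols J" and c: "c < n" "c \<notin> set jj"
    and k: "k < n" "k \<notin> set jj"
  shows "\<delta> ii (jj @ [c]) (bar (pol_var k)) = (if k = c then minor J ii jj else 0)"
proof -
  note C = nonsing_colsD[OF jj]
  have cc: "length (jj @ [c]) = Suc (mat_rank J)" "set (jj @ [c]) \<subseteq> {..<n}" "distinct (jj @ [c])"
    using C c by auto
  show ?thesis
  proof (cases "k = c")
    case True
    have "omit (mat_rank J) (jj @ [c]) = jj" using omit_last[of jj c] C(1) by simp
    then show ?thesis
      using True jacobi_derivation_var_nth[OF ii cc, of "mat_rank J"] C(1) by (simp add: nth_append)
  next
    case False
    then show ?thesis using jacobi_derivation_var_notin[OF ii cc(1,2) k(1)] k(2) by simp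
  qed
qed

lemma snoc_Ders:
  assumes "ii \<in> nonsing_rows J" "jj \<in> nonsing_cols J" "c < n"
  shows "\<delta> ii (jj @ [c]) \<in> Ders"
  using assms nonsing_colsD[OF assms(2)] by (intro jacobi_derivation_Ders) auto

text \<open>Both sides are derivations with the same values on the variables outside
  \<open>jj\<close>, by that duality. This one identity yields generation and, for \<open>D\<close>
  a generator, the relations.\<close>

lemma minor_times_derivation:
  assumes D: "D \<in> Ders" and ii: "ii \<in> nonsing_rows J" and jj: "jj \<in> nonsing_cols J"
  shows "fscale (minor J ii jj) D = (\<Sum>k\<in>{..<n} - set jj. fscale (D (bar (pol_var k))) (\<delta> ii (jj @ [k])))"
    (is "?L = ?R")
proof -
  note sub = derivations_subspace[of "\<lambda>c. bar (pol_const c)"]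
  have "?L - ?R = 0"
  proof (rule derivation_zero_if_free[OF _ ii jj])
    show "?L - ?R \<in> Ders"
      using D snoc_Ders[OF ii jj]
      by (intro fmod.subspace_diff fmod.subspace_scale fmod.subspace_sum sub) auto
    fix k assume k: "k < n" "k \<notin> set jj"
    have "?R (bar (pol_var k)) = (\<Sum>c\<in>{..<n} - set jj. D (bar (pol_var c)) * (if k = c then minor J ii jj else 0))"
      unfolding sum_apply fscale_def
      by (rule sum.cong[OF refl]) (simp add: jacobi_derivation_snoc[OF ii jj] k)
    also have "\<dots> = (\<Sum>c\<in>{..<n} - set jj. if k = c then D (bar (pol_var c)) * minor J ii jj else 0)"
      by (rule sum.cong) auto
    also have "\<dots> = D (bar (pol_var k)) * minor J ii jj" using k by simp
    finally show "(?L - ?R) (bar (pol_var k)) = 0" by (simp add: fscale_def mult.commute)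
  qed
  then show ?thesis by simp
qed

text \<open>The attached derivation vanishes at variables outside \<open>jj'\<close>, and at those
  inside its values are the signed minors. This turns \<open>minor_times_derivation\<close> into the
  stated form of the relations.\<close>

lemma sum_ext_cols:
  assumes ii': "ii' \<in> nonsing_rows J" and jj': "jj' \<in> ext_cols J"
  shows "(\<Sum>k\<in>{..<n} - set jj. fscale (\<delta> ii' jj' (bar (pol_var k))) (G k)) =
    (\<Sum>\<nu> \<in> {\<nu>. \<nu> < length jj' \<and> jj' ! \<nu> \<notin> set jj}.
       fscale ((-1) ^ (mat_rank J + \<nu>) * minor J ii' (omit \<nu> jj')) (G (jj' ! \<nu>)))"
proof -
  note C = ext_colsD[OF jj']
  let ?F = "\<lambda>k. fscale (\<delta> ii' jj' (bar (pol_var k))) (G k)"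
  let ?N = "{\<nu>. \<nu> < length jj' \<and> jj' ! \<nu> \<notin> set jj}"
  have "(\<Sum>k\<in>{..<n} - set jj. ?F k) = (\<Sum>k\<in>set jj' - set jj. ?F k)"
    using C(2) jacobi_derivation_var_notin[OF ii' C(1,2)]
    by (intro sum.mono_neutral_right) (auto simp: fscale_def fun_eq_iff)
  also have "\<dots> = (\<Sum>\<nu>\<in>?N. ?F (jj' ! \<nu>))"
  proof (rule sum.reindex_bij_betw[symmetric])
    show "bij_betw ((!) jj') ?N (set jj' - set jj)"
      using C(3) by (auto simp: bij_betw_def inj_on_def nth_eq_iff_index_eq in_set_conv_nth)
  qed
  also have "\<dots> = (\<Sum>\<nu>\<in>?N. fscale ((-1) ^ (mat_rank J + \<nu>) * minor J ii' (omit \<nu> jj')) (G (jj' ! \<nu>)))"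
    by (rule sum.cong) (simp_all add: jacobi_derivation_var_nth[OF ii' C])
  finally show ?thesis .
qed

lemma relator_eq:
  assumes "ii' \<in> nonsing_rows J" "jj' \<in> ext_cols J"
  shows "relator J ii jj ii' jj' = fscale (minor J ii jj) (free_gen ii' jj') -
    (\<Sum>k\<in>{..<n} - set jj. fscale (\<delta> ii' jj' (bar (pol_var k))) (signed_gen ii (jj @ [k])))"
  unfolding sum_ext_cols[OF assms] relator_def nonsing_rowsD(1)[OF assms(1)] ..

text \<open>The entry \<open>k\<close> moves from the end to position \<open>pos\<close> and passes
  the r - pos larger entries; these are all the inversions. Omitting it again gives
  \<open>jj\<close>, hence membership in \<open>ext_cols\<close>.\<close>

lemma sort_snoc:
  assumes jj: "jj \<in> nonsing_cols J" and k: "k < n" "k \<notin> set jj"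
  obtains pos where "pos \<le> mat_rank J" "sort (jj @ [k]) \<in> ext_cols J"
    "sort (jj @ [k]) ! pos = k" "omit pos (sort (jj @ [k])) = jj"
    "card {(a, b). a < b \<and> b < length (jj @ [k]) \<and> (jj @ [k]) ! b < (jj @ [k]) ! a} = mat_rank J - pos"
proof -
  note C = nonsing_colsD[OF jj]
  define pos where "pos = length (takeWhile (\<lambda>x. x < k) jj)"
  have pos: "pos \<le> length jj" unfolding pos_def by (rule length_takeWhile_le)
  have lt: "jj ! a < k" if "a < pos" for a
    using that nth_mem[of a "takeWhile (\<lambda>x. x < k) jj"] unfolding pos_def
    by (auto simp: takeWhile_nth dest: set_takeWhileD)
  have gt: "k < jj ! a" if "pos \<le> a" "a < length jj" for a
  proof -
    have "\<not> jj ! pos < k" using nth_length_takeWhile[of "\<lambda>x. x < k" jj] that unfolding pos_def by simp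
    moreover have "jj ! pos \<le> jj ! a"
      using C(3) that by (cases "pos = a") (auto simp: sorted_wrt_iff_nth_less less_imp_le)
    moreover have "jj ! a \<noteq> k" using k(2) that by auto
    ultimately show ?thesis by simp
  qed
  let ?xs = "take pos jj @ k # drop pos jj"
  have take_lt: "x < k" if "x \<in> set (take pos jj)" for x
    using that lt pos by (auto simp: in_set_conv_nth)
  have drop_gt: "k < x" if "x \<in> set (drop pos jj)" for x
    using that gt pos by (auto simp: in_set_conv_nth)
  have sj: "sorted jj" using C(3) by (simp add: strict_sorted_iff)
  have "sorted ?xs"
    using take_lt drop_gt sj
    by (auto simp: sorted_append sorted_wrt_take sorted_wrt_drop intro: less_imp_le less_trans dest: less_trans)
  moreover have "mset (jj @ [k]) = mset ?xs"
  proof -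
    have "mset jj = mset (take pos jj) + mset (drop pos jj)" by (metis append_take_drop_id mset_append)
    then show ?thesis by simp
  qed
  ultimately have sort: "sort (jj @ [k]) = ?xs" using properties_for_sort[of ?xs "jj @ [k]"] by simp
  have nth: "?xs ! pos = k" using pos by (simp add: nth_append)
  have om: "omit pos ?xs = jj" using pos by (simp add: omit_def)
  have "sort (jj @ [k]) \<in> incr_tuples (mat_rank J + 1) n"
    using C k by (auto simp: incr_tuples_def strict_sorted_iff)
  then have ext: "sort (jj @ [k]) \<in> ext_cols J"
    unfolding ext_cols_def sort using om jj pos C(1) by (auto intro!: exI[of _ pos])
  have "{(a, b). a < b \<and> b < length (jj @ [k]) \<and> (jj @ [k]) ! b < (jj @ [k]) ! a} = (\<lambda>a. (a, length jj)) ` {pos..<length jj}"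
    (is "?S = ?T")
  proof (rule subset_antisym; rule subsetI)
    fix x assume "x \<in> ?S"
    then obtain a b where x: "x = (a, b)" "a < b" "b \<le> length jj" "(jj @ [k]) ! b < (jj @ [k]) ! a" by auto
    have b: "b = length jj"
    proof (rule ccontr)
      assume "b \<noteq> length jj"
      then have "b < length jj" using x by simp
      then have "jj ! b < jj ! a" "jj ! a < jj ! b" using x C(3) by (auto simp: nth_append sorted_wrt_iff_nth_less)
      then show False by simp
    qed
    then have "k < jj ! a" using x by (simp add: nth_append)
    then have "\<not> a < pos" using lt[of a] by auto
    then show "x \<in> ?T" using x b by auto
  next
    fix x assume "x \<in> ?T"
    then show "x \<in> ?S" using gt by (auto simp: nth_append)
  qed
  then have "card {(a, b). a < b \<and> b < length (jj @ [k]) \<and> (jj @ [k]) ! b < (jj @ [k]) ! a} = mat_rank J - pos"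
    using C(1) by (simp add: card_image inj_on_def)
  then show thesis using that[of pos] pos C(1) ext nth om unfolding sort by simp
qed

section \<open>The map from the free module onto combinations of generators, and its kernel\<close>

definition eval_gens :: "(nat list \<times> nat list \<Rightarrow> 'a) \<Rightarrow> 'a \<Rightarrow> 'a" where
  "eval_gens c = (\<Sum>x \<in> nonsing_rows J \<times> ext_cols J. fscale (c x) (\<delta> (fst x) (snd x)))"

lemma eval_gens_add: "eval_gens (c + d) = eval_gens c + eval_gens d"
  by (simp add: eval_gens_def fmod.scale_left_distrib sum.distrib)

lemma eval_gens_scale: "eval_gens (fscale a c) = fscale a (eval_gens c)"
proof -
  have "fscale (fscale a c x) D = fscale a (fscale (c x) D)" for x and D :: "'a \<Rightarrow> 'a"
    by (simp add: fscale_def mult.assoc)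
  then show ?thesis by (simp add: eval_gens_def fmod.scale_sum_right)
qed

lemma eval_gens_0: "eval_gens 0 = 0"
  using eval_gens_scale[of 0 0] by simp

lemma eval_gens_diff: "eval_gens (c - d) = eval_gens c - eval_gens d"
  using eval_gens_add[of "c - d" d] by simp

lemma eval_gens_sum: "eval_gens (sum c A) = (\<Sum>i\<in>A. eval_gens (c i))"
  by (induction A rule: infinite_finite_induct) 
    (simp_all only: sum.infinite sum.empty sum.insert eval_gens_0 eval_gens_add not_False_eq_True)

lemma eval_gens_free:
  assumes "ii \<in> nonsing_rows J" "jj \<in> ext_cols J"
  shows "eval_gens (free_gen ii jj) = \<delta> ii jj"
proof -
  have "fscale (free_gen ii jj x) (\<delta> (fst x) (snd x)) = (if x = (ii, jj) then \<delta> ii jj else 0)" for x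
    by (simp add: free_gen_def)
  then show ?thesis using assms finite_generators by (simp add: eval_gens_def)
qed

text \<open>Two derivations are compared on the variables outside \<open>jj\<close>, where only x_k
  gives nonzero values; there the claim is an identity of signs.\<close>

lemma eval_gens_signed:
  assumes ii: "ii \<in> nonsing_rows J" and jj: "jj \<in> nonsing_cols J" and k: "k < n" "k \<notin> set jj"
  shows "eval_gens (signed_gen ii (jj @ [k])) = \<delta> ii (jj @ [k])"
proof -
  let ?r = "mat_rank J" and ?cc = "sort (jj @ [k])"
  note C = nonsing_colsD[OF jj]
  obtain pos where pos: "pos \<le> ?r" "?cc \<in> ext_cols J" "?cc ! pos = k" "omit pos ?cc = jj"
    "card {(a, b). a < b \<and> b < length (jj @ [k]) \<and> (jj @ [k]) ! b < (jj @ [k]) ! a} = ?r - pos"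
    using sort_snoc[OF jj k] .
  note E = ext_colsD[OF pos(2)]
  let ?L = "fscale ((-1) ^ (?r - pos)) (\<delta> ii ?cc)"
  have "?L - \<delta> ii (jj @ [k]) = 0"
  proof (rule derivation_zero_if_free[OF _ ii jj])
    show "?L - \<delta> ii (jj @ [k]) \<in> Ders"
      using snoc_Ders[OF ii jj k(1)] jacobi_derivation_Ders[OF ii E(1,2)]
      by (intro fmod.subspace_diff fmod.subspace_scale derivations_subspace)
    fix k' assume k': "k' < n" "k' \<notin> set jj"
    show "(?L - \<delta> ii (jj @ [k])) (bar (pol_var k')) = 0"
    proof (cases "k' = k")
      case True
      have "\<delta> ii ?cc (bar (pol_var k)) = (-1) ^ (?r + pos) * minor J ii jj"
        using jacobi_derivation_var_nth[OF ii E, of pos] pos E(1) by simp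
      moreover have "(-1) ^ (?r - pos) * (-1) ^ (?r + pos) = (1 :: 'a)"
        \<comment> \<open>The inversions contribute r - pos and the expansion at \<open>pos\<close>
          contributes r + pos, in total the even number 2r.\<close>
        using pos(1) by (simp flip: power_add)
      then have "(-1) ^ (?r - pos) * ((-1) ^ (?r + pos) * minor J ii jj) = minor J ii jj"
        by (simp flip: mult.assoc)
      ultimately show ?thesis
        using True jacobi_derivation_snoc[OF ii jj k k] by (simp add: fscale_def)
    next
      case False
      then have "k' \<notin> set ?cc" using k' by simp
      then show ?thesis
        using False jacobi_derivation_snoc[OF ii jj k k'] jacobi_derivation_var_notin[OF ii E(1,2) k'(1)]
        by (simp add: fscale_def)
    qed
  qed
  then show ?thesis
    unfolding signed_gen_def pos(5) by (simp add: eval_gens_scale eval_gens_free[OF ii pos(2)])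
qed

lemma eval_gens_relator:
  assumes ii: "ii \<in> nonsing_rows J" and jj: "jj \<in> nonsing_cols J"
    and ii': "ii' \<in> nonsing_rows J" and jj': "jj' \<in> ext_cols J"
  shows "eval_gens (relator J ii jj ii' jj') = 0"
proof -
  note E = ext_colsD[OF jj']
  have "eval_gens (relator J ii jj ii' jj') = fscale (minor J ii jj) (\<delta> ii' jj') -
     (\<Sum>k\<in>{..<n} - set jj. fscale (\<delta> ii' jj' (bar (pol_var k))) (\<delta> ii (jj @ [k])))"
    unfolding relator_eq[OF ii' jj'] eval_gens_diff eval_gens_scale eval_gens_sum eval_gens_free[OF ii' jj']
    by (rule arg_cong2[of _ _ _ _ minus, OF refl], rule sum.cong[OF refl])
      (simp add: eval_gens_signed[OF ii jj])
  then show ?thesis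
    using minor_times_derivation[OF jacobi_derivation_Ders[OF ii' E(1,2)] ii jj] by simp
qed

lemma relator_support:
  assumes ii: "ii \<in> nonsing_rows J" and jj: "jj \<in> nonsing_cols J"
    and ii': "ii' \<in> nonsing_rows J" and jj': "jj' \<in> ext_cols J"
    and x: "x \<notin> nonsing_rows J \<times> ext_cols J"
  shows "relator J ii jj ii' jj' x = 0"
proof -
  have free: "free_gen a b x = (0 :: 'a)" if "a \<in> nonsing_rows J" "b \<in> ext_cols J" for a b
    using that x by (auto simp: free_gen_def)
  have "signed_gen ii (jj @ [k]) x = (0 :: 'a)" if k: "k \<in> {..<n} - set jj" for k
  proof -
    have "sort (jj @ [k]) \<in> ext_cols J" using sort_snoc[OF jj, of k] k by (metis DiffD1 DiffD2 lessThan_iff)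
    then show ?thesis using free[OF ii] by (simp add: signed_gen_def fscale_def)
  qed
  then show ?thesis
    unfolding relator_eq[OF ii' jj'] by (simp add: free[OF ii' jj'] sum_apply fscale_def)
qed

text \<open>In the sum of the relators weighted by \<open>c\<close>, the first terms add up to the
  minor times \<open>c\<close>. The coefficient of each signed generator is the value at x_k of the
  derivation that \<open>c\<close> represents, which is 0.\<close>

lemma minor_times_syzygy:
  assumes ii: "ii \<in> nonsing_rows J" and jj: "jj \<in> nonsing_cols J"
    and c: "\<And>x. x \<notin> nonsing_rows J \<times> ext_cols J \<Longrightarrow> c x = 0" and ev: "eval_gens c = 0"
  shows "fscale (minor J ii jj) c =
    (\<Sum>x \<in> nonsing_rows J \<times> ext_cols J. fscale (c x) (relator J ii jj (fst x) (snd x)))"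
proof -
  let ?G = "nonsing_rows J \<times> ext_cols J" and ?K = "{..<n} - set jj"
  let ?s = "\<lambda>k. signed_gen ii (jj @ [k])"
  have c_sum: "(\<Sum>x\<in>?G. fscale (c x) (free_gen (fst x) (snd x))) = c"
  proof
    fix y
    have "fscale (c x) (free_gen (fst x) (snd x)) y = (if x = y then c x else 0)" for x
      by (auto simp: fscale_def free_gen_def)
    then show "(\<Sum>x\<in>?G. fscale (c x) (free_gen (fst x) (snd x))) y = c y"
      using c[of y] finite_generators by (simp add: sum_apply)
  qed
  have 1: "(\<Sum>x\<in>?G. c x * \<delta> (fst x) (snd x) (bar (pol_var k))) = 0" for k
    using fun_cong[OF ev, of "bar (pol_var k)"] by (simp add: eval_gens_def sum_apply fscale_def)
  have "(\<Sum>x\<in>?G. fscale (c x) (relator J ii jj (fst x) (snd x))) =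
    (\<Sum>x\<in>?G. fscale (minor J ii jj) (fscale (c x) (free_gen (fst x) (snd x))) -
      (\<Sum>k\<in>?K. fscale (c x * \<delta> (fst x) (snd x) (bar (pol_var k))) (?s k)))"
  proof (rule sum.cong[OF refl])
    fix x assume "x \<in> ?G"
    then show "fscale (c x) (relator J ii jj (fst x) (snd x)) =
      fscale (minor J ii jj) (fscale (c x) (free_gen (fst x) (snd x))) -
      (\<Sum>k\<in>?K. fscale (c x * \<delta> (fst x) (snd x) (bar (pol_var k))) (?s k))"
      by (subst relator_eq)
        (auto simp: fmod.scale_right_diff_distrib fmod.scale_sum_right mult.commute)
  qed
  also have "\<dots> = fscale (minor J ii jj) c -
     (\<Sum>x\<in>?G. \<Sum>k\<in>?K. fscale (c x * \<delta> (fst x) (snd x) (bar (pol_var k))) (?s k))"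
    by (simp only: sum_subtractf c_sum fmod.scale_sum_right[symmetric])
  also have "(\<Sum>x\<in>?G. \<Sum>k\<in>?K. fscale (c x * \<delta> (fst x) (snd x) (bar (pol_var k))) (?s k)) =
     (\<Sum>k\<in>?K. fscale (\<Sum>x\<in>?G. c x * \<delta> (fst x) (snd x) (bar (pol_var k))) (?s k))"
    by (subst sum.swap) (simp add: fmod.scale_sum_left)
  also have "\<dots> = 0" by (simp add: 1)
  finally show ?thesis by simp
qed

text \<open>The scalars that carry \<open>v\<close> into \<open>W\<close> form an ideal containing
  all these minors. By regularity no prime contains all of them, so the ideal contains 1.\<close>

lemma in_subspace_if_minors:
  fixes v :: "'b \<Rightarrow> 'a"
  assumes K: "CHAR('k) > 0" "perfect_field TYPE('k)" and reg: "regular_ring (ring_of_type_algebra :: 'a ring)"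
    and W: "fmod.subspace W"
    and minors: "\<And>ii jj. ii \<in> nonsing_rows J \<Longrightarrow> jj \<in> nonsing_cols J \<Longrightarrow> fscale (minor J ii jj) v \<in> W"
  shows "v \<in> W"
proof (rule ccontr)
  assume v: "v \<notin> W"
  let ?A = "{a. fscale a v \<in> W}"
  obtain p where p: "prime_set p" "?A \<subseteq> p"
  proof (rule ideal_in_prime[of ?A])
    show "0 \<in> ?A" using fmod.subspace_0[OF W] by simp
    show "a + b \<in> ?A" if "a \<in> ?A" "b \<in> ?A" for a b
      using that fmod.subspace_add[OF W] by (simp add: fmod.scale_left_distrib)
    show "a * b \<in> ?A" if "b \<in> ?A" for a b
      using that fmod.subspace_scale[OF W, of "fscale b v" a] by simp
    show "1 \<notin> ?A" using v by simp
  qed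
  obtain ii jj where "ii \<in> nonsing_rows J" "jj \<in> nonsing_cols J" "minor J ii jj \<notin> p"
    using regular_minor_notin_prime[OF K reg p(1)] .
  then show False using minors p(2) by blast
qed

lemma span_jacobi_derivations:
  assumes K: "CHAR('k) > 0" "perfect_field TYPE('k)" and reg: "regular_ring (ring_of_type_algebra :: 'a ring)"
  shows "fmod.span {\<delta> ii jj |ii jj. ii \<in> nonsing_rows J \<and> jj \<in> ext_cols J} = Ders" (is "?S = _")
proof
  show "?S \<subseteq> Ders"
    using ext_colsD jacobi_derivation_Ders by (intro fmod.span_minimal derivations_subspace) blast
  show "Ders \<subseteq> ?S"
  proof
    fix D assume D: "D \<in> Ders"
    show "D \<in> ?S"
    proof (rule in_subspace_if_minors[OF K reg fmod.subspace_span])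
      fix ii jj assume ii: "ii \<in> nonsing_rows J" and jj: "jj \<in> nonsing_cols J"
      have "\<delta> ii (jj @ [k]) \<in> ?S" if k: "k \<in> {..<n} - set jj" for k
      proof -
        have k': "k < n" "k \<notin> set jj" using k by auto
        \<comment> \<open>The derivation with column \<open>k\<close> appended is, up to sign, the
          generator of the sorted tuple.\<close>
        have "sort (jj @ [k]) \<in> ext_cols J" using sort_snoc[OF jj k'] by metis
        then have "fscale s (\<delta> ii (sort (jj @ [k]))) \<in> ?S" for s
          using ii by (intro fmod.span_scale fmod.span_base) blast
        then show ?thesis
          unfolding eval_gens_signed[OF ii jj k', symmetric] signed_gen_def eval_gens_scale
            eval_gens_free[OF ii \<open>sort (jj @ [k]) \<in> ext_cols J\<close>] .
      qed
      then show "fscale (minor J ii jj) D \<in> ?S"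
        unfolding minor_times_derivation[OF D ii jj] by (intro fmod.span_sum fmod.span_scale)
    qed
  qed
qed

lemma syzygies_eq_relators:
  assumes K: "CHAR('k) > 0" "perfect_field TYPE('k)" and reg: "regular_ring (ring_of_type_algebra :: 'a ring)"
  shows "{c. (\<forall>x. x \<notin> nonsing_rows J \<times> ext_cols J \<longrightarrow> c x = 0) \<and> eval_gens c = 0} =
    fmod.span {relator J ii jj ii' jj' |ii jj ii' jj'.
      ii \<in> nonsing_rows J \<and> ii' \<in> nonsing_rows J \<and> jj \<in> nonsing_cols J \<and> jj' \<in> ext_cols J}"
    (is "?Z = fmod.span ?B")
proof
  have "fmod.subspace ?Z"
    by (rule fmod.subspaceI)
      (simp_all add: eval_gens_0 eval_gens_add eval_gens_scale, simp add: fscale_def)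
  moreover have "?B \<subseteq> ?Z" using eval_gens_relator relator_support by blast
  ultimately show "fmod.span ?B \<subseteq> ?Z" by (intro fmod.span_minimal)
  show "?Z \<subseteq> fmod.span ?B"
  proof
    fix c assume "c \<in> ?Z"
    then have c: "\<And>x. x \<notin> nonsing_rows J \<times> ext_cols J \<Longrightarrow> c x = 0" "eval_gens c = 0" by auto
    show "c \<in> fmod.span ?B"
    proof (rule in_subspace_if_minors[OF K reg fmod.subspace_span])
      fix ii jj assume ij: "ii \<in> nonsing_rows J" "jj \<in> nonsing_cols J"
      have "relator J ii jj (fst x) (snd x) \<in> fmod.span ?B" if "x \<in> nonsing_rows J \<times> ext_cols J" for x
        using that ij by (intro fmod.span_base) (auto simp: mem_Times_iff)
      then have "(\<Sum>x \<in> nonsing_rows J \<times> ext_cols J. fscale (c x) (relator J ii jj (fst x) (snd x)))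
          \<in> fmod.span ?B"
        by (intro fmod.span_sum fmod.span_scale)
      then show "fscale (minor J ii jj) c \<in> fmod.span ?B"
        using minor_times_syzygy[OF ij c] by simp
    qed
  qed
qed

end

section \<open>Localizations of quotients of polynomial algebras\<close>

lemma (in ideal) FactRing_carrierE:
  assumes "F \<in> carrier (R Quot I)"
  obtains g where "g \<in> carrier R" "F = I +> g"
  using assms by (auto simp: FactRing_def A_RCOSETS_def')

text \<open>With 0 as a denominator all fractions coincide. This excludes 0 from \<open>S\<close>,
  since the localization is isomorphic to a ring in which 0 and 1 differ.\<close>

lemma localization_trivial:
  fixes R (structure)
  assumes "cring R" "S \<subseteq> carrier R" "\<zero> \<in> S"
    and xy: "x \<in> carrier (localization R S)" "y \<in> carrier (localization R S)"
  shows "x = y"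
proof -
  interpret cring R by fact
  have "z = carrier R \<times> S" if z: "z \<in> carrier (localization R S)" for z
  proof -
    obtain a s where as: "z = loc_rel R S `` {(a, s)}" "a \<in> carrier R" "s \<in> S"
      using z by (auto simp: localization_def quotient_def)
    have "\<exists>u\<in>S. u \<otimes> (a \<otimes> t \<ominus> b \<otimes> s) = \<zero>" if "b \<in> carrier R" "t \<in> S" for b t
      using that as assms(2,3) by (intro bexI[of _ \<zero>]) (auto simp: subsetD)
    then show ?thesis unfolding as(1) loc_rel_def using as(2,3) by auto
  qed
  then show ?thesis using xy by blast
qed

lemma pol_ring_simps [simp]:
  "x \<otimes>\<^bsub>pol_ring n\<^esub> y = x * y" "x \<oplus>\<^bsub>pol_ring n\<^esub> y = x + y"
  "\<one>\<^bsub>pol_ring n\<^esub> = 1" "\<zero>\<^bsub>pol_ring n\<^esub> = 0"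
  by (simp_all add: pol_ring_def)

lemma genideal_pol_ring:
  fixes f :: "nat \<Rightarrow> 'k::field mpol"
  assumes R: "cring (pol_ring n :: 'k mpol ring)" and f: "\<And>l. l < m \<Longrightarrow> f l \<in> pols_in {..<n}"
    and g: "g \<in> genideal (pol_ring n) (f ` {..<m})"
  shows "\<exists>c. (\<forall>l<m. c l \<in> pols_in {..<n}) \<and> g = (\<Sum>l<m. c l * f l)"
proof -
  let ?R = "pol_ring n :: 'k mpol ring"
  interpret R: cring ?R by (rule R)
  let ?W = "{\<Sum>l<m. c l * f l |c. \<forall>l<m. c l \<in> pols_in {..<n}}"
  have "ideal ?W ?R"
  proof (rule cring_ideal_from_closure[OF R])
    show "?W \<subseteq> carrier ?R"
      using f by (auto simp: carrier_pol_ring intro!: pols_in_sum pols_in_mult)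
    have "(\<Sum>l<m. (\<lambda>_. 0) l * f l) \<in> ?W" by (rule CollectI, rule exI[of _ "\<lambda>_. 0"]) simp
    then show "?W \<noteq> {}" by blast
  next
    fix a b assume "a \<in> ?W" "b \<in> ?W"
    then obtain c d where "a = (\<Sum>l<m. c l * f l)" "b = (\<Sum>l<m. d l * f l)"
      "\<forall>l<m. c l \<in> pols_in {..<n}" "\<forall>l<m. d l \<in> pols_in {..<n}" by blast
    then show "a \<oplus>\<^bsub>?R\<^esub> b \<in> ?W"
      by (intro CollectI exI[of _ "\<lambda>l. c l + d l"]) (simp add: distrib_right sum.distrib pols_in_add)
  next
    fix a x assume "a \<in> ?W" "x \<in> carrier ?R"
    then obtain c where "a = (\<Sum>l<m. c l * f l)" "\<forall>l<m. c l \<in> pols_in {..<n}" "x \<in> pols_in {..<n}"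
      unfolding carrier_pol_ring by blast
    then show "x \<otimes>\<^bsub>?R\<^esub> a \<in> ?W"
      by (intro CollectI exI[of _ "\<lambda>l. x * c l"]) (simp add: sum_distrib_left mult.assoc pols_in_mult)
  qed
  moreover have "f ` {..<m} \<subseteq> ?W"
  proof safe
    fix l assume l: "l < m"
    have "(if i = l then 1 else 0) * f i = (if i = l then f i else 0)" for i by simp
    then have "f l = (\<Sum>i<m. (if i = l then 1 else 0) * f i)" using l by simp
    then show "\<exists>c. f l = (\<Sum>l<m. c l * f l) \<and> (\<forall>l<m. c l \<in> pols_in {..<n})"
      by (intro exI[of _ "\<lambda>i. if i = l then 1 else 0"]) simp
  qed
  ultimately have "genideal ?R (f ` {..<m}) \<subseteq> ?W" by (rule R.genideal_minimal)
  then show ?thesis using g by blast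
qed

lemma jacobian_algebra_localization:
  fixes f :: "nat \<Rightarrow> 'k::field mpol"
    and h :: "('k mpol set \<times> 'k mpol set) set \<Rightarrow> 'a::idom"
  assumes f: "\<forall>i<m. f i \<in> carrier (pol_ring n)"
    and I: "I = genideal (pol_ring n) (f ` {..<m})" and prime: "primeideal I (pol_ring n)"
    and S: "submonoid S (pol_ring n Quot I)"
    and h: "h \<in> ring_iso (localization (pol_ring n Quot I) S) (ring_of_type_algebra :: 'a ring)"
    and bar: "bar = (\<lambda>g. h (loc_frac (pol_ring n Quot I) S
               (I +>\<^bsub>pol_ring n\<^esub> g) \<one>\<^bsub>pol_ring n Quot I\<^esub>))"
    and J: "J = mat m n (\<lambda>(i, j). bar (pol_pderiv j (f i)))"
  shows "jacobian_algebra n bar m f J"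
proof -
  interpret I: primeideal I "pol_ring n" by (rule prime)
  let ?Q = "pol_ring n Quot I" and ?L = "localization (pol_ring n Quot I) S"
  interpret Q: domain ?Q by (rule I.quotient_is_domain)
  interpret S: submonoid S ?Q by (rule S)
  let ?q = "\<lambda>g. I +>\<^bsub>pol_ring n\<^esub> g"
  have hom: "h \<in> Ring.ring_hom ?L ring_of_type_algebra" and bij: "bij_betw h (carrier ?L) UNIV"
    using h by (auto simp: ring_iso_def)
  have surj: "\<exists>x\<in>carrier ?L. h x = a" for a
    using bij unfolding bij_betw_def by (metis UNIV_I imageE)
  have inj: "inj_on h (carrier ?L)" using bij unfolding bij_betw_def by simp
  have S0: "\<zero>\<^bsub>?Q\<^esub> \<notin> S"
  proof
    assume "\<zero>\<^bsub>?Q\<^esub> \<in> S"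
    then have triv: "x = y" if "x \<in> carrier ?L" "y \<in> carrier ?L" for x y
      using localization_trivial[OF Q.cring_axioms S.subset] that by blast
    obtain x y where "x \<in> carrier ?L" "h x = 0" "y \<in> carrier ?L" "h y = 1"
      using surj[of 0] surj[of 1] by blast
    then show False using triv[of x y] by simp
  qed
  note SS = S S0
  have q_hom: "?q \<in> Ring.ring_hom (pol_ring n) ?Q" by (rule I.rcos_ring_hom)
  have q_closed: "?q g \<in> carrier ?Q" if "g \<in> pols_in {..<n}" for g
    using ring_hom_closed[OF q_hom] that by (simp add: carrier_pol_ring)
  have q_add: "?q (f + g) = ?q f \<oplus>\<^bsub>?Q\<^esub> ?q g" if "f \<in> pols_in {..<n}" "g \<in> pols_in {..<n}" for f g
    using ring_hom_add[OF q_hom, of f g] that by (simp add: carrier_pol_ring)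
  have q_mult: "?q (f * g) = ?q f \<otimes>\<^bsub>?Q\<^esub> ?q g" if "f \<in> pols_in {..<n}" "g \<in> pols_in {..<n}" for f g
    using ring_hom_mult[OF q_hom, of f g] that by (simp add: carrier_pol_ring)
  have q_1: "?q 1 = \<one>\<^bsub>?Q\<^esub>" using ring_hom_one[OF q_hom] by simp
  have q_surj: "\<exists>g\<in>pols_in {..<n}. F = ?q g" if "F \<in> carrier ?Q" for F
    using I.FactRing_carrierE[OF that] by (metis carrier_pol_ring)
  let ?fr = "loc_frac ?Q S"
  have fr_closed: "?fr F s \<in> carrier ?L" if "F \<in> carrier ?Q" "s \<in> S" for F s
    using that by (auto simp: Q.carrier_localization)
  have h_mult: "h (?fr F s) * h (?fr G t) = h (?fr (F \<otimes>\<^bsub>?Q\<^esub> G) (s \<otimes>\<^bsub>?Q\<^esub> t))"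
    if "F \<in> carrier ?Q" "G \<in> carrier ?Q" "s \<in> S" "t \<in> S" for F G s t
    using ring_hom_mult[OF hom fr_closed[OF that(1,3)] fr_closed[OF that(2,4)]]
      Q.localization_mult[OF SS that] by simp
  have h_one: "h (?fr \<one>\<^bsub>?Q\<^esub> \<one>\<^bsub>?Q\<^esub>) = 1"
    using ring_hom_one[OF hom] by (simp add: localization_def)
  have bar_q: "bar g = h (?fr (?q g) \<one>\<^bsub>?Q\<^esub>)" for g by (simp add: bar)
  interpret B: presented_algebra n bar
  proof
    fix f g :: "'k mpol" assume fg: "f \<in> pols_in {..<n}" "g \<in> pols_in {..<n}"
    note c = q_closed[OF fg(1)] q_closed[OF fg(2)]
    show "bar (f * g) = bar f * bar g"
      unfolding bar_q q_mult[OF fg] using h_mult[OF c S.one_closed S.one_closed] by simp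
    have "bar f + bar g = h (?fr (?q f) \<one>\<^bsub>?Q\<^esub> \<oplus>\<^bsub>?L\<^esub> ?fr (?q g) \<one>\<^bsub>?Q\<^esub>)"
      unfolding bar_q using ring_hom_add[OF hom fr_closed[OF c(1) S.one_closed] fr_closed[OF c(2) S.one_closed]] by simp
    also have "\<dots> = bar (f + g)"
      unfolding bar_q q_add[OF fg] Q.localization_add[OF SS c S.one_closed S.one_closed] using c by simp
    finally show "bar (f + g) = bar f + bar g" by simp
  next
    show "bar 1 = 1" unfolding bar_q q_1 by (rule h_one)
  next
    fix a
    obtain x where "x \<in> carrier ?L" "a = h x" using surj[of a] by blast
    then obtain F s where Fs: "F \<in> carrier ?Q" "s \<in> S" "a = h (?fr F s)"
      unfolding Q.carrier_localization by blast
    have sQ: "s \<in> carrier ?Q" using Fs(2) S.subset by blast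
    obtain g where g: "g \<in> pols_in {..<n}" "F = ?q g" using q_surj[OF Fs(1)] by blast
    obtain \<sigma> where \<sigma>: "\<sigma> \<in> pols_in {..<n}" "s = ?q \<sigma>" using q_surj[OF sQ] by blast
    have "a * bar \<sigma> = h (?fr (F \<otimes>\<^bsub>?Q\<^esub> s) (s \<otimes>\<^bsub>?Q\<^esub> \<one>\<^bsub>?Q\<^esub>))"
      unfolding Fs(3) bar_q \<sigma>(2)[symmetric] using Fs sQ by (intro h_mult) simp_all
    also have "?fr (F \<otimes>\<^bsub>?Q\<^esub> s) (s \<otimes>\<^bsub>?Q\<^esub> \<one>\<^bsub>?Q\<^esub>) = ?fr F \<one>\<^bsub>?Q\<^esub>"
      using Q.loc_frac_eq[OF SS, of "F \<otimes>\<^bsub>?Q\<^esub> s" F s "\<one>\<^bsub>?Q\<^esub>"] Fs sQ by simp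
    finally have "a * bar \<sigma> = bar g" by (simp add: bar_q g(2))
    moreover have "h (?fr \<one>\<^bsub>?Q\<^esub> s) * bar \<sigma> = h (?fr (\<one>\<^bsub>?Q\<^esub> \<otimes>\<^bsub>?Q\<^esub> s) (s \<otimes>\<^bsub>?Q\<^esub> \<one>\<^bsub>?Q\<^esub>))"
      unfolding bar_q \<sigma>(2)[symmetric] using Fs sQ by (intro h_mult) simp_all
    moreover have "?fr (\<one>\<^bsub>?Q\<^esub> \<otimes>\<^bsub>?Q\<^esub> s) (s \<otimes>\<^bsub>?Q\<^esub> \<one>\<^bsub>?Q\<^esub>) = ?fr \<one>\<^bsub>?Q\<^esub> \<one>\<^bsub>?Q\<^esub>"
      using Q.loc_frac_eq[OF SS, of "s" "\<one>\<^bsub>?Q\<^esub>" s "\<one>\<^bsub>?Q\<^esub>"] Fs sQ by simp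
    ultimately show "\<exists>g\<in>pols_in {..<n}. \<exists>s\<in>pols_in {..<n}. \<exists>t. a * bar s = bar g \<and> t * bar s = 1"
      using g(1) \<sigma>(1) h_one by metis
  qed
  have fP: "f l \<in> pols_in {..<n}" if "l < m" for l using f that by (simp add: carrier_pol_ring)
  have zero: "?q 0 = \<zero>\<^bsub>?Q\<^esub>" 
    using I.a_rcos_const additive_subgroup.zero_closed[OF I.is_additive_subgroup] by (simp add: FactRing_def)
  show ?thesis
  proof
    show "f l \<in> pols_in {..<n}" if "l < m" for l by (rule fP[OF that])
  next
    fix l assume l: "l < m"
    have "f ` {..<m} \<subseteq> I" unfolding I using f by (intro I.genideal_self) auto
    then have "?q (f l) = I" using l by (intro I.a_rcos_const) auto
    then have "?q (f l) = ?q 0" using zero by (simp add: FactRing_def)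
    then show "bar (f l) = 0" using B.bar_0 by (simp add: bar_q)
  next
    fix g :: "'k mpol" assume g: "g \<in> pols_in {..<n}" "bar g = 0"
    have "h (?fr (?q g) \<one>\<^bsub>?Q\<^esub>) = h (?fr (?q 0) \<one>\<^bsub>?Q\<^esub>)" using g(2) B.bar_0 by (simp add: bar_q)
    then have "?fr (?q g) \<one>\<^bsub>?Q\<^esub> = ?fr (?q 0) \<one>\<^bsub>?Q\<^esub>"
      by (rule inj_onD[OF inj]) (simp_all add: fr_closed q_closed g(1))
    \<comment> \<open>The quotient by the prime ideal is a domain and \<open>S\<close> avoids 0, so
      the map to the localization is injective; hence the kernel of \<open>bar\<close> is exactly
      \<open>I\<close>.\<close>
    then have "?q g = ?q 0"
      using Q.loc_frac_eq[OF SS, of "?q g" "?q 0" "\<one>\<^bsub>?Q\<^esub>" "\<one>\<^bsub>?Q\<^esub>"] g(1) q_closed by simp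
    then have "?q g = I" using zero by (simp add: FactRing_def)
    then have "g \<in> I" using I.rcos_const_imp_mem g(1) by (simp add: carrier_pol_ring)
    then show "\<exists>c. (\<forall>l<m. c l \<in> pols_in {..<n}) \<and> g = (\<Sum>l<m. c l * f l)"
      unfolding I by (intro genideal_pol_ring I.is_cring fP)
  next
    show "J = mat m n (\<lambda>(i, j). bar (pol_pderiv j (f i)))" by (rule J)
  qed
qed

theorem theorem1p1:
  fixes n m :: nat
    and f :: "nat \<Rightarrow> 'k::field mpol"
    and I :: "'k mpol set"
    and S :: "'k mpol set set"
    and h :: "('k mpol set \<times> 'k mpol set) set \<Rightarrow> 'a::idom"
    and bar :: "'k mpol \<Rightarrow> 'a"
    and J :: "'a mat"
    and r :: nat
    and \<delta> :: "nat list \<Rightarrow> nat list \<Rightarrow> 'a \<Rightarrow> 'a"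
  assumes "CHAR('k) > 0" and "perfect_field TYPE('k)"
    and "\<forall>i<m. f i \<in> carrier (pol_ring n)"
    and "I = genideal (pol_ring n) (f ` {..<m})"
    and "primeideal I (pol_ring n)" and "\<not> maximalideal I (pol_ring n)"
    and "submonoid S (pol_ring n Quot I)"
    and "h \<in> ring_iso (localization (pol_ring n Quot I) S) (ring_of_type_algebra :: 'a ring)"
    and "regular_ring (ring_of_type_algebra :: 'a ring)"
    and "bar = (\<lambda>g. h (loc_frac (pol_ring n Quot I) S
               (I +>\<^bsub>pol_ring n\<^esub> g) \<one>\<^bsub>pol_ring n Quot I\<^esub>))"
    and "J = mat m n (\<lambda>(i, j). bar (pol_pderiv j (f i)))"
    and "r = mat_rank J"
    and "\<delta> = jacobi_derivation n bar J"
  shows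
    "(\<forall>ii \<in> nonsing_rows J. \<forall>cc. length cc = r + 1 \<and> distinct cc \<and> set cc \<subseteq> {..<n} \<longrightarrow>
        is_jacobi_derivation n bar J ii cc (\<delta> ii cc)) \<and>
     fmod.span {\<delta> ii jj |ii jj. ii \<in> nonsing_rows J \<and> jj \<in> ext_cols J}
       = derivations (\<lambda>c. bar (pol_const c)) \<and>
     (\<forall>ii \<in> nonsing_rows J. \<forall>ii' \<in> nonsing_rows J. \<forall>jj \<in> nonsing_cols J. \<forall>jj' \<in> ext_cols J.
        fscale (minor J ii jj) (\<delta> ii' jj') =
        (\<Sum>\<nu> \<in> {\<nu>. \<nu> < r + 1 \<and> jj' ! \<nu> \<notin> set jj}.
           fscale ((-1) ^ (r + \<nu>) * minor J ii' (omit \<nu> jj')) (\<delta> ii (jj @ [jj' ! \<nu>])))) \<and>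
     {c :: nat list \<times> nat list \<Rightarrow> 'a.
        (\<forall>x. x \<notin> nonsing_rows J \<times> ext_cols J \<longrightarrow> c x = 0) \<and>
        (\<Sum>x \<in> nonsing_rows J \<times> ext_cols J. fscale (c x) (\<delta> (fst x) (snd x))) = 0}
       = fmod.span {relator J ii jj ii' jj' |ii jj ii' jj'.
           ii \<in> nonsing_rows J \<and> ii' \<in> nonsing_rows J \<and> jj \<in> nonsing_cols J \<and> jj' \<in> ext_cols J}"
proof -
  interpret jacobian_algebra n bar m f J
    using assms(3-5,7,8,10,11) by (rule jacobian_algebra_localization)
  note K = assms(1,2) and reg = assms(9) and \<delta> = assms(13)
  show ?thesis
    unfolding \<delta> assms(12)
  proof (intro conjI ballI allI impI)
    fix ii cc assume "ii \<in> nonsing_rows J" "length cc = mat_rank J + 1 \<and> distinct cc \<and> set cc \<subseteq> {..<n}"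
    then show "is_jacobi_derivation n bar J ii cc (jacobi_derivation n bar J ii cc)"
      by (intro jacobi_derivation) auto
  next
    show "fmod.span {jacobi_derivation n bar J ii jj |ii jj. ii \<in> nonsing_rows J \<and> jj \<in> ext_cols J} =
        derivations (\<lambda>c. bar (pol_const c))"
      by (rule span_jacobi_derivations[OF K reg])
  next
    fix ii ii' jj jj'
    assume a: "ii \<in> nonsing_rows J" "ii' \<in> nonsing_rows J" "jj \<in> nonsing_cols J" "jj' \<in> ext_cols J"
    note E = ext_colsD[OF a(4)]
    show "fscale (minor J ii jj) (jacobi_derivation n bar J ii' jj') =
      (\<Sum>\<nu> \<in> {\<nu>. \<nu> < mat_rank J + 1 \<and> jj' ! \<nu> \<notin> set jj}.
        fscale ((-1) ^ (mat_rank J + \<nu>) * minor J ii' (omit \<nu> jj'))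
          (jacobi_derivation n bar J ii (jj @ [jj' ! \<nu>])))"
      using minor_times_derivation[OF jacobi_derivation_Ders[OF a(2) E(1,2)] a(1,3)]
        sum_ext_cols[OF a(2,4), where jj = jj and G = "\<lambda>k. jacobi_derivation n bar J ii (jj @ [k])"] E(1)
      by simp
  next
    show "{c. (\<forall>x. x \<notin> nonsing_rows J \<times> ext_cols J \<longrightarrow> c x = 0) \<and>
        (\<Sum>x \<in> nonsing_rows J \<times> ext_cols J. fscale (c x) (jacobi_derivation n bar J (fst x) (snd x))) = 0}
      = fmod.span {relator J ii jj ii' jj' |ii jj ii' jj'.
          ii \<in> nonsing_rows J \<and> ii' \<in> nonsing_rows J \<and> jj \<in> nonsing_cols J \<and> jj' \<in> ext_cols J}"
      using syzygies_eq_relators[OF K reg] unfolding eval_gens_def .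
  qed
qed

end
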